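(* Let $D$ be a twisted link diagram and let $\tilde D$ be a double covering diagram of $D$. Then the twisted link group $\tilde\Pi(D)$ of $D$ is (isomorphic to) the (upper) virtual link group $\Pi(\tilde D)$ of $\tilde D$.
   Context: **Diagrams.** A twisted link diagram is an oriented link diagram in $\mathbb R^2$ in which each double point is either a real crossing (with over/under information) or a virtual crossing (encircled, without over/under information), and which may carry finitely many bars; a bar is a small edge meeting an arc of the diagram transversely, away from double points. A virtual link diagram is one without bars. **Double covering diagram.** Let $r:\mathbb R^2\to\mathbb R^2$, $(x,y)\mapsto(-x,y)$, let $c$ be the operation switching over/under information at every real crossing, and let $s=c\circ r$ on twisted link diagrams. Let $h(x,y)=y$. A twisted link diagram $D$ is in general position with respect to $h$ if (1) the critical points of $h|_D$ are maximal or minimal points, (2) $h$ is injective on the set consisting of the critical points of $h|_D$, the real crossings, the virtual crossings and the intersections of $D$ with bars, and (3) the image under $h$ of each bar is a point. Given $D$, move it by an isotopy of $\mathbb R^2$ into $\{x>0\}$ and into general position. Let $l_1,\dots,l_n$ be the horizontal lines containing the bars, with thin horizontal neighbourhoods $N(l_i)$ in which $s(D)\cup D$ has no critical points of $h$, crossings or bars other than the two mirror-symmetric bars on $l_i$. In each $N(l_i)$ delete the two bars and replace the two barred arcs, located at horizontal positions $\pm p_i$, by two arcs monotone in $h$, one joining the bottom endpoint at $p_i$ to the top endpoint at $-p_i$ and the other joining the bottom endpoint at $-p_i$ to the top endpoint at $p_i$; all other arcs in $N(l_i)$ are kept and all crossings arising in $N(l_i)$ are virtual. The resulting virtual link diagram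 $\tilde D$ is called a double covering diagram of $D$. **Groups.** A semi-arc of a diagram is one of the pieces obtained by cutting the diagram at all real crossings and all bars (virtual crossings are ignored). To each semi-arc $a$ assign symbols $x_a$ and $y_a$. At a real crossing $c$, let the over strand arrive along semi-arc $a$ and leave along $a'$, and the under strand arrive along $b$ and leave along $b'$. If $c$ is positive (the over direction followed by the under direction is a positive basis of $\mathbb R^2$), upper-rel$(c)$ is $\{x_{a'}=x_a,\ x_{b'}=x_a^{-1}x_bx_a\}$ and lower-rel$(c)$ is $\{y_{a'}=y_b^{-1}y_ay_b,\ y_{b'}=y_b\}$. If $c$ is negative, upper-rel$(c)$ is $\{x_{a'}=x_a,\ x_{b'}=x_ax_bx_a^{-1}\}$ and lower-rel$(c)$ is $\{y_{a'}=y_by_ay_b^{-1},\ y_{b'}=y_b\}$. At a bar $b$ where semi-arc $a$ arrives and $a'$ leaves, bar-rel$(b)$ is $\{x_{a'}=y_a,\ y_{a'}=x_a\}$. The twisted link group $\tilde\Pi(D)$ is the group with generators $x_a,y_a$ for all semi-arcs $a$, and relations upper-rel$(c)$, lower-rel$(c)$ for all real crossings $c$, and bar-rel$(b)$ for all bars $b$. For a virtual link diagram $D$, the (upper) virtual link group $\Pi(D)$ is the group with generators $x_a$ and relations upper-rel$(c)$ for all real crossings $c$. *)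

theory Defs
  imports "HOL-Analysis.Analysis" "HOL-Algebra.Group"
begin

section \<open>Groups given by generators and relations\<close>

datatype 'g letter = Gen 'g | Inv 'g

definition words :: "'g set \<Rightarrow> 'g letter list set" where
  "words X = lists (Gen ` X \<union> Inv ` X)"

text \<open>
  A relation \<open>l = r\<close> is a pair \<open>(l, r)\<close> of words.  The congruence below is the one on words over
  \<open>X\<close> generated by free cancellation and by the relations in \<open>R\<close>.
\<close>

inductive word_cong :: "'g set \<Rightarrow> ('g letter list \<times> 'g letter list) set \<Rightarrow>
    'g letter list \<Rightarrow> 'g letter list \<Rightarrow> bool"
  for X R where
  refl: "w \<in> words X \<Longrightarrow> word_cong X R w w"
| sym: "word_cong X R v w \<Longrightarrow> word_cong X R w v"
| trans: "word_cong X R u v \<Longrightarrow> word_cong X R v w \<Longrightarrow> word_cong X R u w"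
| cancel_right: "u \<in> words X \<Longrightarrow> v \<in> words X \<Longrightarrow> g \<in> X \<Longrightarrow>
    word_cong X R (u @ [Gen g, Inv g] @ v) (u @ v)"
| cancel_left: "u \<in> words X \<Longrightarrow> v \<in> words X \<Longrightarrow> g \<in> X \<Longrightarrow>
    word_cong X R (u @ [Inv g, Gen g] @ v) (u @ v)"
| relator: "u \<in> words X \<Longrightarrow> v \<in> words X \<Longrightarrow> (l, r) \<in> R \<Longrightarrow> l \<in> words X \<Longrightarrow> r \<in> words X \<Longrightarrow>
    word_cong X R (u @ l @ v) (u @ r @ v)"

definition presented_group :: "'g set \<Rightarrow> ('g letter list \<times> 'g letter list) set \<Rightarrow>
    'g letter list set monoid" where
  "presented_group X R =
    \<lparr>carrier = words X // {(v, w). word_cong X R v w},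
     mult = (\<lambda>A B. \<Union>a\<in>A. \<Union>b\<in>B. {w. word_cong X R (a @ b) w}),
     one = {w. word_cong X R [] w}\<rparr>"

lemma words_Nil [simp]: "[] \<in> words X"
  and words_append [simp]: "u @ v \<in> words X \<longleftrightarrow> u \<in> words X \<and> v \<in> words X"
  and words_Gen [simp]: "Gen g # u \<in> words X \<longleftrightarrow> g \<in> X \<and> u \<in> words X"
  and words_Inv [simp]: "Inv g # u \<in> words X \<longleftrightarrow> g \<in> X \<and> u \<in> words X"
  by (auto simp: words_def)

lemma word_cong_words: "word_cong X R v w \<Longrightarrow> v \<in> words X \<and> w \<in> words X"
  by (induction rule: word_cong.induct) auto

lemma word_cong_context:
  "word_cong X R v w \<Longrightarrow> p \<in> words X \<Longrightarrow> q \<in> words X \<Longrightarrow> word_cong X R (p @ v @ q) (p @ w @ q)"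
proof (induction rule: word_cong.induct)
  case (cancel_right u v g)
  then show ?case using word_cong.cancel_right[of "p @ u" X "v @ q" g R] by simp
next
  case (cancel_left u v g)
  then show ?case using word_cong.cancel_left[of "p @ u" X "v @ q" g R] by simp
next
  case (relator u v l r)
  then show ?case using word_cong.relator[of "p @ u" X "v @ q" l r R] by simp
qed (auto intro: word_cong.intros)

lemma word_cong_append:
  assumes "word_cong X R a a'" "word_cong X R b b'"
  shows "word_cong X R (a @ b) (a' @ b')"
  using word_cong_context[OF assms(1), of "[]" b] word_cong_context[OF assms(2), of a' "[]"]
    word_cong_words[OF assms(1)] word_cong_words[OF assms(2)] word_cong.trans by fastforce

definition word_class :: "'g set \<Rightarrow> ('g letter list \<times> 'g letter list) set \<Rightarrow>
    'g letter list \<Rightarrow> 'g letter list set" where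
  "word_class X R v = {w. word_cong X R v w}"

lemma word_class_eq_iff:
  "v \<in> words X \<Longrightarrow> w \<in> words X \<Longrightarrow> word_class X R v = word_class X R w \<longleftrightarrow> word_cong X R v w"
  unfolding word_class_def using word_cong.intros(1-3) by (metis (no_types, lifting) Collect_cong mem_Collect_eq)

lemma carrier_presented_group: "carrier (presented_group X R) = word_class X R ` words X"
  by (auto simp: presented_group_def quotient_def word_class_def)

lemma one_presented_group: "\<one>\<^bsub>presented_group X R\<^esub> = word_class X R []"
  by (simp add: presented_group_def word_class_def)

lemma mult_presented_group:
  assumes "v \<in> words X" "w \<in> words X"
  shows "word_class X R v \<otimes>\<^bsub>presented_group X R\<^esub> word_class X R w = word_class X R (v @ w)"
proof -
  have "word_cong X R (v @ w) z" if "word_cong X R v a" "word_cong X R w b" "word_cong X R (a @ b) z" for a b z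
    using that word_cong_append word_cong.trans by metis
  then show ?thesis
    using assms by (fastforce simp: presented_group_def word_class_def intro: word_cong.refl)
qed

fun inv_letter :: "'g letter \<Rightarrow> 'g letter" where
  "inv_letter (Gen g) = Inv g"
| "inv_letter (Inv g) = Gen g"

lemma word_left_inverse:
  "w \<in> words X \<Longrightarrow> rev (map inv_letter w) \<in> words X \<and> word_cong X R (rev (map inv_letter w) @ w) []"
proof (induction w)
  case Nil
  show ?case by (simp add: word_cong.refl)
next
  case (Cons x w)
  then have w: "w \<in> words X" by (cases x) auto
  have "word_cong X R (rev (map inv_letter w) @ [inv_letter x, x] @ w) (rev (map inv_letter w) @ w)"
    using Cons w by (cases x) (auto intro: word_cong.cancel_right word_cong.cancel_left simp del: append.simps)
  then show ?case
    using Cons w word_cong.trans by (cases x) fastforce+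
qed

lemma group_presented_group: "group (presented_group X R)"
proof (rule groupI)
  fix A assume "A \<in> carrier (presented_group X R)"
  then obtain w where w: "w \<in> words X" "A = word_class X R w"
    by (auto simp: carrier_presented_group)
  then show "\<exists>B\<in>carrier (presented_group X R). B \<otimes>\<^bsub>presented_group X R\<^esub> A = \<one>\<^bsub>presented_group X R\<^esub>"
    using word_left_inverse[OF w(1), of R]
    by (intro bexI[of _ "word_class X R (rev (map inv_letter w))"])
      (auto simp: carrier_presented_group mult_presented_group one_presented_group word_class_eq_iff)
qed (auto simp: carrier_presented_group mult_presented_group one_presented_group)


section \<open>Twisted link diagrams\<close>

text \<open>
  The plane is \<open>complex\<close>, with coordinates \<open>Re\<close>, \<open>Im\<close>.  A diagram is a \<open>C\<^sup>1\<close> immersion of a disjoint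
  union of \<open>n\<close> circles; the point \<open>z\<close> of the \<open>i\<close>-th circle (\<open>i < n\<close>, \<open>z\<close> on the unit circle) is the
  pair \<open>(i, z)\<close>, and the circles are oriented anticlockwise.  A double point of the plane is
  recorded by the two points of the circles over it.  A real crossing is the pair
  \<open>(over preimage, under preimage)\<close>; the double points not listed are the virtual crossings.
  A bar is a subset of the plane.
\<close>

type_synonym point = "nat \<times> complex"

record diagram =
  ncircles :: nat
  curve :: "point \<Rightarrow> complex"
  real_crossings :: "(point \<times> point) set"
  bars :: "complex set set"

definition source :: "diagram \<Rightarrow> point set" where
  "source D = {..<ncircles D} \<times> sphere 0 1"

definition shift :: "point \<Rightarrow> real \<Rightarrow> point" where
  "shift p t = (fst p, snd p * cis t)"

definition velocity :: "diagram \<Rightarrow> point \<Rightarrow> complex" where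
  "velocity D p = vector_derivative (\<lambda>t. curve D (shift p t)) (at 0)"

definition double_points :: "diagram \<Rightarrow> (point \<times> point) set" where
  "double_points D = {(p, q). p \<in> source D \<and> q \<in> source D \<and> p \<noteq> q \<and> curve D p = curve D q}"

text \<open>\<open>orientation u v\<close> is the determinant of \<open>(u, v)\<close>; it is positive iff \<open>(u, v)\<close> is a positive basis.\<close>

definition orientation :: "complex \<Rightarrow> complex \<Rightarrow> real" where
  "orientation u v = Re u * Im v - Im u * Re v"

definition is_bar :: "diagram \<Rightarrow> complex set \<Rightarrow> bool" where
  "is_bar D B \<longleftrightarrow> (\<exists>\<beta>. arc \<beta> \<and> \<beta> C1_differentiable_on {0..1} \<and>
     (\<forall>s\<in>{0..1}. vector_derivative \<beta> (at s) \<noteq> 0) \<and> B = path_image \<beta> \<and>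
     (\<exists>p s. {q \<in> source D. curve D q \<in> B} = {p} \<and> s \<in> {0<..<1} \<and> \<beta> s = curve D p \<and>
        orientation (velocity D p) (vector_derivative \<beta> (at s)) \<noteq> 0))"

definition twisted_link_diagram :: "diagram \<Rightarrow> bool" where
  "twisted_link_diagram D \<longleftrightarrow>
     (\<forall>i<ncircles D. (\<lambda>t. curve D (i, cis t)) C1_differentiable_on UNIV) \<and>
     (\<forall>p\<in>source D. velocity D p \<noteq> 0) \<and>
     finite (double_points D) \<and>
     (\<forall>p q q'. (p, q) \<in> double_points D \<longrightarrow> (p, q') \<in> double_points D \<longrightarrow> q = q') \<and>
     (\<forall>(p, q)\<in>double_points D. orientation (velocity D p) (velocity D q) \<noteq> 0) \<and>
     real_crossings D \<subseteq> double_points D \<and>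
     (\<forall>p q. (p, q) \<in> real_crossings D \<longrightarrow> (q, p) \<notin> real_crossings D) \<and>
     finite (bars D) \<and> (\<forall>B\<in>bars D. is_bar D B) \<and> pairwise disjnt (bars D)"

definition virtual_link_diagram :: "diagram \<Rightarrow> bool" where
  "virtual_link_diagram D \<longleftrightarrow> twisted_link_diagram D \<and> bars D = {}"

definition bar_point :: "diagram \<Rightarrow> complex set \<Rightarrow> point" where
  "bar_point D B = (THE p. p \<in> source D \<and> curve D p \<in> B)"


section \<open>The groups\<close>

definition semi_arcs :: "diagram \<Rightarrow> point set set" where
  "semi_arcs D = components (source D - (fst ` real_crossings D \<union> snd ` real_crossings D \<union> bar_point D ` bars D))"

definition arrives :: "diagram \<Rightarrow> point \<Rightarrow> point set \<Rightarrow> bool" where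
  "arrives D p a \<longleftrightarrow> a \<in> semi_arcs D \<and> (\<forall>\<^sub>F t in at_right 0. shift p (- t) \<in> a)"

definition leaves :: "diagram \<Rightarrow> point \<Rightarrow> point set \<Rightarrow> bool" where
  "leaves D p a \<longleftrightarrow> a \<in> semi_arcs D \<and> (\<forall>\<^sub>F t in at_right 0. shift p t \<in> a)"

definition positive_crossing :: "diagram \<Rightarrow> point \<times> point \<Rightarrow> bool" where
  "positive_crossing D = (\<lambda>(p, q). orientation (velocity D p) (velocity D q) > 0)"

datatype 'a symbol = X 'a | Y 'a

type_synonym relation = "point set symbol letter list \<times> point set symbol letter list"

definition upper_rel :: "diagram \<Rightarrow> point \<times> point \<Rightarrow> relation set" where
  "upper_rel D = (\<lambda>(p, q). \<Union>{
     {([Gen (X a')], [Gen (X a)]),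
      ([Gen (X b')], if positive_crossing D (p, q)
                     then [Inv (X a), Gen (X b), Gen (X a)]
                     else [Gen (X a), Gen (X b), Inv (X a)])}
     | a a' b b'. arrives D p a \<and> leaves D p a' \<and> arrives D q b \<and> leaves D q b'})"

definition lower_rel :: "diagram \<Rightarrow> point \<times> point \<Rightarrow> relation set" where
  "lower_rel D = (\<lambda>(p, q). \<Union>{
     {([Gen (Y a')], if positive_crossing D (p, q)
                     then [Inv (Y b), Gen (Y a), Gen (Y b)]
                     else [Gen (Y b), Gen (Y a), Inv (Y b)]),
      ([Gen (Y b')], [Gen (Y b)])}
     | a a' b b'. arrives D p a \<and> leaves D p a' \<and> arrives D q b \<and> leaves D q b'})"

definition bar_rel :: "diagram \<Rightarrow> complex set \<Rightarrow> relation set" where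
  "bar_rel D B = \<Union>{
     {([Gen (X a')], [Gen (Y a)]), ([Gen (Y a')], [Gen (X a)])}
     | a a'. arrives D (bar_point D B) a \<and> leaves D (bar_point D B) a'}"

definition twisted_link_group :: "diagram \<Rightarrow> point set symbol letter list set monoid" where
  "twisted_link_group D = presented_group (X ` semi_arcs D \<union> Y ` semi_arcs D)
     ((\<Union>c\<in>real_crossings D. upper_rel D c \<union> lower_rel D c) \<union> (\<Union>B\<in>bars D. bar_rel D B))"

definition virtual_link_group :: "diagram \<Rightarrow> point set symbol letter list set monoid" where
  "virtual_link_group D = presented_group (X ` semi_arcs D) (\<Union>c\<in>real_crossings D. upper_rel D c)"


section \<open>Isotopy, symmetry and general position\<close>

text \<open>A \<open>C\<^sup>1\<close> isotopy of the plane, starting at the identity.\<close>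

definition plane_isotopy :: "(real \<Rightarrow> complex \<Rightarrow> complex) \<Rightarrow> bool" where
  "plane_isotopy H \<longleftrightarrow> H 0 = id \<and> (\<forall>t\<in>{0..1}. bij (H t)) \<and>
     continuous_on ({0..1} \<times> UNIV) (\<lambda>(t, z). H t z) \<and>
     (\<exists>H' :: real \<Rightarrow> complex \<Rightarrow> complex \<Rightarrow>\<^sub>L complex.
        (\<forall>t\<in>{0..1}. \<forall>z. (H t has_derivative blinfun_apply (H' t z)) (at z) \<and> bij (blinfun_apply (H' t z))) \<and>
        continuous_on ({0..1} \<times> UNIV) (\<lambda>(t, z). H' t z))"

definition map_diagram :: "(complex \<Rightarrow> complex) \<Rightarrow> diagram \<Rightarrow> diagram" where
  "map_diagram f D = D\<lparr>curve := f \<circ> curve D, bars := (`) f ` bars D\<rparr>"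

definition reflect :: "complex \<Rightarrow> complex" where
  "reflect z = Complex (- Re z) (Im z)"

definition switch_crossings :: "diagram \<Rightarrow> diagram" where
  "switch_crossings D = D\<lparr>real_crossings := (real_crossings D)\<inverse>\<rparr>"

definition mirror :: "diagram \<Rightarrow> diagram" where
  "mirror D = switch_crossings (map_diagram reflect D)"

definition in_right_half_plane :: "diagram \<Rightarrow> bool" where
  "in_right_half_plane D \<longleftrightarrow> curve D ` source D \<union> \<Union>(bars D) \<subseteq> {z. Re z > 0}"

text \<open>The height function \<open>h(x, y) = y\<close> is \<open>Im\<close>.\<close>

definition critical_points :: "diagram \<Rightarrow> point set" where
  "critical_points D = {p \<in> source D. Im (velocity D p) = 0}"

definition local_extremum :: "diagram \<Rightarrow> point \<Rightarrow> bool" where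
  "local_extremum D p \<longleftrightarrow>
     (\<forall>\<^sub>F t in nhds 0. Im (curve D (shift p t)) \<le> Im (curve D p)) \<or>
     (\<forall>\<^sub>F t in nhds 0. Im (curve D (shift p t)) \<ge> Im (curve D p))"

definition general_position :: "diagram \<Rightarrow> bool" where
  "general_position D \<longleftrightarrow>
     (\<forall>p\<in>critical_points D. local_extremum D p) \<and>
     inj_on Im (curve D ` (critical_points D \<union> fst ` double_points D \<union> bar_point D ` bars D)) \<and>
     (\<forall>B\<in>bars D. \<exists>y. Im ` B = {y})"


section \<open>Double covering diagrams\<close>

text \<open>
  Oriented plane curves are compared through the set of their points together with the unit tangent
  vectors there.  For an immersion with transverse double points this set determines the curve up
  to orientation-preserving reparametrisation, and \<open>strand D\<close> is injective on the circles.
\<close>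

definition strand :: "diagram \<Rightarrow> point \<Rightarrow> complex \<times> complex" where
  "strand D p = (curve D p, sgn (velocity D p))"

definition strip :: "real \<Rightarrow> real \<Rightarrow> complex set" where
  "strip lo hi = {z. lo \<le> Im z \<and> Im z \<le> hi}"

text \<open>
  \<open>strip lo hi\<close> is a neighbourhood \<open>N(l)\<close> of the line \<open>l\<close> containing the bar \<open>B\<close> of \<open>D\<close>.  (If \<open>D\<close> lies
  in \<open>{x > 0}\<close> then \<open>D\<close> and \<open>mirror D\<close> are disjoint, so their union has no further crossings.)
\<close>

definition thin_strip :: "diagram \<Rightarrow> complex set \<Rightarrow> real \<Rightarrow> real \<Rightarrow> bool" where
  "thin_strip D B lo hi \<longleftrightarrow> Im ` B \<subseteq> {lo<..<hi} \<and>
     (\<forall>E\<in>{D, mirror D}.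
        (\<forall>p\<in>critical_points E \<union> fst ` double_points E. curve E p \<notin> strip lo hi) \<and>
        (\<forall>B'\<in>bars E. B' \<noteq> B \<and> B' \<noteq> reflect ` B \<longrightarrow> B' \<inter> strip lo hi = {}))"

definition barred_arc :: "diagram \<Rightarrow> complex set \<Rightarrow> real \<Rightarrow> real \<Rightarrow> point set" where
  "barred_arc D B lo hi =
     connected_component_set {p \<in> source D. curve D p \<in> strip lo hi} (bar_point D B)"

text \<open>
  A connecting arc \<open>e\<close> is parametrised upwards on \<open>{0..1}\<close>; its orientation as part of the diagram is
  upwards or downwards according to the sign \<open>\<sigma>\<close>.
\<close>

definition monotone_arc :: "(real \<Rightarrow> complex) \<Rightarrow> complex \<Rightarrow> complex \<Rightarrow> bool" where
  "monotone_arc e u v \<longleftrightarrow> e C1_differentiable_on {0..1} \<and>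
     (\<forall>s\<in>{0..1}. vector_derivative e (at s) \<noteq> 0) \<and>
     strict_mono_on {0..1} (\<lambda>s. Im (e s)) \<and> e 0 = u \<and> e 1 = v"

definition arc_strands :: "real \<Rightarrow> (real \<Rightarrow> complex) \<Rightarrow> (complex \<times> complex) set" where
  "arc_strands \<sigma> e = (\<lambda>s. (e s, \<sigma> *\<^sub>R sgn (vector_derivative e (at s)))) ` {0..1}"

text \<open>
  \<open>Dt\<close> arises from the union of \<open>D\<close> and \<open>mirror D\<close> by exchanging, in the strip at every bar \<open>B\<close>, the
  barred arc of \<open>D\<close> and its mirror image for two arcs: \<open>e B\<close>, from the bottom endpoint of the
  barred arc of \<open>D\<close> to the top endpoint of its mirror image, and \<open>f B\<close>, from the bottom endpoint of
  the mirror image to the top endpoint on \<open>D\<close>.  The disjointness conditions say that the new arcs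
  nowhere run along each other or along the curves that are kept.  By the last condition, the
  crossings of \<open>Dt\<close> that do not come from \<open>D\<close> or \<open>mirror D\<close> are virtual.
\<close>

definition covering_surgery :: "diagram \<Rightarrow> diagram \<Rightarrow> bool" where
  "covering_surgery D Dt \<longleftrightarrow> (\<exists>lo hi e f.
     (\<forall>B\<in>bars D. thin_strip D B (lo B) (hi B)) \<and>
     pairwise (\<lambda>B B'. disjnt (strip (lo B) (hi B)) (strip (lo B') (hi B'))) (bars D) \<and>
     (\<forall>B\<in>bars D. \<exists>p\<in>barred_arc D B (lo B) (hi B). \<exists>q\<in>barred_arc D B (lo B) (hi B).
        Im (curve D p) = lo B \<and> Im (curve D q) = hi B \<and>
        monotone_arc (e B) (curve D p) (reflect (curve D q)) \<and>
        monotone_arc (f B) (reflect (curve D p)) (curve D q)) \<and>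
     (let \<sigma> = (\<lambda>B. sgn (Im (velocity D (bar_point D B))));
          E = (\<lambda>B. arc_strands (\<sigma> B) (e B));
          F = (\<lambda>B. arc_strands (\<sigma> B) (f B));
          kept = (\<Union>D'\<in>{D, mirror D}.
                    strand D' ` source D - (\<Union>B\<in>bars D. strand D' ` barred_arc D B (lo B) (hi B)))
      in (\<forall>B\<in>bars D. disjnt (E B) (F B) \<and> disjnt kept (E B \<union> F B)) \<and>
         strand Dt ` source Dt = kept \<union> (\<Union>B\<in>bars D. E B \<union> F B)) \<and>
     map_prod (strand Dt) (strand Dt) ` real_crossings Dt =
       (\<Union>D'\<in>{D, mirror D}. map_prod (strand D') (strand D') ` real_crossings D'))"

definition double_covering_diagram :: "diagram \<Rightarrow> diagram \<Rightarrow> bool" where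
  "double_covering_diagram D Dt \<longleftrightarrow> virtual_link_diagram Dt \<and>
     (\<exists>H. plane_isotopy H \<and>
        (let D' = map_diagram (H 1) D
         in in_right_half_plane D' \<and> general_position D' \<and> covering_surgery D' Dt))"

end

(*
  A C1 isotopy changes neither the semi-arcs nor the signs of the crossings, so one may assume that
  D lies in {x > 0} and in general position.  Points together with unit tangents embed the circles of
  D, of its mirror image and of Dt in the space C x C, and there the image of Dt is a union of the
  kept parts of the first two and of the connecting arcs.  Off the crossings each semi-arc a of D gives
  a semi-arc of Dt on either side; x_a is sent to the one on the side of D and y_a to the one on the
  side of the mirror image.  Two such symbols have the same image exactly when the bar relations
  identify them: a function of the symbols that is invariant under the bar relations is locally
  constant on Dt minus its crossings.  Reflection together with switching preserves the sign of a
  crossing but exchanges the roles of the strands, so it turns lower relations into upper ones.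
*)

theory Submission
  imports Defs
begin

section \<open>Group presentations\<close>

text \<open>\<open>covering_surgery\<close> gives \<open>Dt\<close> only as a set of points with
  tangents: no parametrisation of its circles and no correspondence with those of \<open>D\<close>.
  The correspondence is recovered by compactness: \<open>strand\<close> is injective and continuous
  on a compact space, hence a homeomorphism onto its image, so components and limits can be taken
  there. Unit tangents also decide the direction of travel, without which arriving and leaving
  semi-arcs could be interchanged. The correspondence is partial, as the interior of a barred arc is
  cut out; its two halves are collapsed to its ends, which is continuous away from the bar. No
  inverse homomorphism is constructed. A semi-arc of \<open>Dt\<close> may run through many
  connecting arcs, alternating between the sides; instead of an induction along it, the class of a
  symbol in the twisted link group serves as the invariant labelling, and connectedness does the
  rest.\<close>

lemma words_map_letter: "w \<in> words A \<Longrightarrow> map (map_letter f) w \<in> words (f ` A)"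
proof (induction w)
  case (Cons x w)
  then show ?case by (cases x) auto
qed simp

lemma words_map_letterE:
  assumes "w' \<in> words (f ` A)"
  obtains w where "w \<in> words A" "map (map_letter f) w = w'"
proof -
  have "\<exists>w\<in>words A. map (map_letter f) w = w'"
    using assms
  proof (induction w')
    case (Cons x w')
    then obtain w where w: "w \<in> words A" "map (map_letter f) w = w'"
      by (cases x) auto
    have "\<exists>y \<in> Gen ` A \<union> Inv ` A. map_letter f y = x"
      using Cons.prems by (cases x) (auto simp: bex_Un)
    then obtain y where "y \<in> Gen ` A \<union> Inv ` A" "map_letter f y = x" by blast
    with w show ?case by (intro bexI[of _ "y # w"]) auto
  qed simp
  then show thesis using that by blast
qed

text \<open>The fibre condition of the next lemma speaks of generators only; words with inverse
  letters need this consequence. It comes from the word \<open>Inv s, Gen s, Inv s'\<close>, by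
  cancelling directly or after replacing \<open>Gen s\<close>.\<close>

lemma word_cong_Inv:
  assumes "word_cong A R [Gen s] [Gen s']"
  shows "word_cong A R [Inv s] [Inv s']"
proof -
  have s: "s \<in> A" "s' \<in> A" using word_cong_words[OF assms] by auto
  have "word_cong A R [Inv s, Gen s', Inv s'] [Inv s]"
    using word_cong.cancel_right[of "[Inv s]" A "[]" s' R] s by simp
  moreover have "word_cong A R [Inv s, Gen s, Inv s'] [Inv s, Gen s', Inv s']"
    using word_cong_context[OF assms, of "[Inv s]" "[Inv s']"] s by simp
  moreover have "word_cong A R [Inv s, Gen s, Inv s'] [Inv s']"
    using word_cong.cancel_left[of "[]" A "[Inv s']" s R] s by simp
  ultimately show ?thesis by (meson word_cong.sym word_cong.trans)
qed

text \<open>A Tietze argument in one step: identifying generators that are already congruent does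
  not change the group. Relations of the source only have to hold in the target, while every
  relation of the target must be the image of one in the source, so that derivations can be
  lifted.\<close>

lemma presented_group_isoI:
  fixes f :: "'g \<Rightarrow> 'h"
  assumes onto: "f ` A = A'"
    and fibre: "\<And>s s'. s \<in> A \<Longrightarrow> s' \<in> A \<Longrightarrow> f s = f s' \<Longrightarrow> word_cong A R [Gen s] [Gen s']"
    and rel: "\<And>l r. (l, r) \<in> R \<Longrightarrow> l \<in> words A \<Longrightarrow> r \<in> words A \<Longrightarrow>
      word_cong A' R' (map (map_letter f) l) (map (map_letter f) r)"
    and rel': "\<And>l' r'. (l', r') \<in> R' \<Longrightarrow>
      \<exists>(l, r)\<in>R. l \<in> words A \<and> r \<in> words A \<and> l' = map (map_letter f) l \<and> r' = map (map_letter f) r"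
  shows "presented_group A R \<cong> presented_group A' R'"
proof -
  let ?F = "map (map_letter f)"
  have F_words: "?F w \<in> words A'" if "w \<in> words A" for w
    using words_map_letter[OF that, of f] onto by simp
  have lift: "\<exists>w\<in>words A. ?F w = w'" if "w' \<in> words A'" for w'
    using words_map_letterE[of w' f A] that onto by metis
  have F_cong: "word_cong A' R' (?F v) (?F w)" if "word_cong A R v w" for v w
    using that
  proof (induction rule: word_cong.induct)
    case (relator u v l r)
    then show ?case
      using word_cong_context[OF rel[OF relator(3-5)], of "?F u" "?F v"] F_words by simp
  next
    case (cancel_right u v g)
    then show ?case
      using word_cong.cancel_right[of "?F u" A' "?F v" "f g" R'] F_words onto by auto
  next
    case (cancel_left u v g)
    then show ?case
      using word_cong.cancel_left[of "?F u" A' "?F v" "f g" R'] F_words onto by auto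
  next
    case (trans u v w)
    from trans.IH show ?case by (rule word_cong.trans)
  next
    case (sym v w)
    from sym.IH show ?case by (rule word_cong.sym)
  next
    case (refl w)
    then show ?case by (intro word_cong.refl F_words)
  qed
  have fibre_words: "word_cong A R v w" if "v \<in> words A" "w \<in> words A" "?F v = ?F w" for v w
    using that
  proof (induction v arbitrary: w)
    case Nil
    then show ?case by (simp add: word_cong.refl)
  next
    case (Cons x v)
    then obtain y w' where w: "w = y # w'" "map_letter f x = map_letter f y" "?F v = ?F w'"
      by (cases w) auto
    have "word_cong A R v w'"
      using Cons w by (cases x; cases y) auto
    moreover have "word_cong A R [x] [y]"
      using Cons w by (cases x; cases y) (auto intro: fibre word_cong_Inv)
    ultimately show ?case using word_cong_append[of A R "[x]" "[y]" v w'] w by simp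
  qed
  \<comment> \<open>Derivations in the target are lifted. Both lifts \<open>v\<close> and
    \<open>w\<close> stay arbitrary in the induction: each rule is performed on suitable lifts, and
    \<open>fibre_words\<close> joins these to the given ones.\<close>
  have F_reflect: "word_cong A R v w"
    if "word_cong A' R' v' w'" "v \<in> words A" "w \<in> words A" "?F v = v'" "?F w = w'" for v w v' w'
    using that
  proof (induction arbitrary: v w rule: word_cong.induct)
    case (refl w')
    then show ?case using fibre_words by simp
  next
    case (sym v' w')
    from sym.IH[OF sym.prems(2,1,4,3)] show ?case by (rule word_cong.sym)
  next
    case (trans u' v' w')
    obtain z where z: "z \<in> words A" "?F z = v'"
      using lift word_cong_words[OF trans.hyps(1)] by metis
    from trans z have "word_cong A R v z" "word_cong A R z w" by simp_all
    then show ?case by (rule word_cong.trans)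
  next
    case (cancel_right u' v' g)
    then obtain u1 v1 where 1: "u1 \<in> words A" "?F u1 = u'" "v1 \<in> words A" "?F v1 = v'"
      using lift by metis
    obtain g1 where g1: "g1 \<in> A" "f g1 = g" using cancel_right onto by auto
    have "word_cong A R (u1 @ [Gen g1, Inv g1] @ v1) (u1 @ v1)"
      using 1 g1 by (intro word_cong.cancel_right)
    moreover have "word_cong A R v (u1 @ [Gen g1, Inv g1] @ v1)" "word_cong A R (u1 @ v1) w"
      by (rule fibre_words; use 1 g1 cancel_right in auto)+
    ultimately show ?case by (meson word_cong.trans)
  next
    case (cancel_left u' v' g)
    then obtain u1 v1 where 1: "u1 \<in> words A" "?F u1 = u'" "v1 \<in> words A" "?F v1 = v'"
      using lift by metis
    obtain g1 where g1: "g1 \<in> A" "f g1 = g" using cancel_left onto by auto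
    have "word_cong A R (u1 @ [Inv g1, Gen g1] @ v1) (u1 @ v1)"
      using 1 g1 by (intro word_cong.cancel_left)
    moreover have "word_cong A R v (u1 @ [Inv g1, Gen g1] @ v1)" "word_cong A R (u1 @ v1) w"
      by (rule fibre_words; use 1 g1 cancel_left in auto)+
    ultimately show ?case by (meson word_cong.trans)
  next
    case (relator u' v' l' r')
    then obtain u1 v1 where 1: "u1 \<in> words A" "?F u1 = u'" "v1 \<in> words A" "?F v1 = v'"
      using lift by metis
    obtain l r where lr: "(l, r) \<in> R" "l \<in> words A" "r \<in> words A" "l' = ?F l" "r' = ?F r"
      using rel'[OF relator(3)] by auto
    have "word_cong A R (u1 @ l @ v1) (u1 @ r @ v1)"
      using 1 lr by (intro word_cong.relator)
    moreover have "word_cong A R v (u1 @ l @ v1)" "word_cong A R (u1 @ r @ v1) w"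
      by (rule fibre_words; use 1 lr relator in auto)+
    ultimately show ?case by (meson word_cong.trans)
  qed
  \<comment> \<open>A union over the class avoids choosing a representative; it is a single class
    because congruent words have congruent images.\<close>
  define h where "h W = (\<Union>v\<in>W. word_class A' R' (?F v))" for W
  have h: "h (word_class A R v) = word_class A' R' (?F v)" if v: "v \<in> words A" for v
  proof -
    have "word_class A' R' (?F w) = word_class A' R' (?F v)" if "word_cong A R v w" for w
      using F_cong[OF that] word_cong_words[OF that]
      by (metis F_words word_class_eq_iff)
    moreover have "word_cong A R v v" using v by (rule word_cong.refl)
    ultimately show ?thesis unfolding h_def word_class_def[of A R] by blast
  qed
  have "h \<in> iso (presented_group A R) (presented_group A' R')"
  proof (rule isoI)
    show "h \<in> hom (presented_group A R) (presented_group A' R')"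
      by (rule homI) (auto simp: carrier_presented_group h mult_presented_group F_words)
    show "bij_betw h (carrier (presented_group A R)) (carrier (presented_group A' R'))"
      unfolding bij_betw_def
    proof
      show "inj_on h (carrier (presented_group A R))"
      proof (rule inj_onI)
        fix V W
        assume "V \<in> carrier (presented_group A R)" "W \<in> carrier (presented_group A R)" "h V = h W"
        then obtain v w where vw: "v \<in> words A" "w \<in> words A"
            "V = word_class A R v" "W = word_class A R w"
          by (auto simp: carrier_presented_group)
        with \<open>h V = h W\<close> have "word_cong A' R' (?F v) (?F w)"
          by (simp add: h word_class_eq_iff F_words)
        then show "V = W" using F_reflect vw by (simp add: word_class_eq_iff)
      qed
      show "h ` carrier (presented_group A R) = carrier (presented_group A' R')"
      proof
        show "h ` carrier (presented_group A R) \<subseteq> carrier (presented_group A' R')"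
          by (auto simp: carrier_presented_group h F_words)
        show "carrier (presented_group A' R') \<subseteq> h ` carrier (presented_group A R)"
        proof
          fix W assume "W \<in> carrier (presented_group A' R')"
          then obtain w' where "w' \<in> words A'" "W = word_class A' R' w'"
            by (auto simp: carrier_presented_group)
          moreover from this obtain w where "w \<in> words A" "?F w = w'" using lift by blast
          ultimately have "W = h (word_class A R w)" using h by simp
          with \<open>w \<in> words A\<close> show "W \<in> h ` carrier (presented_group A R)"
            by (auto simp: carrier_presented_group)
        qed
      qed
    qed
  qed
  then show ?thesis by (rule is_isoI)
qed

section \<open>Points of the circles\<close>

lemma shift_0 [simp]: "shift p 0 = p"
  by (simp add: shift_def)

lemma shift_shift [simp]: "shift (shift p s) t = shift p (s + t)"
  by (simp add: shift_def cis_mult[symmetric] mult.assoc)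

lemma shift_in_source [simp]: "shift p t \<in> source D \<longleftrightarrow> p \<in> source D"
  by (cases p) (auto simp: shift_def source_def norm_mult)

lemma continuous_on_shift [continuous_intros]:
  "continuous_on A f \<Longrightarrow> continuous_on A (\<lambda>t. shift p (f t))"
  by (auto simp: shift_def cis_conv_exp intro!: continuous_intros)

lemma shift_inject:
  assumes "p \<in> source D" "\<bar>s - t\<bar> < 2 * pi" "shift p s = shift p t"
  shows "s = t"
proof -
  have "snd p \<noteq> 0" using assms(1) by (auto simp: source_def)
  then have "cis s = cis t" using assms(3) by (simp add: shift_def)
  then have "cis (s - t) = 1" by (simp add: cis_divide[symmetric])
  then have "cos (s - t) = 1" by (metis cis.sel(1) one_complex.sel(1))
  then obtain n :: int where n: "s - t = n * 2 * pi" using cos_one_2pi_int by auto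
  with assms(2) have "\<bar>real_of_int n\<bar> * (2 * pi) < 1 * (2 * pi)" by (simp add: abs_mult)
  then have "\<bar>real_of_int n\<bar> < 1" using pi_gt_zero by (subst (asm) mult_less_cancel_right) auto
  then have "n = 0" by linarith
  with n show ?thesis by simp
qed

text \<open>This serves as a local chart of the circles: the first coordinate is discrete, and the
  rotation angle is the argument of a quotient near 1, where \<open>Arg\<close> is
  continuous.\<close>

lemma eventually_nhds_shift:
  assumes "p \<in> source D" "0 < \<delta>"
  shows "\<forall>\<^sub>F q in nhds p. q \<in> source D \<longrightarrow> (\<exists>t. \<bar>t\<bar> < \<delta> \<and> q = shift p t)"
proof -
  have p: "norm (snd p) = 1" using assms(1) by (auto simp: source_def)
  then have p0: "snd p \<noteq> 0" by auto
  have "((\<lambda>q. snd q / snd p) \<longlongrightarrow> snd p / snd p) (nhds p)"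
    using p0 by (intro tendsto_intros) (auto intro: tendsto_snd tendsto_ident_at filterlim_ident)
  then have "((\<lambda>q. Arg (snd q / snd p)) \<longlongrightarrow> Arg (snd p / snd p)) (nhds p)"
    using p0 by (intro isCont_tendsto_compose[OF continuous_at_Arg]) auto
  then have "((\<lambda>q. Arg (snd q / snd p)) \<longlongrightarrow> 0) (nhds p)" using p0 by simp
  then have 1: "\<forall>\<^sub>F q in nhds p. \<bar>Arg (snd q / snd p)\<bar> < \<delta>"
    using tendstoD[OF _ assms(2)] by (fastforce simp: dist_real_def)
  have "((\<lambda>q. fst q) \<longlongrightarrow> fst p) (nhds p)" by (intro tendsto_fst filterlim_ident)
  then have 2: "\<forall>\<^sub>F q in nhds p. fst q = fst p"
    by (rule topological_tendstoD[of _ _ _ "{fst p}", simplified]) (auto simp: open_discrete)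
  show ?thesis
    using 1 2
  proof eventually_elim
    case (elim q)
    show ?case
    proof
      assume "q \<in> source D"
      then have "norm (snd q) = 1" by (auto simp: source_def)
      then have "cis (Arg (snd q / snd p)) = snd q / snd p"
        using p p0 by (subst cis_Arg) (auto simp: sgn_eq norm_divide)
      then have "q = shift p (Arg (snd q / snd p))"
        using p0 elim by (simp add: shift_def prod_eq_iff)
      with elim show "\<exists>t. \<bar>t\<bar> < \<delta> \<and> q = shift p t" by blast
    qed
  qed
qed

text \<open>By the chart above, continuity at a point can be tested along the rotation through it,
  where calculus in one real variable applies.\<close>

lemma continuous_on_sourceI:
  fixes F :: "point \<Rightarrow> 'a::topological_space"
  assumes "\<And>p. p \<in> source D \<Longrightarrow> isCont (\<lambda>t. F (shift p t)) 0"
  shows "continuous_on (source D) F"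
  unfolding continuous_on_eq_continuous_within continuous_within
proof
  fix p assume p: "p \<in> source D"
  show "(F \<longlongrightarrow> F p) (at p within source D)"
  proof (rule topological_tendstoI)
    fix V assume V: "open V" "F p \<in> V"
    have "((\<lambda>t. F (shift p t)) \<longlongrightarrow> F p) (at 0)" using assms[OF p] by (simp add: isCont_def)
    then have "\<forall>\<^sub>F t in at 0. F (shift p t) \<in> V" using V by (rule topological_tendstoD)
    then have "\<forall>\<^sub>F t in nhds 0. F (shift p t) \<in> V"
      using V by (auto simp: eventually_at_filter elim!: eventually_mono)
    then obtain \<delta> where \<delta>: "\<delta> > 0" "\<And>t. \<bar>t\<bar> < \<delta> \<Longrightarrow> F (shift p t) \<in> V"
      by (auto simp: eventually_nhds_metric dist_real_def)
    have "\<forall>\<^sub>F q in nhds p. q \<in> source D \<longrightarrow> F q \<in> V"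
      using eventually_nhds_shift[OF p \<delta>(1)] by eventually_elim (use \<delta> in blast)
    then show "\<forall>\<^sub>F q in at p within source D. F q \<in> V"
      by (auto simp: eventually_at_filter elim!: eventually_mono)
  qed
qed

lemma compact_source: "compact (source D)"
  by (simp add: source_def compact_Times finite_imp_compact)


section \<open>Immersed curves\<close>

definition cut_points :: "diagram \<Rightarrow> point set" where
  "cut_points D = fst ` real_crossings D \<union> snd ` real_crossings D \<union> bar_point D ` bars D"

definition semi_arc_at :: "diagram \<Rightarrow> point \<Rightarrow> point set" where
  "semi_arc_at D p = connected_component_set (source D - cut_points D) p"

text \<open>The sign covers arriving (\<open>- 1\<close>) and leaving (\<open>1\<close>) at once; at
  a bar it lets strands running up and strands running down be treated together.\<close>

definition germ :: "diagram \<Rightarrow> real \<Rightarrow> point \<Rightarrow> point set \<Rightarrow> bool" where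
  "germ D \<sigma> p a \<longleftrightarrow> a \<in> semi_arcs D \<and> (\<forall>\<^sub>F t in at_right 0. shift p (\<sigma> * t) \<in> a)"

lemma arrives_iff_germ: "arrives D p a \<longleftrightarrow> germ D (- 1) p a"
  and leaves_iff_germ: "leaves D p a \<longleftrightarrow> germ D 1 p a"
  by (simp_all add: arrives_def leaves_def germ_def)

lemma semi_arcs_components: "semi_arcs D = components (source D - cut_points D)"
  by (simp add: semi_arcs_def cut_points_def)

lemma semi_arc_at_in_semi_arcs:
  "p \<in> source D \<Longrightarrow> p \<notin> cut_points D \<Longrightarrow> semi_arc_at D p \<in> semi_arcs D"
  by (simp add: semi_arcs_components semi_arc_at_def componentsI)

lemma mem_semi_arc_at: "p \<in> source D \<Longrightarrow> p \<notin> cut_points D \<Longrightarrow> p \<in> semi_arc_at D p"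
  by (simp add: semi_arc_at_def)

lemma semi_arc_eq:
  assumes "a \<in> semi_arcs D" "p \<in> a"
  shows "a = semi_arc_at D p"
proof -
  obtain x where "a = connected_component_set (source D - cut_points D) x"
    using assms(1) by (auto simp: semi_arcs_components components_def)
  with assms(2) show ?thesis by (simp add: semi_arc_at_def connected_component_eq)
qed

lemma semi_arc_subset: "a \<in> semi_arcs D \<Longrightarrow> a \<subseteq> source D - cut_points D"
  unfolding semi_arcs_components by (rule in_components_subset)

lemma semi_arc_nonempty: "a \<in> semi_arcs D \<Longrightarrow> a \<noteq> {}"
  unfolding semi_arcs_components by (rule in_components_nonempty)

lemma connected_semi_arc: "a \<in> semi_arcs D \<Longrightarrow> connected a"
  unfolding semi_arcs_components by (rule in_components_connected)

lemma semi_arc_at_eqI: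
  assumes "connected C" "C \<subseteq> source D - cut_points D" "p \<in> C" "q \<in> C"
  shows "semi_arc_at D p = semi_arc_at D q"
  unfolding semi_arc_at_def
  by (rule connected_component_eq) (use assms in \<open>auto simp: connected_component_def\<close>)

lemma sgn_eq_imp_orientation_0:
  assumes "sgn u = sgn v"
  shows "orientation u v = 0"
proof -
  have "u = norm u *\<^sub>R sgn u" "v = norm v *\<^sub>R sgn u"
    using assms by (metis (no_types, lifting) norm_sgn scaleR_scaleR sgn_div_norm norm_eq_zero
        scaleR_zero_left scaleR_one right_inverse)+
  then show ?thesis
    by (metis (no_types, lifting) mult.commute mult.left_commute orientation_def right_minus_eq
        scaleR_complex.sel)
qed

lemma has_vector_derivative_translate:
  fixes g :: "real \<Rightarrow> 'a::real_normed_vector"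
  assumes "(g has_vector_derivative g') (at (s + t))"
  shows "((\<lambda>t. g (s + t)) has_vector_derivative g') (at t)"
proof -
  have "((\<lambda>t. s + t) has_vector_derivative 1) (at t)"
    using DERIV_add[OF DERIV_const[of s] DERIV_ident]
    by (simp add: has_real_derivative_iff_has_vector_derivative)
  from vector_diff_chain_at[OF this assms] show ?thesis by (simp add: o_def)
qed

text \<open>Bars are recorded through the unique circle point over them, a condition that any
  bijection of the plane transports without touching the smooth arcs in
  \<open>is_bar\<close>.\<close>

locale immersed =
  fixes D :: diagram
  assumes C1: "i < ncircles D \<Longrightarrow> (\<lambda>t. curve D (i, cis t)) C1_differentiable_on UNIV"
    and velocity_nonzero: "p \<in> source D \<Longrightarrow> velocity D p \<noteq> 0"
    and finite_double_points: "finite (double_points D)"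
    and transverse: "(p, q) \<in> double_points D \<Longrightarrow> orientation (velocity D p) (velocity D q) \<noteq> 0"
    and crossings_subset: "real_crossings D \<subseteq> double_points D"
    and finite_bars: "finite (bars D)"
    and ex1_bar_point: "B \<in> bars D \<Longrightarrow> \<exists>!p. p \<in> source D \<and> curve D p \<in> B"
begin

lemma bar_point: "B \<in> bars D \<Longrightarrow> bar_point D B \<in> source D \<and> curve D (bar_point D B) \<in> B"
  unfolding bar_point_def by (rule theI'[OF ex1_bar_point])

lemma
  assumes p: "p \<in> source D"
  shows has_vector_derivative_curve:
      "((\<lambda>t. curve D (shift p t)) has_vector_derivative velocity D (shift p t)) (at t)"
    and isCont_velocity_shift: "isCont (\<lambda>t. velocity D (shift p t)) t"
proof -
  define i \<theta> where "i = fst p" and "\<theta> = Arg (snd p)"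
  have "norm (snd p) = 1" and i: "i < ncircles D" using p by (auto simp: source_def i_def)
  then have p_eq: "p = (i, cis \<theta>)"
    using cis_Arg[of "snd p"] by (force simp: i_def \<theta>_def prod_eq_iff sgn_eq)
  have shift_eq: "shift p t = (i, cis (\<theta> + t))" for t
    by (simp add: p_eq shift_def cis_mult)
  obtain c' where c': "\<And>t. ((\<lambda>t. curve D (i, cis t)) has_vector_derivative c' t) (at t)"
      and cont: "continuous_on UNIV c'"
    using C1[OF i] by (auto simp: C1_differentiable_on_def)
  have deriv: "((\<lambda>t. curve D (shift p t)) has_vector_derivative c' (\<theta> + t)) (at t)" for t
    unfolding shift_eq
    by (rule has_vector_derivative_translate) (rule c')
  have vel: "velocity D (shift p t) = c' (\<theta> + t)" for t
  proof -
    have "((\<lambda>s. curve D (shift p (t + s))) has_vector_derivative c' (\<theta> + t)) (at 0)"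
      by (rule has_vector_derivative_translate) (use deriv in simp)
    then show ?thesis by (simp add: velocity_def vector_derivative_at)
  qed
  show "((\<lambda>t. curve D (shift p t)) has_vector_derivative velocity D (shift p t)) (at t)"
    by (simp add: vel deriv)
  have "isCont (\<lambda>t. \<theta> + t) t" by (intro continuous_intros)
  moreover have "isCont c' (\<theta> + t)" using cont by (simp add: continuous_on_eq_continuous_at)
  ultimately show "isCont (\<lambda>t. velocity D (shift p t)) t"
    unfolding vel by (rule isCont_o2)
qed

lemma isCont_curve_shift: "p \<in> source D \<Longrightarrow> isCont (\<lambda>t. curve D (shift p t)) t"
  using has_vector_derivative_curve has_vector_derivative_continuous by blast

lemma continuous_on_curve: "continuous_on (source D) (curve D)"
  by (rule continuous_on_sourceI) (rule isCont_curve_shift)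

lemma continuous_on_velocity: "continuous_on (source D) (velocity D)"
  by (rule continuous_on_sourceI) (rule isCont_velocity_shift)

lemma continuous_on_strand: "continuous_on (source D) (strand D)"
  unfolding strand_def
  by (intro continuous_on_Pair continuous_on_sgn continuous_on_curve continuous_on_velocity)
    (use velocity_nonzero in auto)

text \<open>At a double point transversality makes the two tangent directions different; elsewhere
  the position alone suffices.\<close>

lemma inj_on_strand: "inj_on (strand D) (source D)"
proof (rule inj_onI, rule ccontr)
  fix p q assume "p \<in> source D" "q \<in> source D" "strand D p = strand D q" "p \<noteq> q"
  then have "(p, q) \<in> double_points D" "sgn (velocity D p) = sgn (velocity D q)"
    by (auto simp: double_points_def strand_def)
  then show False using transverse sgn_eq_imp_orientation_0 by blast
qed

lemma compact_strand_image: "compact (strand D ` source D)"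
  by (intro compact_continuous_image continuous_on_strand compact_source)

text \<open>Near a point the displacement points forward for positive angles and backward for
  negative ones. Only positions and the unit tangent enter, that is, data visible in
  \<open>strand\<close>; hence directions of travel can be compared between \<open>D\<close> and the
  covering.\<close>

lemma curve_moves_forward:
  assumes p: "p \<in> source D"
  shows "\<forall>\<^sub>F t in at 0. t * ((curve D (shift p t) - curve D p) \<bullet> sgn (velocity D p)) > 0"
proof -
  let ?v = "velocity D p" and ?g = "\<lambda>t. curve D (shift p t) \<bullet> sgn (velocity D p)"
  have "?v \<noteq> 0" using velocity_nonzero[OF p] .
  have "((\<lambda>t. curve D (shift p t)) has_vector_derivative ?v) (at 0)"
    using has_vector_derivative_curve[OF p, of 0] by simp
  then have "(?g has_vector_derivative ?v \<bullet> sgn ?v) (at 0)"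
    using bounded_linear.has_vector_derivative[OF bounded_linear_inner_left] by fastforce
  moreover have "?v \<bullet> sgn ?v = norm ?v"
    using \<open>?v \<noteq> 0\<close>
    by (simp add: sgn_div_norm power2_norm_eq_inner[symmetric] power2_eq_square)
  ultimately have "(?g has_real_derivative norm ?v) (at 0)"
    by (simp add: has_real_derivative_iff_has_vector_derivative)
  then have "((\<lambda>t. (?g t - ?g 0) / t) \<longlongrightarrow> norm ?v) (at 0)"
    by (simp add: has_field_derivative_iff)
  then have "\<forall>\<^sub>F t in at 0. (?g t - ?g 0) / t > 0"
    using \<open>?v \<noteq> 0\<close> by (intro order_tendstoD) auto
  then show ?thesis
    by eventually_elim (auto simp: inner_diff_left zero_less_mult_iff zero_less_divide_iff)
qed

lemma finite_cut_points: "finite (cut_points D)"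
  unfolding cut_points_def
  using finite_subset[OF crossings_subset finite_double_points] finite_bars by simp

lemma cut_points_subset: "cut_points D \<subseteq> source D"
  unfolding cut_points_def using crossings_subset bar_point by (force simp: double_points_def)

lemma eventually_shift_not_cut:
  assumes p: "p \<in> source D"
  shows "\<forall>\<^sub>F t in at 0. shift p t \<notin> cut_points D"
proof -
  \<comment> \<open>Angles below half a turn differ by less than a full turn, so the rotation is
    injective on them and finiteness of the cut points transfers.\<close>
  let ?K = "{t. \<bar>t\<bar> < pi \<and> shift p t \<in> cut_points D}"
  have "inj_on (shift p) ?K"
    by (rule inj_onI) (rule shift_inject[OF p], auto)
  moreover have "shift p ` ?K \<subseteq> cut_points D" by auto
  ultimately have "finite ?K"
    using finite_cut_points finite_subset finite_imageD by metis
  then have "\<forall>\<^sub>F t in at 0. t \<notin> ?K"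
    using islimpt_finite[of ?K 0] by (simp add: islimpt_iff_eventually)
  moreover have "\<forall>\<^sub>F t in at (0::real). \<bar>t\<bar> < pi"
    by (auto simp: eventually_at dist_real_def intro!: exI[of _ pi])
  ultimately show ?thesis by eventually_elim auto
qed

text \<open>A short arc beside \<open>p\<close> avoids the finitely many cut points, which gives a
  germ; two germs share a point and hence are the same component.\<close>

lemma ex1_germ:
  assumes p: "p \<in> source D" and \<sigma>: "\<sigma> \<in> {1, - 1}"
  shows "\<exists>!a. germ D \<sigma> p a"
proof -
  obtain \<delta> where \<delta>: "\<delta> > 0" "\<And>t. t \<noteq> 0 \<Longrightarrow> \<bar>t\<bar> < \<delta> \<Longrightarrow> shift p t \<notin> cut_points D"
    using eventually_shift_not_cut[OF p] by (auto simp: eventually_at dist_real_def)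
  define C where "C = (\<lambda>t. shift p (\<sigma> * t)) ` {0<..<\<delta>}"
  have C: "connected C" "C \<subseteq> source D - cut_points D"
    using \<delta> \<sigma> p unfolding C_def
    by (auto intro!: connected_continuous_image continuous_intros)
  have mid: "shift p (\<sigma> * (\<delta> / 2)) \<in> C"
    unfolding C_def using \<delta>(1) by (intro imageI) auto
  let ?a = "semi_arc_at D (shift p (\<sigma> * (\<delta> / 2)))"
  have "germ D \<sigma> p ?a"
    unfolding germ_def
  proof
    show "?a \<in> semi_arcs D" using mid C by (intro semi_arc_at_in_semi_arcs) auto
    have "C \<subseteq> ?a" unfolding semi_arc_at_def using C mid by (intro connected_component_maximal)
    moreover have "\<forall>\<^sub>F t in at_right 0. t \<in> {0<..<\<delta>}"
      using \<delta> by (simp add: eventually_at_right_less eventually_at_right) blast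
    ultimately show "\<forall>\<^sub>F t in at_right 0. shift p (\<sigma> * t) \<in> ?a"
      by (auto simp: C_def image_subset_iff elim: eventually_mono)
  qed
  moreover have "a = a'" if "germ D \<sigma> p a" "germ D \<sigma> p a'" for a a'
  proof -
    have "\<forall>\<^sub>F t in at_right 0. shift p (\<sigma> * t) \<in> a \<and> shift p (\<sigma> * t) \<in> a'"
      using that by (auto simp: germ_def eventually_conj)
    then obtain t where "shift p (\<sigma> * t) \<in> a" "shift p (\<sigma> * t) \<in> a'"
      using eventually_happens[of _ "at_right (0::real)"] trivial_limit_at_right_real by blast
    then show ?thesis using that semi_arc_eq by (metis germ_def)
  qed
  ultimately show ?thesis by blast
qed

text \<open>Semi-arcs are open in the circles because there are finitely many cut points. This is
  what makes a labelling of semi-arcs locally constant.\<close>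

lemma semi_arc_nhds:
  assumes a: "a \<in> semi_arcs D" and p: "p \<in> a"
  shows "\<forall>\<^sub>F q in nhds p. q \<in> source D \<longrightarrow> q \<in> a"
proof -
  have pU: "p \<in> source D" "p \<notin> cut_points D" using semi_arc_subset[OF a] p by auto
  obtain \<delta> where \<delta>: "\<delta> > 0" "\<And>t. t \<noteq> 0 \<Longrightarrow> \<bar>t\<bar> < \<delta> \<Longrightarrow> shift p t \<notin> cut_points D"
    using eventually_shift_not_cut[OF pU(1)] by (auto simp: eventually_at dist_real_def)
  define C where "C = shift p ` {- \<delta><..<\<delta>}"
  have "shift p t \<notin> cut_points D" if "\<bar>t\<bar> < \<delta>" for t
    using \<delta>(2)[of t] that pU(2) by (cases "t = 0") auto
  then have "C \<subseteq> source D - cut_points D" using pU by (auto simp: C_def)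
  moreover have "connected C"
    unfolding C_def by (intro connected_continuous_image continuous_intros) auto
  moreover have "p \<in> C" using \<delta>(1) by (auto simp: C_def intro!: image_eqI[of _ _ 0])
  ultimately have "C \<subseteq> a"
    unfolding semi_arc_eq[OF a p] semi_arc_at_def by (intro connected_component_maximal)
  then show ?thesis
    using eventually_nhds_shift[OF pU(1) \<delta>(1)]
  proof eventually_elim
    case (elim q)
    then show ?case using \<open>C \<subseteq> a\<close> by (auto simp: C_def abs_less_iff)
  qed
qed

end

section \<open>Barred arcs\<close>

text \<open>On the component of the level band around 0 the derivative keeps its sign, so
  \<open>g\<close> increases there. Length \<open>T\<close> or more would contradict periodicity,
  hence the component is a compact interval, and its maximality forces the end values
  \<open>lo\<close> and \<open>hi\<close>. The derivative is positive at the ends as well, so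
  \<open>g\<close> leaves the band just beyond them; \<open>\<epsilon>\<close> records how far this
  is certain.\<close>

lemma increasing_crossing_interval:
  fixes g g' :: "real \<Rightarrow> real"
  assumes deriv: "\<And>t. (g has_real_derivative g' t) (at t)"
    and cont: "continuous_on UNIV g'"
    and period: "T > 0" "\<And>t. g (t + T) = g t"
    and at_0: "g' 0 > 0" "lo < g 0" "g 0 < hi"
    and nonzero: "\<And>t. lo \<le> g t \<Longrightarrow> g t \<le> hi \<Longrightarrow> g' t \<noteq> 0"
  obtains \<alpha> \<beta> \<epsilon> where "\<alpha> < 0" "0 < \<beta>" "\<beta> - \<alpha> < T" "0 < \<epsilon>" "g \<alpha> = lo" "g \<beta> = hi"
    "strict_mono_on {\<alpha>..\<beta>} g"
    "\<And>t. t \<notin> {\<alpha>..\<beta>} \<Longrightarrow> \<alpha> - \<epsilon> < t \<Longrightarrow> t < \<beta> + \<epsilon> \<Longrightarrow> g t \<notin> {lo..hi}"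
proof -
  have g_cont: "isCont g t" for t using deriv DERIV_isCont by blast
  define V where "V = {t. g t \<in> {lo..hi}}"
  define I where "I = connected_component_set V 0"
  have "closed V"
    unfolding V_def using closed_vimage[of "{lo..hi}" g] g_cont
    by (simp add: vimage_def continuous_on_eq_continuous_at)
  have "0 \<in> V" using at_0 by (simp add: V_def)
  have I: "connected I" "closed I" "0 \<in> I" "I \<subseteq> V"
    unfolding I_def using \<open>closed V\<close> \<open>0 \<in> V\<close>
    by (simp_all add: closed_connected_component connected_component_subset)
  have interval: "{s..t} \<subseteq> I" if "s \<in> I" "t \<in> I" for s t
    using connectedD_interval[OF I(1) that] by auto
  have pos: "g' t > 0" if "t \<in> I" for t
  proof (rule ccontr)
    assume "\<not> g' t > 0"
    moreover have "connected (g' ` I)"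
      using continuous_on_subset[OF cont subset_UNIV] I(1) by (rule connected_continuous_image)
    ultimately have "0 \<in> g' ` I"
      using connectedD_interval[of "g' ` I" "g' t" "g' 0" 0] that I(3) at_0(1) by simp
    then show False using I(4) nonzero by (auto simp: V_def)
  qed
  have mono: "g s < g t" if "s \<in> I" "t \<in> I" "s < t" for s t
  proof (rule DERIV_pos_imp_increasing[OF that(3)])
    fix r assume "s \<le> r" "r \<le> t"
    then have "r \<in> I" using interval[OF that(1,2)] by auto
    then show "\<exists>y. (g has_real_derivative y) (at r) \<and> 0 < y" using pos deriv by blast
  qed
  have shorter: "t - s < T" if "s \<in> I" "t \<in> I" for s t
  proof (rule ccontr)
    assume "\<not> t - s < T"
    then have "s + T \<in> I" using interval[OF that] period(1) by auto
    then show False using mono[OF that(1)] period by force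
  qed
  have "I \<subseteq> {- T..T}" using shorter[OF I(3)] shorter[OF _ I(3)] by force
  then have "compact I" using I(2) by (meson bounded_closed_interval bounded_subset compact_eq_bounded_closed)
  then obtain \<alpha> \<beta> where I_eq: "I = {\<alpha>..\<beta>}" using connected_compact_interval_1[of I] I(1) by auto
  have ends: "\<alpha> \<in> I" "\<beta> \<in> I" using I(3) I_eq by auto
  have maximal: "s \<in> I" if "\<And>t. min s 0 \<le> t \<Longrightarrow> t \<le> max s 0 \<Longrightarrow> t \<in> V" for s
  proof -
    have "{min s 0..max s 0} \<subseteq> I"
      unfolding I_def using that by (intro connected_component_maximal) auto
    then show ?thesis by (auto simp: subset_iff)
  qed
  have "g \<beta> = hi"
  proof (rule ccontr)
    assume "g \<beta> \<noteq> hi"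
    moreover have "g \<beta> \<le> hi" using ends I(4) by (auto simp: V_def)
    moreover have "g 0 \<le> g \<beta>" using mono[OF I(3) ends(2)] I(3) I_eq by fastforce
    ultimately have "lo < g \<beta>" "g \<beta> < hi" using at_0 by auto
    then have "\<forall>\<^sub>F t in nhds \<beta>. lo < g t \<and> g t < hi"
      using g_cont[of \<beta>] by (intro eventually_conj order_tendstoD) (auto simp: isCont_def tendsto_at_iff_tendsto_nhds)
    then obtain d where d: "d > 0" "\<And>t. \<bar>t - \<beta>\<bar> < d \<Longrightarrow> t \<in> V"
      by (force simp: eventually_nhds_metric dist_real_def V_def)
    have "\<beta> + d / 2 \<in> I"
    proof (rule maximal)
      fix t assume "min (\<beta> + d / 2) 0 \<le> t" "t \<le> max (\<beta> + d / 2) 0"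
      then show "t \<in> V" using d I(3,4) I_eq by (cases "t \<le> \<beta>") auto
    qed
    then show False using I_eq d by auto
  qed
  have "g \<alpha> = lo"
  proof (rule ccontr)
    assume "g \<alpha> \<noteq> lo"
    moreover have "lo \<le> g \<alpha>" using ends I(4) by (auto simp: V_def)
    moreover have "g \<alpha> \<le> g 0" using mono[OF ends(1) I(3)] I(3) I_eq by fastforce
    ultimately have "lo < g \<alpha>" "g \<alpha> < hi" using at_0 by auto
    then have "\<forall>\<^sub>F t in nhds \<alpha>. lo < g t \<and> g t < hi"
      using g_cont[of \<alpha>] by (intro eventually_conj order_tendstoD) (auto simp: isCont_def tendsto_at_iff_tendsto_nhds)
    then obtain d where d: "d > 0" "\<And>t. \<bar>t - \<alpha>\<bar> < d \<Longrightarrow> t \<in> V"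
      by (force simp: eventually_nhds_metric dist_real_def V_def)
    have "\<alpha> - d / 2 \<in> I"
    proof (rule maximal)
      fix t assume "min (\<alpha> - d / 2) 0 \<le> t" "t \<le> max (\<alpha> - d / 2) 0"
      then show "t \<in> V" using d I(3,4) I_eq by (cases "t \<ge> \<alpha>") auto
    qed
    then show False using I_eq d by auto
  qed
  have "\<alpha> \<noteq> 0" "\<beta> \<noteq> 0" using \<open>g \<alpha> = lo\<close> \<open>g \<beta> = hi\<close> at_0 by auto
  then have "\<alpha> < 0" "0 < \<beta>" using I(3) I_eq by auto
  obtain d1 where d1: "d1 > 0" "\<And>h. 0 < h \<Longrightarrow> h < d1 \<Longrightarrow> g \<beta> < g (\<beta> + h)"
    using DERIV_pos_inc_right[OF deriv pos[OF ends(2)]] by auto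
  obtain d2 where d2: "d2 > 0" "\<And>h. 0 < h \<Longrightarrow> h < d2 \<Longrightarrow> g (\<alpha> - h) < g \<alpha>"
    using DERIV_pos_inc_left[OF deriv pos[OF ends(1)]] by auto
  show thesis
  proof (rule that[of \<alpha> \<beta> "min d1 d2"])
    show "strict_mono_on {\<alpha>..\<beta>} g" using mono I_eq by (auto simp: strict_mono_on_def)
    fix t assume t: "t \<notin> {\<alpha>..\<beta>}" "\<alpha> - min d1 d2 < t" "t < \<beta> + min d1 d2"
    show "g t \<notin> {lo..hi}"
    proof (cases "t < \<alpha>")
      case True
      then show ?thesis using d2(2)[of "\<alpha> - t"] t(2) \<open>g \<alpha> = lo\<close> by (auto simp: min_def split: if_splits)
    next
      case False
      then show ?thesis using d1(2)[of "t - \<beta>"] t(1,3) \<open>g \<beta> = hi\<close> by (auto simp: min_def split: if_splits)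
    qed
  qed (use \<open>\<alpha> < 0\<close> \<open>0 < \<beta>\<close> \<open>g \<alpha> = lo\<close> \<open>g \<beta> = hi\<close> d1 d2 shorter[OF ends] in auto)
qed

lemma openin_top_of_set_iff_nhds:
  "openin (top_of_set S) T \<longleftrightarrow> T \<subseteq> S \<and> (\<forall>x\<in>T. \<forall>\<^sub>F y in nhds x. y \<in> S \<longrightarrow> y \<in> T)"
proof
  assume "openin (top_of_set S) T"
  then obtain U where "open U" "T = S \<inter> U" by (auto simp: openin_open)
  then show "T \<subseteq> S \<and> (\<forall>x\<in>T. \<forall>\<^sub>F y in nhds x. y \<in> S \<longrightarrow> y \<in> T)"
    by (auto simp: eventually_nhds)
next
  assume *: "T \<subseteq> S \<and> (\<forall>x\<in>T. \<forall>\<^sub>F y in nhds x. y \<in> S \<longrightarrow> y \<in> T)"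
  show "openin (top_of_set S) T"
  proof (subst openin_subopen, intro ballI)
    fix x assume "x \<in> T"
    with * obtain U where "open U" "x \<in> U" "\<forall>y\<in>U. y \<in> S \<longrightarrow> y \<in> T"
      by (auto simp: eventually_nhds)
    with * \<open>x \<in> T\<close> show "\<exists>U. openin (top_of_set S) U \<and> x \<in> U \<and> U \<subseteq> T"
      by (intro exI[of _ "S \<inter> U"]) (auto simp: openin_open)
  qed
qed

text \<open>The preceding analysis is applied to the height along the rotation through the bar
  point. Without critical points in the strip, height is a coordinate on the barred arc; the bar
  point is its only cut point, so each of its two halves lies in one semi-arc.\<close>

lemma (in immersed) barred_arc_ends:
  fixes lo hi
  assumes B: "B \<in> bars D"
    and inside: "lo < Im (curve D (bar_point D B))" "Im (curve D (bar_point D B)) < hi"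
    and not_critical: "\<And>p. p \<in> critical_points D \<Longrightarrow> curve D p \<notin> strip lo hi"
    and not_cut: "\<And>p. p \<in> cut_points D \<Longrightarrow> p \<noteq> bar_point D B \<Longrightarrow> curve D p \<notin> strip lo hi"
  defines "J \<equiv> barred_arc D B lo hi" and "h \<equiv> \<lambda>p. Im (curve D p)"
  obtains P Q \<sigma> where "\<sigma> \<in> {1, - 1}"
    "P \<in> J" "Q \<in> J" "h P = lo" "h Q = hi" "inj_on h J" "compact J" "J \<subseteq> source D"
    "openin (top_of_set (source D)) (J - {P, Q})"
    "P \<in> closure (source D - J)" "Q \<in> closure (source D - J)"
    "germ D (- \<sigma>) (bar_point D B) (semi_arc_at D P)" "germ D \<sigma> (bar_point D B) (semi_arc_at D Q)"
    "\<And>p. p \<in> J \<Longrightarrow> h p < h (bar_point D B) \<Longrightarrow> semi_arc_at D p = semi_arc_at D P"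
    "\<And>p. p \<in> J \<Longrightarrow> h p > h (bar_point D B) \<Longrightarrow> semi_arc_at D p = semi_arc_at D Q"
proof -
  let ?b = "bar_point D B"
  have b: "?b \<in> source D" using bar_point[OF B] by blast
  have v: "Im (velocity D p) \<noteq> 0" if "p \<in> source D" "curve D p \<in> strip lo hi" for p
    using not_critical[of p] that by (auto simp: critical_points_def)
  \<comment> \<open>The rotation is run in the direction in which the height increases at the bar.
    Thus the germ below has sign \<open>- \<sigma>\<close> and the germ above has sign
    \<open>\<sigma>\<close>, whichever way the strand is oriented.\<close>
  define \<sigma> where "\<sigma> = sgn (Im (velocity D ?b))"
  have "Im (velocity D ?b) \<noteq> 0" using v[OF b] inside by (simp add: strip_def)
  then have \<sigma>: "\<sigma> \<in> {1, - 1}" "\<sigma> * Im (velocity D ?b) > 0"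
    by (auto simp: \<sigma>_def sgn_if)
  then have \<sigma>\<sigma>: "\<sigma> * (\<sigma> * t) = t" for t by auto
  define u where "u t = shift ?b (\<sigma> * t)" for t
  define g where "g t = h (u t)" for t
  define g' where "g' t = \<sigma> * Im (velocity D (u t))" for t
  have u_source: "u t \<in> source D" for t using b by (simp add: u_def)
  have u_shift: "shift (u t) \<tau> = u (t + \<sigma> * \<tau>)" for t \<tau>
    by (simp add: u_def ring_distribs \<sigma>\<sigma>)
  have u_cont: "continuous_on S u" for S
    unfolding u_def by (intro continuous_intros)
  have u_inj: "s = t" if "u s = u t" "\<bar>s - t\<bar> < 2 * pi" for s t
  proof -
    have "\<bar>\<sigma> * s - \<sigma> * t\<bar> = \<bar>s - t\<bar>" using \<sigma>(1) by auto
    then have "\<sigma> * s = \<sigma> * t"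
      using that by (intro shift_inject[OF b]) (simp_all add: u_def)
    then show ?thesis using \<sigma>(1) by auto
  qed
  have deriv: "(g has_real_derivative g' t) (at t)" for t
  proof -
    have "((\<lambda>t. \<sigma> * t) has_vector_derivative \<sigma>) (at t)"
      using DERIV_cmult_Id[of \<sigma>] by (simp add: has_real_derivative_iff_has_vector_derivative)
    from vector_diff_chain_at[OF this has_vector_derivative_curve[OF b]]
    have "((\<lambda>t. curve D (u t)) has_vector_derivative \<sigma> *\<^sub>R velocity D (u t)) (at t)"
      by (simp add: o_def u_def)
    from bounded_linear.has_vector_derivative[OF bounded_linear_Im this]
    show ?thesis
      by (simp add: g_def[abs_def] g'_def h_def has_real_derivative_iff_has_vector_derivative)
  qed
  have g'_cont: "continuous_on UNIV g'"
    unfolding g'_def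
    by (intro continuous_intros continuous_on_compose2[OF continuous_on_velocity u_cont])
      (use u_source in auto)
  have period: "g (t + 2 * pi) = g t" for t
  proof -
    have "cis (\<sigma> * (2 * pi)) = 1" using \<sigma>(1) by (auto simp: complex_eq_iff)
    then show ?thesis
      by (simp add: g_def u_def shift_def distrib_left[of \<sigma>] cis_mult[symmetric])
  qed
  obtain \<alpha> \<beta> \<epsilon> where \<alpha>\<beta>: "\<alpha> < 0" "0 < \<beta>" "\<beta> - \<alpha> < 2 * pi" "0 < \<epsilon>" "g \<alpha> = lo" "g \<beta> = hi"
    and mono: "strict_mono_on {\<alpha>..\<beta>} g"
    and outside: "\<And>t. t \<notin> {\<alpha>..\<beta>} \<Longrightarrow> \<alpha> - \<epsilon> < t \<Longrightarrow> t < \<beta> + \<epsilon> \<Longrightarrow> g t \<notin> {lo..hi}"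
  proof (rule increasing_crossing_interval[of g g' "2 * pi" lo hi])
    show "g' 0 > 0" "lo < g 0" "g 0 < hi" using \<sigma> inside by (simp_all add: g'_def g_def u_def h_def)
    show "g' t \<noteq> 0" if "lo \<le> g t" "g t \<le> hi" for t
      using v[OF u_source[of t]] that \<sigma> by (auto simp: g'_def g_def h_def strip_def)
  qed (use deriv g'_cont period in auto)
  define W where "W = {p \<in> source D. curve D p \<in> strip lo hi}"
  have W_iff: "u t \<in> W \<longleftrightarrow> g t \<in> {lo..hi}" for t
    using u_source by (auto simp: W_def strip_def g_def h_def)
  have mono_le: "g s \<le> g t" if "s \<in> {\<alpha>..\<beta>}" "t \<in> {\<alpha>..\<beta>}" "s \<le> t" for s t
    using strict_mono_onD[OF mono that(1,2)] that(3) by (cases "s = t") auto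
  have in_range: "g t \<in> {lo..hi}" if "t \<in> {\<alpha>..\<beta>}" for t
    using mono_le[of \<alpha> t] mono_le[of t \<beta>] that \<alpha>\<beta> by auto
  have u_nhds: "\<forall>\<^sub>F q in nhds (u t). q \<in> source D \<longrightarrow> (\<exists>s. \<bar>s - t\<bar> < \<delta> \<and> q = u s)"
    if "\<delta> > 0" for t \<delta>
    using eventually_nhds_shift[OF u_source[of t] that]
  proof eventually_elim
    case (elim q)
    show ?case
    proof
      assume "q \<in> source D"
      with elim obtain \<tau> where "\<bar>\<tau>\<bar> < \<delta>" "q = shift (u t) \<tau>" by blast
      then show "\<exists>s. \<bar>s - t\<bar> < \<delta> \<and> q = u s"
        using \<sigma>(1) by (intro exI[of _ "t + \<sigma> * \<tau>"]) (auto simp: u_shift abs_mult)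
    qed
  qed
  \<comment> \<open>The image of the interval is compact, hence closed in the component, and
    relatively open because just beyond the interval the curve is outside the strip; connectedness
    leaves no other points.\<close>
  have J_eq: "J = u ` {\<alpha>..\<beta>}"
  proof -
    have J: "J = connected_component_set W ?b" by (simp add: J_def barred_arc_def W_def)
    have "connected (u ` {\<alpha>..\<beta>})" by (intro connected_continuous_image u_cont) auto
    then have sub: "u ` {\<alpha>..\<beta>} \<subseteq> J"
      unfolding J using \<alpha>\<beta> in_range W_iff
      by (intro connected_component_maximal) (auto simp: u_def image_iff intro!: bexI[of _ 0])
    have "openin (top_of_set J) (u ` {\<alpha>..\<beta>})"
      unfolding openin_top_of_set_iff_nhds
    proof (intro conjI ballI sub)
      fix x assume "x \<in> u ` {\<alpha>..\<beta>}"
      then obtain t where t: "t \<in> {\<alpha>..\<beta>}" "x = u t" by blast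
      show "\<forall>\<^sub>F y in nhds x. y \<in> J \<longrightarrow> y \<in> u ` {\<alpha>..\<beta>}"
        using u_nhds[OF \<alpha>\<beta>(4), of t] unfolding t(2)
      proof eventually_elim
        case (elim y)
        show ?case
        proof
          assume "y \<in> J"
          then have "y \<in> W" unfolding J using connected_component_subset by blast
          then obtain s where s: "\<bar>s - t\<bar> < \<epsilon>" "y = u s" using elim by (auto simp: W_def)
          then have "s \<in> {\<alpha>..\<beta>}"
            using outside[of s] \<open>y \<in> W\<close> t W_iff[of s] by fastforce
          then show "y \<in> u ` {\<alpha>..\<beta>}" using s by blast
        qed
      qed
    qed
    moreover have "compact (u ` {\<alpha>..\<beta>})" by (intro compact_continuous_image u_cont) auto
    then have "closedin (top_of_set J) (u ` {\<alpha>..\<beta>})"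
      using sub by (simp add: closed_subset compact_imp_closed)
    moreover have "connected J" by (simp add: J)
    ultimately have "u ` {\<alpha>..\<beta>} = {} \<or> u ` {\<alpha>..\<beta>} = J" by (auto simp: connected_clopen)
    then show ?thesis using \<alpha>\<beta> by auto
  qed
  have h_u: "h (u t) = g t" for t by (simp add: g_def)
  have inj: "inj_on h J"
    unfolding J_eq using strict_mono_on_imp_inj_on[OF mono] by (auto simp: inj_on_def h_u)
  have not_cut_u: "u t \<notin> cut_points D" if "t \<in> {\<alpha>..\<beta>}" "t \<noteq> 0" for t
  proof
    assume "u t \<in> cut_points D"
    then have "u t = ?b" using not_cut[of "u t"] in_range[OF that(1)] by (auto simp: strip_def h_u[symmetric] h_def)
    then have "u t = u 0" by (simp add: u_def)
    moreover have "\<bar>t - 0\<bar> < 2 * pi" using that(1) \<alpha>\<beta>(1-3) by (auto simp: abs_less_iff)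
    ultimately show False using u_inj that(2) by blast
  qed
  \<comment> \<open>\<open>\<rho> = - 1\<close>, \<open>e = \<alpha>\<close> is the half below the
    bar and \<open>\<rho> = 1\<close>, \<open>e = \<beta>\<close> the half above. The parameter
    interval of \<open>C\<close> is open at 0 in order to leave out the bar point.\<close>
  have half: "germ D (\<rho> * \<sigma>) ?b (semi_arc_at D (u e))"
      "\<And>t. 0 < \<rho> * t \<Longrightarrow> \<rho> * t \<le> \<rho> * e \<Longrightarrow> semi_arc_at D (u t) = semi_arc_at D (u e)"
    if e: "e \<in> {\<alpha>, \<beta>}" and \<rho>: "\<rho> \<in> {1, - 1}" "\<rho> * e > 0" for e \<rho>
  proof -
    define C where "C = (\<lambda>t. u (\<rho> * t)) ` {0<..\<rho> * e}"
    have range: "\<rho> * t \<in> {\<alpha>..\<beta>}" "\<rho> * t \<noteq> 0" if "t \<in> {0<..\<rho> * e}" for t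
      using that e \<rho> \<alpha>\<beta>(1,2) by auto
    have "continuous_on {0<..\<rho> * e} (\<lambda>t. u (\<rho> * t))"
      by (intro continuous_on_compose2[OF u_cont[of UNIV]] continuous_intros) simp
    then have C: "connected C" "C \<subseteq> source D - cut_points D"
      unfolding C_def using u_source range not_cut_u
      by (simp_all add: connected_continuous_image image_subset_iff)
    have "u e = u (\<rho> * (\<rho> * e))" using \<rho>(1) by auto
    then have "u e \<in> C"
      unfolding C_def by (rule image_eqI) (use \<rho> in simp)
    then have sub: "C \<subseteq> semi_arc_at D (u e)"
      unfolding semi_arc_at_def using C by (rule connected_component_maximal)
    have ue: "u e \<in> source D - cut_points D" using \<open>u e \<in> C\<close> C(2) by blast
    have "\<forall>\<^sub>F t in at_right 0. t \<in> {0<..\<rho> * e}"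
      using \<rho>(2) unfolding eventually_at_right_field by auto
    then have "\<forall>\<^sub>F t in at_right 0. shift ?b ((\<rho> * \<sigma>) * t) \<in> semi_arc_at D (u e)"
    proof eventually_elim
      case (elim t)
      then have "u (\<rho> * t) \<in> semi_arc_at D (u e)" using sub by (auto simp: C_def)
      then show ?case by (simp add: u_def mult_ac)
    qed
    moreover have "semi_arc_at D (u e) \<in> semi_arcs D"
      using ue by (intro semi_arc_at_in_semi_arcs) auto
    ultimately show "germ D (\<rho> * \<sigma>) ?b (semi_arc_at D (u e))" by (simp add: germ_def)
    fix t assume t: "0 < \<rho> * t" "\<rho> * t \<le> \<rho> * e"
    have "u t = u (\<rho> * (\<rho> * t))" using \<rho>(1) by auto
    then have "u t \<in> C"
      unfolding C_def by (rule image_eqI) (use t in simp)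
    with C show "semi_arc_at D (u t) = semi_arc_at D (u e)"
      using \<open>u e \<in> C\<close> by (rule semi_arc_at_eqI)
  qed
  \<comment> \<open>Points just beyond an end are outside the strip, hence off \<open>J\<close>, and
    converge to that end.\<close>
  have limit: "u e \<in> closure (source D - J)"
    if e: "e \<in> {\<alpha>, \<beta>}" and \<rho>: "\<rho> \<in> {1, - 1}" "\<rho> * e > 0" for e \<rho>
  proof -
    have lim: "((\<lambda>t. u (e + \<rho> * t)) \<longlongrightarrow> u (e + \<rho> * 0)) (at_right 0)"
    proof -
      have "continuous_on UNIV (\<lambda>t. u (e + \<rho> * t))"
        by (intro continuous_on_compose2[OF u_cont[of UNIV]] continuous_intros) simp
      then have "isCont (\<lambda>t. u (e + \<rho> * t)) 0" by (simp add: continuous_on_eq_continuous_at)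
      then show ?thesis by (intro filterlim_at_split[THEN iffD1, THEN conjunct2]) (simp add: isCont_def)
    qed
    have ev: "\<forall>\<^sub>F t in at_right 0. u (e + \<rho> * t) \<in> closure (source D - J)"
    proof (rule eventually_mono[OF _ closure_subset[THEN subsetD]])
      show "\<forall>\<^sub>F t in at_right 0. u (e + \<rho> * t) \<in> source D - J"
      proof -
        have "\<forall>\<^sub>F t in at_right 0. 0 < t \<and> t < \<epsilon>"
          using \<alpha>\<beta>(4) by (auto simp: eventually_at_right_field)
        then show ?thesis
        proof eventually_elim
          case (elim t)
          then have "e + \<rho> * t \<notin> {\<alpha>..\<beta>}" "\<alpha> - \<epsilon> < e + \<rho> * t" "e + \<rho> * t < \<beta> + \<epsilon>"
            using e \<rho> \<alpha>\<beta>(1,2,4) by auto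
          then have "g (e + \<rho> * t) \<notin> {lo..hi}" by (rule outside)
          then have "u (e + \<rho> * t) \<notin> J" unfolding J_eq by (metis h_u imageE in_range)
          then show ?case using u_source by blast
        qed
      qed
    qed
    from Lim_in_closed_set[OF closed_closure ev trivial_limit_at_right_real lim]
    show ?thesis by simp
  qed
  show thesis
  proof (rule that[of \<sigma> "u \<alpha>" "u \<beta>"])
    show "openin (top_of_set (source D)) (J - {u \<alpha>, u \<beta>})"
      unfolding openin_top_of_set_iff_nhds
    proof (intro conjI ballI)
      show "J - {u \<alpha>, u \<beta>} \<subseteq> source D" using u_source by (auto simp: J_eq)
      fix x assume "x \<in> J - {u \<alpha>, u \<beta>}"
      then obtain t where t: "\<alpha> < t" "t < \<beta>" "x = u t"
        by (force simp: J_eq order.order_iff_strict)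
      show "\<forall>\<^sub>F y in nhds x. y \<in> source D \<longrightarrow> y \<in> J - {u \<alpha>, u \<beta>}"
        using u_nhds[of "min (t - \<alpha>) (\<beta> - t)" t] t unfolding t(3)
      proof (simp, elim eventually_mono, intro impI)
        fix y assume "y \<in> source D \<longrightarrow> (\<exists>s. \<bar>s - t\<bar> < t - \<alpha> \<and> \<bar>s - t\<bar> < \<beta> - t \<and> y = u s)" "y \<in> source D"
        then obtain s where "\<alpha> < s" "s < \<beta>" "y = u s" by (auto simp: abs_less_iff)
        moreover from this have "g s \<noteq> g \<alpha>" "g s \<noteq> g \<beta>"
          using strict_mono_onD[OF mono, of \<alpha> s] strict_mono_onD[OF mono, of s \<beta>] by auto
        ultimately show "y \<in> J \<and> y \<noteq> u \<alpha> \<and> y \<noteq> u \<beta>" by (auto simp: J_eq g_def)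
      qed
    qed
    show "compact J" unfolding J_eq by (intro compact_continuous_image u_cont) auto
    show "germ D (- \<sigma>) ?b (semi_arc_at D (u \<alpha>))" "germ D \<sigma> ?b (semi_arc_at D (u \<beta>))"
      using half(1)[of \<alpha> "- 1"] half(1)[of \<beta> 1] \<alpha>\<beta>(1,2) by simp_all
  next
    fix p assume "p \<in> J"
    then obtain t where t: "t \<in> {\<alpha>..\<beta>}" "p = u t" by (auto simp: J_eq)
    have b_eq: "h ?b = g 0" by (simp add: g_def u_def)
    show "semi_arc_at D p = semi_arc_at D (u \<alpha>)" if "h p < h ?b"
    proof -
      have "t < 0" using that mono_le[of 0 t] t \<alpha>\<beta>(1,2) by (force simp: b_eq h_u)
      then show ?thesis using half(2)[of \<alpha> "- 1" t] t \<alpha>\<beta>(1) by simp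
    qed
    show "semi_arc_at D p = semi_arc_at D (u \<beta>)" if "h p > h ?b"
    proof -
      have "t > 0" using that mono_le[of t 0] t \<alpha>\<beta>(1,2) by (force simp: b_eq h_u)
      then show ?thesis using half(2)[of \<beta> 1 t] t \<alpha>\<beta>(2) by simp
    qed
  next
    show "u \<alpha> \<in> closure (source D - J)" "u \<beta> \<in> closure (source D - J)"
      using limit[of \<alpha> "- 1"] limit[of \<beta> 1] \<alpha>\<beta>(1,2) by simp_all
    show "u \<alpha> \<in> J" "u \<beta> \<in> J" "J \<subseteq> source D"
      using \<alpha>\<beta>(1,2) u_source by (simp_all add: J_eq image_subset_iff)
    show "\<sigma> \<in> {1, - 1}" "h (u \<alpha>) = lo" "h (u \<beta>) = hi" "inj_on h J"
      using \<sigma>(1) \<alpha>\<beta>(5,6) h_u inj by simp_all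
  qed
qed

section \<open>Isotopy invariance\<close>

lemma twisted_link_diagram_imp_immersed:
  assumes "twisted_link_diagram D"
  shows "immersed D"
proof
  fix B assume "B \<in> bars D"
  then have "is_bar D B" using assms by (simp add: twisted_link_diagram_def)
  then obtain p where "{q \<in> source D. curve D q \<in> B} = {p}" by (auto simp: is_bar_def)
  then have "q \<in> source D \<and> curve D q \<in> B \<longleftrightarrow> q = p" for q by blast
  then show "\<exists>!p. p \<in> source D \<and> curve D p \<in> B" by auto
qed (use assms in \<open>auto simp: twisted_link_diagram_def\<close>)

text \<open>Multiplicativity of the determinant: the factor is the determinant of \<open>L\<close>
  in the basis \<open>1\<close>, \<open>\<i>\<close>.\<close>

lemma orientation_linear:
  assumes "linear L"
  shows "orientation (L u) (L v) = orientation (L 1) (L \<i>) * orientation u v"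
proof -
  have *: "L z = Re z *\<^sub>R L 1 + Im z *\<^sub>R L \<i>" for z
  proof -
    have "z = Re z *\<^sub>R 1 + Im z *\<^sub>R \<i>" by (simp add: complex_eq_iff)
    then have "L z = L (Re z *\<^sub>R 1 + Im z *\<^sub>R \<i>)" by simp
    also have "\<dots> = Re z *\<^sub>R L 1 + Im z *\<^sub>R L \<i>"
      by (simp only: linear_add[OF assms] linear_scale[OF assms])
    finally show ?thesis .
  qed
  show ?thesis
    unfolding *[of u] *[of v] by (simp add: orientation_def algebra_simps)
qed

lemma orientation_linear_bij:
  assumes "linear L" "bij L"
  shows "orientation (L 1) (L \<i>) \<noteq> 0"
proof
  assume 0: "orientation (L 1) (L \<i>) = 0"
  obtain u v where "L u = 1" "L v = \<i>" using assms(2) by (metis bij_pointE)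
  then have "orientation 1 \<i> = 0" using orientation_linear[OF assms(1), of u v] 0 by simp
  then show False by (simp add: orientation_def)
qed

section \<open>Orientation-preserving diffeomorphisms of the plane\<close>

locale orientation_preserving_diffeo =
  fixes f :: "complex \<Rightarrow> complex" and f' :: "complex \<Rightarrow> complex \<Rightarrow>\<^sub>L complex"
  assumes bij: "bij f"
    and deriv: "(f has_derivative blinfun_apply (f' z)) (at z)"
    and bij_deriv: "bij (blinfun_apply (f' z))"
    and cont_deriv: "continuous_on UNIV f'"
    and positive: "orientation (f' z 1) (f' z \<i>) > 0"

text \<open>The determinant of the derivative is continuous in time, never 0, and equal to 1 for the
  identity at time 0, so it is still positive at time 1.\<close>

lemma plane_isotopy_diffeo:
  assumes "plane_isotopy H"
  obtains f' where "orientation_preserving_diffeo (H 1) f'"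
proof -
  obtain H' :: "real \<Rightarrow> complex \<Rightarrow> complex \<Rightarrow>\<^sub>L complex" where
      H0: "H 0 = id" and bij: "\<And>t. t \<in> {0..1} \<Longrightarrow> bij (H t)"
    and deriv: "\<And>t z. t \<in> {0..1} \<Longrightarrow> (H t has_derivative blinfun_apply (H' t z)) (at z)"
    and bij': "\<And>t z. t \<in> {0..1} \<Longrightarrow> bij (blinfun_apply (H' t z))"
    and cont: "continuous_on ({0..1} \<times> UNIV) (\<lambda>(t, z). H' t z)"
    using assms unfolding plane_isotopy_def by metis
  have "orientation_preserving_diffeo (H 1) (H' 1)"
  proof
    have "continuous_on UNIV (\<lambda>z. (\<lambda>(t, z). H' t z) (1, z))"
      by (rule continuous_on_compose2[OF cont]) (auto intro!: continuous_intros)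
    then show "continuous_on UNIV (H' 1)" by simp
    fix z
    define d where "d t = orientation (H' t z 1) (H' t z \<i>)" for t
    have "continuous_on {0..1} (\<lambda>t. (\<lambda>(t, z). H' t z) (t, z))"
      by (rule continuous_on_compose2[OF cont]) (auto intro!: continuous_intros)
    then have path: "continuous_on {0..1} (\<lambda>t. H' t z)" by simp
    have d_cont: "continuous_on {0..1} d"
      unfolding d_def orientation_def by (intro continuous_intros path)
    have d_nonzero: "d t \<noteq> 0" if "t \<in> {0..1}" for t
      unfolding d_def
      by (intro orientation_linear_bij bij'[OF that]) (simp add: bounded_linear.linear blinfun.bounded_linear_right)
    have "(id has_derivative blinfun_apply (H' 0 z)) (at z)" using deriv[of 0 z] H0 by simp
    then have "blinfun_apply (H' 0 z) = id"
      using has_derivative_unique[OF _ has_derivative_id] by blast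
    then have "d 0 = 1" by (simp add: d_def orientation_def)
    have "d 1 > 0"
    proof (rule ccontr)
      assume "\<not> d 1 > 0"
      then obtain t where "0 \<le> t" "t \<le> 1" "d t = 0"
        using IVT2'[of d 1 0 0] d_cont \<open>d 0 = 1\<close> by auto
      then show False using d_nonzero by auto
    qed
    then show "orientation (H' 1 z 1) (H' 1 z \<i>) > 0" by (simp add: d_def)
  qed (use bij deriv bij' in auto)
  then show thesis using that by blast
qed

context orientation_preserving_diffeo
begin

lemma linear_deriv: "linear (blinfun_apply (f' z))"
  by (simp add: bounded_linear.linear blinfun.bounded_linear_right)

lemma orientation_pos_iff: "orientation (f' z u) (f' z v) > 0 \<longleftrightarrow> orientation u v > 0"
  and orientation_0_iff: "orientation (f' z u) (f' z v) = 0 \<longleftrightarrow> orientation u v = 0"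
  using positive[of z] orientation_linear[OF linear_deriv, of z u v]
  by (simp_all add: zero_less_mult_iff)

context
  fixes D
  assumes "immersed D"
begin

interpretation immersed D by fact

abbreviation (input) "D' \<equiv> map_diagram f D"

lemma map_diagram_simps [simp]:
  "ncircles D' = ncircles D" "curve D' p = f (curve D p)"
  "real_crossings D' = real_crossings D" "source D' = source D" "bars D' = (`) f ` bars D"
  by (simp_all add: map_diagram_def source_def)

lemma double_points_map: "double_points D' = double_points D"
  using bij by (auto simp: double_points_def dest: bij_is_inj injD)

lemma velocity_map:
  assumes p: "p \<in> source D"
  shows "velocity D' p = f' (curve D p) (velocity D p)"
proof -
  have "((\<lambda>t. curve D (shift p t)) has_vector_derivative velocity D p) (at 0)"
    using has_vector_derivative_curve[OF p, of 0] by simp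
  then have "((\<lambda>t. f (curve D (shift p t))) has_vector_derivative f' (curve D p) (velocity D p)) (at 0)"
    using vector_derivative_diff_chain_within[of "\<lambda>t. curve D (shift p t)" "velocity D p" 0 UNIV f
        "blinfun_apply (f' (curve D p))"] deriv[of "curve D p"]
    by (simp add: o_def has_derivative_at_withinI)
  then show ?thesis by (simp add: velocity_def vector_derivative_at)
qed

lemma bar_point_map:
  assumes "B \<in> bars D"
  shows "bar_point D' (f ` B) = bar_point D B"
proof -
  have "f z \<in> f ` B \<longleftrightarrow> z \<in> B" for z using bij by (auto dest: bij_is_inj injD)
  then show ?thesis by (simp add: bar_point_def)
qed

lemma immersed_map: "immersed D'"
proof
  fix i assume i: "i < ncircles D'"
  let ?c = "\<lambda>t. curve D (i, cis t)"
  obtain c' where c': "\<And>t. (?c has_vector_derivative c' t) (at t)" "continuous_on UNIV c'"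
    using C1[of i] i by (auto simp: C1_differentiable_on_def)
  have "((\<lambda>t. f (?c t)) has_vector_derivative f' (?c t) (c' t)) (at t)" for t
    using vector_derivative_diff_chain_within[of ?c "c' t" t UNIV f "blinfun_apply (f' (?c t))"]
      deriv[of "?c t"] c'(1)[of t]
    by (simp add: o_def has_derivative_at_withinI)
  moreover have "continuous_on UNIV (\<lambda>t. f' (?c t) (c' t))"
  proof -
    have "continuous_on UNIV ?c"
      using c'(1) has_vector_derivative_continuous continuous_at_imp_continuous_on by blast
    then show ?thesis
      by (intro continuous_intros c'(2) continuous_on_compose2[OF cont_deriv]) auto
  qed
  ultimately show "(\<lambda>t. curve D' (i, cis t)) C1_differentiable_on UNIV"
    unfolding C1_differentiable_on_def by (intro exI[of _ "\<lambda>t. f' (?c t) (c' t)"]) simp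
next
  fix p assume p: "p \<in> source D'"
  then have "velocity D p \<noteq> 0" using velocity_nonzero by simp
  then show "velocity D' p \<noteq> 0"
    using p velocity_map[of p] bij_is_inj[OF bij_deriv] linear_injective_0[OF linear_deriv] by auto
next
  fix p q assume pq: "(p, q) \<in> double_points D'"
  then have "(p, q) \<in> double_points D" using double_points_map by simp
  then have "p \<in> source D" "q \<in> source D" "curve D p = curve D q"
    "orientation (velocity D p) (velocity D q) \<noteq> 0"
    using transverse by (auto simp: double_points_def)
  then show "orientation (velocity D' p) (velocity D' q) \<noteq> 0"
    by (simp add: velocity_map orientation_0_iff)
next
  fix B assume "B \<in> bars D'"
  then obtain B' where "B' \<in> bars D" "B = f ` B'" by auto
  moreover have "f z \<in> f ` B' \<longleftrightarrow> z \<in> B'" for z using bij by (auto dest: bij_is_inj injD)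
  ultimately show "\<exists>!p. p \<in> source D' \<and> curve D' p \<in> B" using ex1_bar_point by simp
qed (use double_points_map finite_double_points crossings_subset finite_bars in auto)

lemma cut_points_map: "cut_points D' = cut_points D"
  by (auto simp: cut_points_def bar_point_map image_image)

lemma semi_arcs_map: "semi_arcs D' = semi_arcs D"
  by (simp add: semi_arcs_components cut_points_map)

lemma germ_map: "arrives D' = arrives D" "leaves D' = leaves D"
  by (simp_all add: arrives_def[abs_def] leaves_def[abs_def] semi_arcs_map)

lemma positive_crossing_map:
  assumes "c \<in> real_crossings D"
  shows "positive_crossing D' c \<longleftrightarrow> positive_crossing D c"
proof -
  obtain p q where c: "c = (p, q)" by (cases c)
  then have "p \<in> source D" "q \<in> source D" "curve D p = curve D q"
    using assms crossings_subset by (auto simp: double_points_def)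
  then show ?thesis by (simp add: c positive_crossing_def velocity_map orientation_pos_iff)
qed

text \<open>Equality and not just isomorphism: semi-arcs are sets of points of the circles, on which
  \<open>f\<close> does not act, so the presentations coincide once the signs of the crossings
  agree.\<close>

lemma twisted_link_group_map: "twisted_link_group D' = twisted_link_group D"
proof -
  have "upper_rel D' c = upper_rel D c" "lower_rel D' c = lower_rel D c" if "c \<in> real_crossings D" for c
    using positive_crossing_map[OF that] by (cases c, simp add: upper_rel_def lower_rel_def germ_map)+
  moreover have "bar_rel D' (f ` B) = bar_rel D B" if "B \<in> bars D" for B
    using that by (simp add: bar_rel_def germ_map bar_point_map)
  ultimately show ?thesis
    by (simp add: twisted_link_group_def semi_arcs_map image_image)
qed

end

end

section \<open>The double covering\<close>

definition side :: "bool \<Rightarrow> complex \<Rightarrow> complex" where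
  "side m z = (if m then reflect z else z)"

text \<open>The strands of both copies in terms of \<open>D\<close> alone, so that one Boolean
  covers the two cases. On the source the value for \<open>True\<close> agrees with
  \<open>strand (mirror D)\<close>; see \<open>strand_mirror\<close>.\<close>

definition side_strand :: "diagram \<Rightarrow> bool \<Rightarrow> point \<Rightarrow> complex \<times> complex" where
  "side_strand D m p = (side m (curve D p), sgn (side m (velocity D p)))"

lemma Re_side [simp]: "Re (side m z) = (if m then - Re z else Re z)"
  and Im_side [simp]: "Im (side m z) = Im z"
  by (simp_all add: side_def reflect_def)

lemma side_inject [simp]: "side m z = side m w \<longleftrightarrow> z = w"
  by (auto simp: complex_eq_iff)

lemma side_eq_0 [simp]: "side m z = 0 \<longleftrightarrow> z = 0"
  by (auto simp: complex_eq_iff)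

lemma side_diff: "side m (z - w) = side m z - side m w"
  by (simp add: complex_eq_iff)

lemma norm_side [simp]: "norm (side m z) = norm z"
  by (simp add: cmod_def)

lemma inner_side [simp]: "side m z \<bullet> side m w = z \<bullet> w"
  by (simp add: inner_complex_def)

lemma sgn_side: "sgn (side m z) = side m (sgn z)"
  by (simp add: sgn_div_norm complex_eq_iff)

lemma linear_side: "linear (side m)"
  by (rule linearI) (simp_all add: complex_eq_iff)

lemma continuous_on_side [continuous_intros]:
  "continuous_on S g \<Longrightarrow> continuous_on S (\<lambda>x. side m (g x))"
  by (rule bounded_linear.continuous_on[OF linear_side[unfolded linear_conv_bounded_linear]])

lemma orientation_side: "orientation (side m u) (side m v) = (if m then - 1 else 1) * orientation u v"
  by (simp add: orientation_def)

lemma orientation_swap: "orientation v u = - orientation u v"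
  by (simp add: orientation_def)

text \<open>\<open>strand\<close> keeps only unit tangents, so the signs of crossings have to be
  readable from these.\<close>

lemma positive_crossing_sgn:
  "positive_crossing D (p, q) \<longleftrightarrow> orientation (sgn (velocity D p)) (sgn (velocity D q)) > 0"
proof (cases "velocity D p = 0 \<or> velocity D q = 0")
  case False
  have "orientation (sgn (velocity D p)) (sgn (velocity D q)) =
      orientation (velocity D p) (velocity D q) / (norm (velocity D p) * norm (velocity D q))"
    by (simp add: orientation_def sgn_div_norm divide_simps)
  with False show ?thesis by (simp add: positive_crossing_def zero_less_divide_iff mult_less_0_iff)
qed (auto simp: positive_crossing_def orientation_def)

text \<open>
  The Boolean \<open>m\<close> selects a side: \<open>False\<close> stands for \<open>D\<close> itself and \<open>True\<close> for its mirror image.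
  The arc \<open>A B m\<close> of the covering starts at the bottom end \<open>P B\<close> on side \<open>m\<close> and ends at the top
  end \<open>Q B\<close> on the other side.
\<close>

locale covering = D: immersed D + C: immersed C for D C :: diagram +
  fixes lo hi :: "complex set \<Rightarrow> real" and P Q :: "complex set \<Rightarrow> point"
    and A :: "complex set \<Rightarrow> bool \<Rightarrow> (complex \<times> complex) set"
    and J :: "complex set \<Rightarrow> point set" and h :: "point \<Rightarrow> real" and X :: "point set"
  defines "J \<equiv> \<lambda>B. barred_arc D B (lo B) (hi B)"
    and "h \<equiv> \<lambda>p. Im (curve D p)"
    and "X \<equiv> fst ` real_crossings D \<union> snd ` real_crossings D"
  assumes right: "p \<in> source D \<Longrightarrow> Re (curve D p) > 0"
    and no_bars: "bars C = {}"
    and P: "B \<in> bars D \<Longrightarrow> P B \<in> J B" and Q: "B \<in> bars D \<Longrightarrow> Q B \<in> J B"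
    and h_P: "B \<in> bars D \<Longrightarrow> h (P B) = lo B" and h_Q: "B \<in> bars D \<Longrightarrow> h (Q B) = hi B"
    and inj_h: "B \<in> bars D \<Longrightarrow> inj_on h (J B)"
    and compact_J: "B \<in> bars D \<Longrightarrow> compact (J B)"
    and openin_J: "B \<in> bars D \<Longrightarrow> openin (top_of_set (source D)) (J B - {P B, Q B})"
    and closure_P: "B \<in> bars D \<Longrightarrow> P B \<in> closure (source D - J B)"
    and closure_Q: "B \<in> bars D \<Longrightarrow> Q B \<in> closure (source D - J B)"
    and lower: "B \<in> bars D \<Longrightarrow> p \<in> J B \<Longrightarrow> h p < h (bar_point D B) \<Longrightarrow>
      semi_arc_at D p = semi_arc_at D (P B)"
    and upper: "B \<in> bars D \<Longrightarrow> p \<in> J B \<Longrightarrow> h p > h (bar_point D B) \<Longrightarrow>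
      semi_arc_at D p = semi_arc_at D (Q B)"
    and germ_bar: "B \<in> bars D \<Longrightarrow> \<exists>\<sigma>\<in>{1, - 1}. germ D (- \<sigma>) (bar_point D B) (semi_arc_at D (P B)) \<and>
      germ D \<sigma> (bar_point D B) (semi_arc_at D (Q B))"
    and cut_J: "B \<in> bars D \<Longrightarrow> cut_points D \<inter> J B = {bar_point D B}"
    and X_J: "B \<in> bars D \<Longrightarrow> X \<inter> J B = {}"
    and h_bar: "B \<in> bars D \<Longrightarrow> lo B < h (bar_point D B) \<and> h (bar_point D B) < hi B"
    and strips: "B \<in> bars D \<Longrightarrow> B' \<in> bars D \<Longrightarrow> y \<in> {lo B..hi B} \<Longrightarrow> y \<in> {lo B'..hi B'} \<Longrightarrow> B = B'"
    and connected_A: "B \<in> bars D \<Longrightarrow> connected (A B m)"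
    and compact_A: "B \<in> bars D \<Longrightarrow> compact (A B m)"
    and range_A: "B \<in> bars D \<Longrightarrow> z \<in> A B m \<Longrightarrow> Im (fst z) \<in> {lo B..hi B}"
    and bottom_A: "B \<in> bars D \<Longrightarrow> z \<in> A B m \<Longrightarrow> Im (fst z) = lo B \<Longrightarrow> fst z = side m (curve D (P B))"
    and top_A: "B \<in> bars D \<Longrightarrow> z \<in> A B m \<Longrightarrow> Im (fst z) = hi B \<Longrightarrow> fst z = side (\<not> m) (curve D (Q B))"
    and disjoint_A: "B \<in> bars D \<Longrightarrow> A B False \<inter> A B True = {}"
    and kept_A: "B \<in> bars D \<Longrightarrow> p \<in> source D \<Longrightarrow> (\<And>B'. B' \<in> bars D \<Longrightarrow> p \<notin> J B') \<Longrightarrow>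
      side_strand D m p \<notin> A B m'"
    and strand_C: "strand C ` source C =
      (\<Union>m. side_strand D m ` (source D - \<Union>(J ` bars D))) \<union> (\<Union>B\<in>bars D. \<Union>m. A B m)"
    and crossings_C: "map_prod (strand C) (strand C) ` real_crossings C =
      map_prod (side_strand D False) (side_strand D False) ` real_crossings D \<union>
      map_prod (side_strand D True) (side_strand D True) ` (real_crossings D)\<inverse>"
begin

abbreviation "S \<equiv> source D"
abbreviation "st \<equiv> side_strand D"

text \<open>The ends of the barred arcs are included to make this set compact, whereas
  \<open>strand_C\<close> takes its kept strands from the points off the closed barred arcs. The gap
  is closed by \<open>end_in_A\<close>.\<close>

definition K :: "point set" where
  "K = S - (\<Union>B\<in>bars D. J B - {P B, Q B})"

lemma J_subset: "J B \<subseteq> S"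
  using connected_component_subset unfolding J_def barred_arc_def by blast

lemma h_J: "p \<in> J B \<Longrightarrow> h p \<in> {lo B..hi B}"
  using connected_component_subset[of "{p \<in> S. curve D p \<in> strip (lo B) (hi B)}" "bar_point D B"]
  by (auto simp: J_def h_def barred_arc_def strip_def)

lemma J_disjoint: "B \<in> bars D \<Longrightarrow> B' \<in> bars D \<Longrightarrow> p \<in> J B \<Longrightarrow> p \<in> J B' \<Longrightarrow> B = B'"
  using h_J strips by blast

lemma cut_points_D: "cut_points D = X \<union> bar_point D ` bars D"
  by (simp add: cut_points_def X_def)

lemma X_subset: "X \<subseteq> S - \<Union>(J ` bars D)"
  using D.cut_points_subset X_J by (auto simp: cut_points_D)

lemma S_minus_J_subset: "S - \<Union>(J ` bars D) \<subseteq> K"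
  by (auto simp: K_def)

lemma
  assumes B: "B \<in> bars D"
  shows P_K: "P B \<in> K" and Q_K: "Q B \<in> K"
proof -
  have "p \<in> K" if p: "p \<in> {P B, Q B}" for p
  proof -
    have pJ: "p \<in> J B" using p P[OF B] Q[OF B] by blast
    have "p \<notin> J B' - {P B', Q B'}" if "B' \<in> bars D" for B'
      using J_disjoint[OF B that pJ] p by blast
    with pJ J_subset show ?thesis unfolding K_def by blast
  qed
  then show "P B \<in> K" "Q B \<in> K" by simp_all
qed

lemma K_cases:
  assumes "p \<in> K"
  obtains "p \<in> S" "\<And>B. B \<in> bars D \<Longrightarrow> p \<notin> J B" | B where "B \<in> bars D" "p = P B" | B where "B \<in> bars D" "p = Q B"
  using assms by (auto simp: K_def)

lemma cut_K: "cut_points D \<inter> K = X"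
proof -
  have "bar_point D B \<notin> K" if B: "B \<in> bars D" for B
  proof -
    have "bar_point D B \<in> J B" using cut_J[OF B] by blast
    moreover have "bar_point D B \<noteq> P B" "bar_point D B \<noteq> Q B"
      using h_bar[OF B] h_P[OF B] h_Q[OF B] by auto
    ultimately show ?thesis using B by (auto simp: K_def)
  qed
  then show ?thesis using X_subset S_minus_J_subset by (auto simp: cut_points_D)
qed

lemma compact_K: "compact K"
proof -
  have "openin (top_of_set S) (\<Union>B\<in>bars D. J B - {P B, Q B})"
    using openin_J by blast
  then have "closedin (top_of_set S) K" by (simp add: K_def closedin_diff)
  then show ?thesis using compact_source closedin_compact by blast
qed

lemma continuous_on_st: "continuous_on S (st m)"
  unfolding side_strand_def
  by (intro continuous_intros continuous_on_sgn D.continuous_on_curve D.continuous_on_velocity)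
    (use D.velocity_nonzero in auto)

text \<open>The line \<open>x = 0\<close> separates the two copies, so the sign of the real part
  determines the side; after that \<open>strand D\<close> is injective.\<close>

lemma st_inject:
  assumes "p \<in> S" "q \<in> S" "st m p = st m' q"
  shows "m = m' \<and> p = q"
proof -
  have "Re (side m (curve D p)) = Re (side m' (curve D q))" using assms by (simp add: side_strand_def)
  then have "m = m'" using right[OF assms(1)] right[OF assms(2)] by (auto split: if_splits)
  with assms have "strand D p = strand D q" by (auto simp: side_strand_def strand_def sgn_side)
  with \<open>m = m'\<close> show ?thesis using D.inj_on_strand assms by (auto dest: inj_onD)
qed

text \<open>Points off the barred arcs never give strands on a connecting arc, by
  \<open>kept_A\<close>. An end of a barred arc has a boundary height of its strip, where the
  connecting arc has only its own endpoint; positivity of the real part then fixes the side.\<close>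

lemma overlap:
  assumes "p \<in> K" "B \<in> bars D" "st m p \<in> A B m'"
  shows "(m = m' \<and> p = P B) \<or> (m = (\<not> m') \<and> p = Q B)"
proof -
  have same_side: "m1 = m2" if "side m1 (curve D r) = side m2 (curve D r)" "r \<in> S" for m1 m2 r
    using that right[of r] by (auto simp: complex_eq_iff split: if_splits)
  have hp: "h p \<in> {lo B..hi B}" using range_A[OF assms(2,3)] by (simp add: side_strand_def h_def)
  show ?thesis
    using assms(1)
  proof (cases rule: K_cases)
    case 1
    then show ?thesis using kept_A[OF assms(2), of p m m'] assms(3) by blast
  next
    case (2 B')
    then have "B = B'" using strips[OF assms(2), of B' "h p"] hp h_J[OF P[of B']] by auto
    with 2 have "side m (curve D p) = side m' (curve D p)"
      using bottom_A[OF assms(2,3)] h_P[of B] by (simp add: side_strand_def h_def)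
    then show ?thesis using same_side[of m p m'] J_subset P 2 \<open>B = B'\<close> by blast
  next
    case (3 B')
    then have "B = B'" using strips[OF assms(2), of B' "h p"] hp h_J[OF Q[of B']] by auto
    with 3 have "side m (curve D p) = side (\<not> m') (curve D p)"
      using top_A[OF assms(2,3)] h_Q[of B] by (simp add: side_strand_def h_def)
    then show ?thesis using same_side[of m p "\<not> m'"] J_subset Q 3 \<open>B = B'\<close> by blast
  qed
qed

text \<open>The ends of a barred arc are limits of kept points, and the covering is closed.\<close>

lemma end_in_A:
  assumes B: "B \<in> bars D" and p: "p \<in> {P B, Q B}"
  shows "\<exists>m'. st m p \<in> A B m'"
proof -
  have pJ: "p \<in> J B" "p \<in> S" "p \<in> closure (S - J B)"
    using p P[OF B] Q[OF B] J_subset closure_P[OF B] closure_Q[OF B] by auto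
  have "p \<in> closure (S - \<Union>(J ` bars D))"
  proof -
    \<comment> \<open>\<open>closure_P\<close> and \<open>closure_Q\<close> only speak of
      \<open>J B\<close>; this neighbourhood of \<open>p\<close> removes the other barred
      arcs.\<close>
    let ?U = "- (\<Union>B'\<in>bars D - {B}. J B')"
    have "open ?U"
      using D.finite_bars compact_J by (intro open_Compl closed_UN) (auto intro: compact_imp_closed)
    moreover have "p \<in> ?U" using J_disjoint[OF B _ pJ(1)] by auto
    ultimately have "p \<in> closure (?U \<inter> (S - J B))"
      using pJ(3) open_Int_closure_subset by blast
    then show ?thesis by (rule closure_mono[THEN subsetD, rotated]) auto
  qed
  moreover have "st m ` closure (S - \<Union>(J ` bars D)) \<subseteq> strand C ` source C"
  proof (rule image_closure_subset)
    show "continuous_on (closure (S - \<Union>(J ` bars D))) (st m)"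
      using closure_minimal[of "S - \<Union>(J ` bars D)" S] compact_imp_closed[OF compact_source[of D]]
      by (intro continuous_on_subset[OF continuous_on_st]) auto
    show "closed (strand C ` source C)" using C.compact_strand_image by (rule compact_imp_closed)
    show "st m ` (S - \<Union>(J ` bars D)) \<subseteq> strand C ` source C" unfolding strand_C by blast
  qed
  ultimately have "st m p \<in> strand C ` source C" by blast
  moreover have "st m p \<notin> (\<Union>m. st m ` (S - \<Union>(J ` bars D)))"
    using st_inject[OF pJ(2)] pJ(1) B by blast
  ultimately obtain B' m' where B': "B' \<in> bars D" "st m p \<in> A B' m'"
    unfolding strand_C by blast
  have "p \<in> K" using p P_K[OF B] Q_K[OF B] by auto
  then have "p \<in> {P B', Q B'}" using overlap B' by blast
  then have "B' = B" using J_disjoint[OF B' (1) B, of p] P[OF B'(1)] Q[OF B'(1)] pJ(1) by blast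
  with B' show ?thesis by blast
qed

text \<open>As \<open>P B\<close> and \<open>Q B\<close> differ, \<open>overlap\<close> leaves only
  the expected connecting arc. In particular its tangents at the ends are those of the diagram,
  which \<open>monotone_arc\<close> does not postulate.\<close>

lemma st_P: "B \<in> bars D \<Longrightarrow> st m (P B) \<in> A B m"
  and st_Q: "B \<in> bars D \<Longrightarrow> st (\<not> m) (Q B) \<in> A B m"
proof -
  assume B: "B \<in> bars D"
  have PQ: "P B \<noteq> Q B" using h_P[OF B] h_Q[OF B] h_bar[OF B] by force
  obtain m1 m2 where m: "st m (P B) \<in> A B m1" "st (\<not> m) (Q B) \<in> A B m2" using end_in_A[OF B] by blast
  show "st m (P B) \<in> A B m" using overlap[OF P_K[OF B] B m(1)] PQ m(1) by auto
  show "st (\<not> m) (Q B) \<in> A B m" using overlap[OF Q_K[OF B] B m(2)] PQ m(2) by auto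
qed

lemma st_K:
  assumes "p \<in> K"
  shows "st m p \<in> strand C ` source C"
  using assms
proof (cases rule: K_cases)
  case 1
  then show ?thesis unfolding strand_C by blast
next
  case (2 B)
  then show ?thesis using st_P[of B m] unfolding strand_C by blast
next
  case (3 B)
  then have "st m p \<in> A B (\<not> m)" using st_Q[of B "\<not> m"] by simp
  then show ?thesis using 3 unfolding strand_C by blast
qed

section \<open>Lifting kept points to the circles of the covering\<close>

definition lift :: "bool \<Rightarrow> point \<Rightarrow> point" where
  "lift m p = inv_into (source C) (strand C) (st m p)"

lemma lift: "p \<in> K \<Longrightarrow> lift m p \<in> source C" "p \<in> K \<Longrightarrow> strand C (lift m p) = st m p"
  using st_K[of p m] by (auto simp: lift_def inv_into_into f_inv_into_f)

lemma continuous_on_inv_strand: "continuous_on (strand C ` source C) (inv_into (source C) (strand C))"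
  by (rule continuous_on_inv[OF C.continuous_on_strand compact_source])
    (use C.inj_on_strand in simp)

lemma K_subset: "K \<subseteq> S"
  by (auto simp: K_def)

lemma continuous_on_lift: "continuous_on K (lift m)"
  unfolding lift_def
  by (rule continuous_on_compose2[OF continuous_on_inv_strand
        continuous_on_subset[OF continuous_on_st K_subset]])
    (use st_K in auto)

lemma lift_inject:
  assumes "p \<in> K" "q \<in> K"
  shows "lift m p = lift m' q \<longleftrightarrow> m = m' \<and> p = q"
proof
  assume "lift m p = lift m' q"
  then have "st m p = st m' q" using lift(2)[OF assms(1), of m] lift(2)[OF assms(2), of m'] by simp
  with assms show "m = m' \<and> p = q" using K_subset by (intro st_inject) auto
qed simp

lemma strand_cut_C: "strand C ` cut_points C = (\<Union>m. st m ` X)"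
proof -
  have ends: "fst ` map_prod g g ` R \<union> snd ` map_prod g g ` R = g ` (fst ` R \<union> snd ` R)"
    for g :: "point \<Rightarrow> complex \<times> complex" and R
    by (simp add: image_Un image_image)
  have conv: "fst ` R\<inverse> \<union> snd ` R\<inverse> = fst ` R \<union> snd ` R" for R :: "(point \<times> point) set"
    by force
  have "strand C ` cut_points C =
      fst ` map_prod (strand C) (strand C) ` real_crossings C \<union>
      snd ` map_prod (strand C) (strand C) ` real_crossings C"
    by (simp add: cut_points_def no_bars ends)
  also have "\<dots> =
      (fst ` map_prod (st False) (st False) ` real_crossings D \<union>
       snd ` map_prod (st False) (st False) ` real_crossings D) \<union>
      (fst ` map_prod (st True) (st True) ` (real_crossings D)\<inverse> \<union>
       snd ` map_prod (st True) (st True) ` (real_crossings D)\<inverse>)"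
    unfolding crossings_C image_Un by blast
  also have "\<dots> = st False ` X \<union> st True ` X"
    unfolding ends conv X_def ..
  finally show ?thesis by (simp add: UNIV_bool Un_commute)
qed

lemma lift_cut:
  assumes p: "p \<in> K"
  shows "lift m p \<in> cut_points C \<longleftrightarrow> p \<in> X"
proof
  assume "lift m p \<in> cut_points C"
  then have "strand C (lift m p) \<in> (\<Union>m. st m ` X)" unfolding strand_cut_C[symmetric] by (rule imageI)
  then obtain m' q where q: "q \<in> X" "st m p = st m' q" unfolding lift(2)[OF p] by blast
  have "p = q" using st_inject[OF _ _ q(2)] p q(1) K_subset X_subset by blast
  with q show "p \<in> X" by simp
next
  assume "p \<in> X"
  then have "st m p \<in> strand C ` cut_points C" unfolding strand_cut_C by blast
  then obtain c where c: "c \<in> cut_points C" "strand C c = st m p" by force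
  then have "c = lift m p"
    using inj_onD[OF C.inj_on_strand, of c "lift m p"] lift[OF p] C.cut_points_subset by auto
  with c show "lift m p \<in> cut_points C" by simp
qed

text \<open>The strands of \<open>C\<close> at real crossings are those of \<open>D\<close> and its
  mirror image at real crossings. These lie over kept points, so the connecting arcs avoid
  them.\<close>

lemma A_cut:
  assumes "B \<in> bars D" "strand C x \<in> A B m"
  shows "x \<notin> cut_points C"
proof
  assume "x \<in> cut_points C"
  then have "strand C x \<in> (\<Union>m. st m ` X)" unfolding strand_cut_C[symmetric] by (rule imageI)
  then obtain m' q where q: "q \<in> X" "strand C x = st m' q" by blast
  then have "q \<in> S" "\<And>B'. B' \<in> bars D \<Longrightarrow> q \<notin> J B'" using X_subset by blast+
  then have "st m' q \<notin> A B m" by (rule kept_A[OF assms(1)])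
  with assms(2) q(2) show False by simp
qed

lemma source_C_cases:
  assumes "x \<in> source C"
  obtains m p where "p \<in> S - \<Union>(J ` bars D)" "x = lift m p" | B m where "B \<in> bars D" "strand C x \<in> A B m"
proof -
  have "strand C x \<in> strand C ` source C" using assms by blast
  then consider m p where "p \<in> S - \<Union>(J ` bars D)" "strand C x = st m p" | B m where "B \<in> bars D" "strand C x \<in> A B m"
    unfolding strand_C by blast
  then show thesis
  proof cases
    case 1
    then have "p \<in> K" using S_minus_J_subset by blast
    then have "x = lift m p"
      using inj_onD[OF C.inj_on_strand, of x "lift m p"] 1(2) assms lift by simp
    with 1(1) show thesis by (rule that(1))
  next
    case 2
    then show thesis by (rule that(2))
  qed
qed

end

section \<open>Collapsing the barred arcs onto their ends\<close>

lemma continuous_on_finite_closedin_cover: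
  fixes f :: "'a::topological_space \<Rightarrow> 'b::topological_space"
  assumes "finite \<C>" "U \<subseteq> \<Union>\<C>"
    and "\<And>T. T \<in> \<C> \<Longrightarrow> closedin (top_of_set U) T" "\<And>T. T \<in> \<C> \<Longrightarrow> continuous_on T f"
  shows "continuous_on U f"
proof -
  have "continuous_map (top_of_set U) euclidean f"
  proof (rule pasting_lemma_closed[of \<C> _ id _ "\<lambda>_. f"])
    fix T assume T: "T \<in> \<C>"
    then have "U \<inter> T = T" using closedin_imp_subset assms(3) by blast
    then show "continuous_map (subtopology (top_of_set U) (id T)) euclidean f"
      using assms(4)[OF T] by (simp add: subtopology_subtopology)
  qed (use assms in auto)
  then show ?thesis by simp
qed

context covering
begin

text \<open>\<open>lift\<close> is well behaved only on \<open>K\<close>, whereas a semi-arc may end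
  at a bar inside a barred arc. Each half of a barred arc is therefore sent to its end; the jump
  occurs at the bar point, which is a cut point. The bar picked by \<open>THE\<close> is unique
  because the strips are disjoint.\<close>

definition retract :: "point \<Rightarrow> point" where
  "retract p = (if p \<in> \<Union>(J ` bars D)
    then let B = THE B. B \<in> bars D \<and> p \<in> J B in if h p < h (bar_point D B) then P B else Q B
    else p)"

lemma retract_J:
  assumes "B \<in> bars D" "p \<in> J B"
  shows "retract p = (if h p < h (bar_point D B) then P B else Q B)"
proof -
  have "(THE B. B \<in> bars D \<and> p \<in> J B) = B"
    using assms J_disjoint by (intro the_equality) blast+
  with assms show ?thesis by (auto simp: retract_def Let_def)
qed

lemma retract_K:
  assumes "p \<in> K"
  shows "retract p = p"
  using assms
proof (cases rule: K_cases)
  case 1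
  then show ?thesis by (auto simp: retract_def)
next
  case (2 B)
  then show ?thesis using retract_J[OF 2(1) P] h_P h_bar by simp
next
  case (3 B)
  then show ?thesis using retract_J[OF 3(1) Q] h_Q h_bar[OF 3(1)] by simp
qed

lemma J_cases:
  assumes "p \<in> S"
  obtains "p \<in> S - \<Union>(J ` bars D)" | B where "B \<in> bars D" "p \<in> J B"
  using assms by blast

lemma
  assumes "p \<in> S" "p \<notin> cut_points D"
  shows retract_in_K: "retract p \<in> K" and retract_not_X: "retract p \<notin> X"
proof -
  have "retract p \<in> K \<and> retract p \<notin> X"
    using assms(1)
  proof (cases rule: J_cases)
    case 1
    then have "p \<in> K" using S_minus_J_subset by blast
    moreover have "p \<notin> X" using assms(2) cut_points_D by blast
    ultimately show ?thesis using retract_K by simp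
  next
    case (2 B)
    then have "P B \<notin> X" "Q B \<notin> X" using P Q X_J by blast+
    then show ?thesis using P_K Q_K retract_J 2 by simp
  qed
  then show "retract p \<in> K" "retract p \<notin> X" by blast+
qed

lemma h_J_bar:
  assumes "B \<in> bars D" "p \<in> J B" "p \<notin> cut_points D"
  shows "h p \<noteq> h (bar_point D B)"
proof
  have b: "bar_point D B \<in> J B" "bar_point D B \<in> cut_points D" using cut_J[OF assms(1)] by blast+
  assume "h p = h (bar_point D B)"
  then have "p = bar_point D B" using inj_onD[OF inj_h[OF assms(1)]] assms(2) b(1) by blast
  then show False using assms(3) b(2) by simp
qed

lemma semi_arc_at_retract:
  assumes "p \<in> S" "p \<notin> cut_points D"
  shows "semi_arc_at D (retract p) = semi_arc_at D p"
  using assms(1)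
proof (cases rule: J_cases)
  case 1
  then have "p \<in> K" using S_minus_J_subset by blast
  then show ?thesis by (simp add: retract_K)
next
  case (2 B)
  then show ?thesis
    using h_J_bar[OF 2 assms(2)] lower[OF 2] upper[OF 2] retract_J[OF 2] by (cases "h p < h (bar_point D B)") auto
qed

text \<open>Once the bar point is removed, the lower and the upper half of a barred arc are disjoint
  and both relatively closed. The constant maps on the halves and the identity on \<open>K\<close>
  can be pasted.\<close>

lemma continuous_on_retract: "continuous_on (S - cut_points D) retract"
proof -
  let ?U = "S - cut_points D"
  let ?L = "\<lambda>B. ?U \<inter> (J B \<inter> h -` {..h (bar_point D B)})"
  let ?H = "\<lambda>B. ?U \<inter> (J B \<inter> h -` {h (bar_point D B)..})"
  have h_cont: "continuous_on (J B) h" for B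
    unfolding h_def using continuous_on_subset[OF D.continuous_on_curve J_subset]
    by (intro continuous_intros)
  have closed: "closed (J B \<inter> h -` {..y})" "closed (J B \<inter> h -` {y..})" if "B \<in> bars D" for B y
    using continuous_closed_preimage[OF h_cont compact_imp_closed[OF compact_J[OF that]]] by simp_all
  show ?thesis
  proof (rule continuous_on_finite_closedin_cover)
    show "finite (insert (?U \<inter> K) (?L ` bars D \<union> ?H ` bars D))" using D.finite_bars by simp
    show "?U \<subseteq> \<Union> (insert (?U \<inter> K) (?L ` bars D \<union> ?H ` bars D))"
    proof
      fix p assume p: "p \<in> ?U"
      show "p \<in> \<Union> (insert (?U \<inter> K) (?L ` bars D \<union> ?H ` bars D))"
      proof (cases "p \<in> K")
        case False
        then obtain B where "B \<in> bars D" "p \<in> J B" using p by (auto simp: K_def)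
        from p \<open>p \<in> J B\<close> have "p \<in> ?L B \<or> p \<in> ?H B" by auto
        then show ?thesis
        proof
          assume "p \<in> ?L B"
          then show ?thesis by (rule UnionI[rotated]) (use \<open>B \<in> bars D\<close> in simp)
        next
          assume "p \<in> ?H B"
          then show ?thesis by (rule UnionI[rotated]) (use \<open>B \<in> bars D\<close> in simp)
        qed
      qed (use p in blast)
    qed
    fix T assume "T \<in> insert (?U \<inter> K) (?L ` bars D \<union> ?H ` bars D)"
    then consider "T = ?U \<inter> K" | B where "B \<in> bars D" "T = ?L B" | B where "B \<in> bars D" "T = ?H B"
      by blast
    then have "closedin (top_of_set ?U) T \<and> continuous_on T retract"
    proof cases
      case 1
      have "continuous_on T retract \<longleftrightarrow> continuous_on T (\<lambda>p. p)"
        using 1 retract_K by (intro continuous_on_cong) auto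
      then show ?thesis using 1 compact_imp_closed[OF compact_K] by (simp add: closedin_closed_Int)
    next
      case (2 B)
      have "continuous_on T retract \<longleftrightarrow> continuous_on T (\<lambda>p. P B)"
      proof (intro continuous_on_cong HOL.refl)
        fix p assume "p \<in> T"
        then have "p \<in> J B" "p \<notin> cut_points D" "h p \<le> h (bar_point D B)" using 2 by auto
        then show "retract p = P B" using retract_J[OF 2(1)] h_J_bar[OF 2(1)] by fastforce
      qed
      then show ?thesis using 2 closed(1) by (simp add: closedin_closed_Int)
    next
      case (3 B)
      have "continuous_on T retract \<longleftrightarrow> continuous_on T (\<lambda>p. Q B)"
        using 3 retract_J by (intro continuous_on_cong) auto
      then show ?thesis using 3 closed(2) by (simp add: closedin_closed_Int)
    qed
    then show "closedin (top_of_set ?U) T" "continuous_on T retract" by blast+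
  qed
qed

section \<open>The semi-arcs of the covering\<close>

definition cover_arc :: "bool \<Rightarrow> point set \<Rightarrow> point set" where
  "cover_arc m a = semi_arc_at C (lift m (retract (SOME p. p \<in> a)))"

lemma lift_not_cut:
  assumes "p \<in> K" "p \<notin> X"
  shows "lift m p \<in> source C - cut_points C"
  using lift(1)[OF assms(1)] lift_cut[OF assms(1)] assms(2) by blast

text \<open>The image of \<open>a\<close> under \<open>retract\<close> followed by
  \<open>lift m\<close> is connected and avoids the cut points of \<open>C\<close>, so the point
  chosen in the definition of \<open>cover_arc\<close> does not matter.\<close>

lemma cover_arc:
  assumes a: "a \<in> semi_arcs D" and p: "p \<in> a"
  shows "cover_arc m a = semi_arc_at C (lift m (retract p))"
  unfolding cover_arc_def
proof (rule semi_arc_at_eqI)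
  have sub: "a \<subseteq> S - cut_points D" using a by (rule semi_arc_subset)
  have K: "retract ` a \<subseteq> K" "retract ` a \<inter> X = {}" using retract_in_K retract_not_X sub by blast+
  have "continuous_on a (\<lambda>p. lift m (retract p))"
    by (rule continuous_on_compose2[OF continuous_on_lift continuous_on_subset[OF continuous_on_retract sub] K(1)])
  then show "connected ((\<lambda>p. lift m (retract p)) ` a)"
    using connected_semi_arc[OF a] by (rule connected_continuous_image)
  show "(\<lambda>p. lift m (retract p)) ` a \<subseteq> source C - cut_points C"
    using lift_not_cut K by blast
  show "lift m (retract (SOME p. p \<in> a)) \<in> (\<lambda>p. lift m (retract p)) ` a"
    using someI[of "\<lambda>p. p \<in> a", OF p] by blast
  show "lift m (retract p) \<in> (\<lambda>p. lift m (retract p)) ` a"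
    using p by blast
qed

lemma K_minus_X:
  assumes "p \<in> K" "p \<notin> X"
  shows "semi_arc_at D p \<in> semi_arcs D" and "p \<in> semi_arc_at D p"
proof -
  have "p \<in> S" "p \<notin> cut_points D" using assms K_subset cut_K by blast+
  then show "semi_arc_at D p \<in> semi_arcs D" "p \<in> semi_arc_at D p"
    by (rule semi_arc_at_in_semi_arcs, rule mem_semi_arc_at)
qed

lemma cover_arc_K:
  assumes "p \<in> K" "p \<notin> X"
  shows "cover_arc m (semi_arc_at D p) = semi_arc_at C (lift m p)"
  using cover_arc[OF K_minus_X[OF assms]] retract_K[OF assms(1)] by simp

lemma semi_arc_meets_K:
  assumes "a \<in> semi_arcs D"
  obtains p where "p \<in> K" "p \<notin> X" "a = semi_arc_at D p"
proof -
  obtain q where q: "q \<in> a" using semi_arc_nonempty[OF assms] by blast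
  then have "q \<in> S" "q \<notin> cut_points D" using semi_arc_subset[OF assms] by blast+
  then show thesis
    using that[of "retract q"] retract_in_K retract_not_X semi_arc_at_retract semi_arc_eq[OF assms q] by simp
qed

lemma cover_arc_in_semi_arcs:
  assumes "a \<in> semi_arcs D"
  shows "cover_arc m a \<in> semi_arcs C"
proof -
  obtain p where p: "p \<in> K" "p \<notin> X" "a = semi_arc_at D p" using semi_arc_meets_K[OF assms] .
  then show ?thesis using lift_not_cut[OF p(1,2), of m] by (simp add: cover_arc_K semi_arc_at_in_semi_arcs)
qed

lemma P_X: "B \<in> bars D \<Longrightarrow> P B \<notin> X" and Q_X: "B \<in> bars D \<Longrightarrow> Q B \<notin> X"
  using P Q X_J by blast+

lemma semi_arc_A:
  assumes B: "B \<in> bars D" and x: "x \<in> source C" "strand C x \<in> A B m" and y: "y \<in> source C" "strand C y \<in> A B m"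
  shows "semi_arc_at C x = semi_arc_at C y"
proof (rule semi_arc_at_eqI)
  let ?inv = "inv_into (source C) (strand C)"
  have sub: "A B m \<subseteq> strand C ` source C" unfolding strand_C using B by blast
  show "connected (?inv ` A B m)"
    using continuous_on_subset[OF continuous_on_inv_strand sub] connected_A[OF B]
    by (rule connected_continuous_image)
  show "?inv ` A B m \<subseteq> source C - cut_points C"
  proof
    fix z assume "z \<in> ?inv ` A B m"
    then have "z \<in> source C" "strand C z \<in> A B m"
      using sub by (auto simp: f_inv_into_f subset_iff intro: inv_into_into)
    then show "z \<in> source C - cut_points C" using A_cut[OF B] by blast
  qed
  show "x \<in> ?inv ` A B m" "y \<in> ?inv ` A B m"
    using x y inv_into_f_f[OF C.inj_on_strand] by (metis imageI)+
qed

lemma cover_arc_A: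
  assumes B: "B \<in> bars D" and x: "x \<in> source C" "strand C x \<in> A B m"
  shows "semi_arc_at C x = cover_arc m (semi_arc_at D (P B))"
  unfolding cover_arc_K[OF P_K[OF B] P_X[OF B]]
  by (rule semi_arc_A[OF B x]) (use lift[OF P_K[OF B]] st_P[OF B] in simp_all)

text \<open>The geometric content of a bar relation: the connecting arc \<open>A B m\<close> joins
  \<open>P B\<close> on side \<open>m\<close> to \<open>Q B\<close> on the other side without
  meeting a real crossing.\<close>

lemma cover_arc_bar:
  assumes B: "B \<in> bars D"
  shows "cover_arc m (semi_arc_at D (P B)) = cover_arc (\<not> m) (semi_arc_at D (Q B))"
proof -
  have "semi_arc_at C (lift (\<not> m) (Q B)) = cover_arc m (semi_arc_at D (P B))"
    by (rule cover_arc_A[OF B]) (use lift[OF Q_K[OF B]] st_Q[OF B] in simp_all)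
  then show ?thesis using cover_arc_K[OF Q_K[OF B] Q_X[OF B]] by simp
qed

lemma cover_arc_surj:
  assumes c: "c \<in> semi_arcs C"
  obtains m a where "a \<in> semi_arcs D" "c = cover_arc m a"
proof -
  obtain x where "x \<in> c" using semi_arc_nonempty[OF c] by blast
  then have x: "x \<in> source C" "x \<notin> cut_points C" "c = semi_arc_at C x"
    using semi_arc_subset[OF c] semi_arc_eq[OF c] by blast+
  show thesis
    using x(1)
  proof (cases rule: source_C_cases)
    case (1 m p)
    then have "p \<in> K" "p \<notin> X" using S_minus_J_subset lift_cut x(2) by blast+
    then show thesis using that[OF K_minus_X(1)] cover_arc_K x(3) 1(2) by metis
  next
    case (2 B m)
    then show thesis using that[OF K_minus_X(1)[OF P_K P_X]] cover_arc_A x by metis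
  qed
qed

text \<open>
  A labelling of the semi-arcs on both sides that agrees along the arcs of the covering is locally
  constant on the complement of the crossings of \<open>C\<close>, hence constant on each semi-arc of \<open>C\<close>.
\<close>

lemma cover_arc_label:
  fixes lab :: "bool \<Rightarrow> point set \<Rightarrow> 'v"
  assumes bar: "\<And>B m. B \<in> bars D \<Longrightarrow> lab m (semi_arc_at D (P B)) = lab (\<not> m) (semi_arc_at D (Q B))"
    and a: "a \<in> semi_arcs D" and a': "a' \<in> semi_arcs D"
    and eq: "cover_arc m a = cover_arc m' a'"
  shows "lab m a = lab m' a'"
proof (rule ccontr)
  assume neq: "lab m a \<noteq> lab m' a'"
  let ?U = "source C - cut_points C"
  \<comment> \<open>Labels are introduced as relations because a point of the covering can be
    described in two ways: lifted ends of barred arcs also lie on connecting arcs.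
    \<open>unique\<close> shows that the values agree, using \<open>bar\<close> at the ends
    \<open>Q B\<close>.\<close>
  define kept where "kept x v \<longleftrightarrow>
    (\<exists>m p. p \<in> K \<and> p \<notin> X \<and> x = lift m p \<and> v = lab m (semi_arc_at D p))" for x v
  define new where "new x v \<longleftrightarrow>
    (\<exists>B m. B \<in> bars D \<and> x \<in> source C \<and> strand C x \<in> A B m \<and> v = lab m (semi_arc_at D (P B)))" for x v
  have kept_new: "v = w" if kept: "kept x v" and new: "new x w" for x v w
  proof -
    obtain m p where p: "p \<in> K" "x = lift m p" "v = lab m (semi_arc_at D p)"
      using kept by (auto simp: kept_def)
    obtain B m' where B: "B \<in> bars D" "strand C x \<in> A B m'" "w = lab m' (semi_arc_at D (P B))"
      using new by (auto simp: new_def)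
    have "st m p \<in> A B m'" using B(2) lift(2)[OF p(1)] p(2) by simp
    from overlap[OF p(1) B(1) this] show "v = w" using p(3) B(3) bar[OF B(1), of m'] by auto
  qed
  have unique: "v = w" if "kept x v \<or> new x v" "kept x w \<or> new x w" for x v w
  proof -
    have "v = w" if v: "kept x v" and w: "kept x w"
    proof -
      obtain m p where p: "p \<in> K" "x = lift m p" "v = lab m (semi_arc_at D p)"
        using v by (auto simp: kept_def)
      obtain m' p' where p': "p' \<in> K" "x = lift m' p'" "w = lab m' (semi_arc_at D p')"
        using w by (auto simp: kept_def)
      have "m = m' \<and> p = p'" using lift_inject[OF p(1) p'(1)] p(2) p'(2) by metis
      then show "v = w" using p(3) p'(3) by simp
    qed
    moreover have "v = w" if v: "new x v" and w: "new x w"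
    proof -
      obtain B m where B: "B \<in> bars D" "strand C x \<in> A B m" "v = lab m (semi_arc_at D (P B))"
        using v by (auto simp: new_def)
      obtain B' m' where B': "B' \<in> bars D" "strand C x \<in> A B' m'" "w = lab m' (semi_arc_at D (P B'))"
        using w by (auto simp: new_def)
      have "B = B'" using strips[OF B(1) B'(1)] range_A[OF B(1,2)] range_A[OF B'(1,2)] by blast
      moreover have "m = m'"
        using disjoint_A[OF B(1)] B(2) B'(2) \<open>B = B'\<close> by (cases m; cases m') auto
      ultimately show "v = w" using B(3) B'(3) by simp
    qed
    ultimately show ?thesis using kept_new[of x v w] kept_new[of x w v] that by metis
  qed
  have total: "\<exists>v. kept x v \<or> new x v" if "x \<in> ?U" for x
  proof -
    have "x \<in> source C" using that by blast
    then show ?thesis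
    proof (cases rule: source_C_cases)
      case (1 m p)
      then have "p \<in> K" using S_minus_J_subset by blast
      moreover have "p \<notin> X" using lift_cut[OF \<open>p \<in> K\<close>, of m] 1(2) that by blast
      ultimately show ?thesis using 1(2) unfolding kept_def by blast
    next
      case (2 B m)
      then show ?thesis using \<open>x \<in> source C\<close> unfolding new_def by blast
    qed
  qed
  \<comment> \<open>For every set \<open>V\<close> of labels, the points of \<open>?U\<close> with a
    label in \<open>V\<close> are the trace of a closed set. Applied to one label and to its
    complement, this separates the connected semi-arc.\<close>
  have closed: "\<exists>F. closed F \<and> (\<forall>x\<in>?U. x \<in> F \<longleftrightarrow> (\<exists>v\<in>V. kept x v \<or> new x v))" for V
  proof -
    define Z where "Z m = {p \<in> K. p \<notin> X \<and> lab m (semi_arc_at D p) \<in> V}" for m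
    \<comment> \<open>Taking the closure of \<open>Z m\<close> may add crossings, but their lifts
      are cut points and lie outside \<open>?U\<close>. At any other limit point the semi-arc is a
      neighbourhood, so the label there is already in \<open>V\<close>.\<close>
    define F1 where "F1 = (\<Union>m. lift m ` closure (Z m))"
    define F2 where "F2 = (\<Union>B\<in>bars D. \<Union>m\<in>{m. lab m (semi_arc_at D (P B)) \<in> V}.
      source C \<inter> strand C -` A B m)"
    have closure_Z: "closure (Z m) \<subseteq> K" for m
      using compact_imp_closed[OF compact_K] by (intro closure_minimal) (auto simp: Z_def)
    have "compact (closure (Z m))" for m
      using compact_Int_closed[OF compact_K closed_closure[of "Z m"]] closure_Z by (simp add: Int_absorb1)
    then have "compact (lift m ` closure (Z m))" for m
      by (intro compact_continuous_image continuous_on_subset[OF continuous_on_lift closure_Z])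
    then have "closed F1" unfolding F1_def by (intro closed_UN) (auto intro: compact_imp_closed)
    moreover have "closed F2"
    proof -
      have "closed (source C \<inter> strand C -` A B m)" if "B \<in> bars D" for B m
        using C.continuous_on_strand compact_imp_closed[OF compact_source]
          compact_imp_closed[OF compact_A[OF that]] by (rule continuous_closed_preimage)
      then show ?thesis
        unfolding F2_def by (intro closed_UN ballI D.finite_bars finite) auto
    qed
    moreover have "x \<in> F1 \<longleftrightarrow> (\<exists>v\<in>V. kept x v)" if "x \<in> ?U" for x
    proof
      assume "x \<in> F1"
      then obtain m p where p: "p \<in> closure (Z m)" "x = lift m p" by (auto simp: F1_def)
      then have "p \<in> K" using closure_Z by blast
      then have "p \<notin> X" using lift_cut[of p m] p(2) that by blast
      have nhds: "\<forall>\<^sub>F q in nhds p. q \<in> S \<longrightarrow> q \<in> semi_arc_at D p"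
        using D.semi_arc_nhds K_minus_X[OF \<open>p \<in> K\<close> \<open>p \<notin> X\<close>] by blast
      then obtain O' where O': "open O'" "p \<in> O'" "\<And>q. q \<in> O' \<Longrightarrow> q \<in> S \<Longrightarrow> q \<in> semi_arc_at D p"
        by (auto simp: eventually_nhds)
      then obtain q where q: "q \<in> O'" "q \<in> Z m" 
        using open_Int_closure_eq_empty[OF O'(1), of "Z m"] O'(2) p(1) by blast
      then have "q \<in> semi_arc_at D p" using O'(3)[OF q(1)] K_subset unfolding Z_def by blast
      then have "semi_arc_at D p = semi_arc_at D q"
        using semi_arc_eq K_minus_X(1)[OF \<open>p \<in> K\<close> \<open>p \<notin> X\<close>] by blast
      then have "lab m (semi_arc_at D p) \<in> V" using q(2) by (simp add: Z_def)
      then show "\<exists>v\<in>V. kept x v" using \<open>p \<in> K\<close> \<open>p \<notin> X\<close> p(2) unfolding kept_def by blast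
    next
      assume "\<exists>v\<in>V. kept x v"
      then obtain m p where "p \<in> Z m" "x = lift m p" by (auto simp: kept_def Z_def)
      then show "x \<in> F1" using closure_subset[of "Z m"] by (auto simp: F1_def)
    qed
    moreover have "x \<in> F2 \<longleftrightarrow> (\<exists>v\<in>V. new x v)" if "x \<in> ?U" for x
      using that unfolding F2_def new_def by blast
    ultimately show ?thesis
      by (intro exI[of _ "F1 \<union> F2"]) (auto simp: closed_Un)
  qed
  obtain F where F: "closed F" "\<And>x. x \<in> ?U \<Longrightarrow> x \<in> F \<longleftrightarrow> (\<exists>v\<in>{lab m a}. kept x v \<or> new x v)"
    using closed[of "{lab m a}"] by blast
  obtain F' where F': "closed F'" "\<And>x. x \<in> ?U \<Longrightarrow> x \<in> F' \<longleftrightarrow> (\<exists>v\<in>- {lab m a}. kept x v \<or> new x v)"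
    using closed[of "- {lab m a}"] by blast
  obtain p where p: "p \<in> K" "p \<notin> X" "a = semi_arc_at D p" using semi_arc_meets_K[OF a] .
  obtain p' where p': "p' \<in> K" "p' \<notin> X" "a' = semi_arc_at D p'" using semi_arc_meets_K[OF a'] .
  define c where "c = cover_arc m a"
  have c: "c \<in> semi_arcs C" unfolding c_def by (rule cover_arc_in_semi_arcs[OF a])
  have cU: "c \<subseteq> ?U" using semi_arc_subset[OF c] .
  have "c = semi_arc_at C (lift m p)" "c = semi_arc_at C (lift m' p')"
    using cover_arc_K[OF p(1,2)] cover_arc_K[OF p'(1,2)] p(3) p'(3) eq by (simp_all add: c_def)
  then have in_c: "lift m p \<in> c" "lift m' p' \<in> c"
    using lift_not_cut[OF p(1,2), of m] lift_not_cut[OF p'(1,2), of m'] mem_semi_arc_at by (metis DiffE)+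
  have "kept (lift m p) (lab m a)" "kept (lift m' p') (lab m' a')"
    using p p' unfolding kept_def by blast+
  moreover have "lift m p \<in> ?U" "lift m' p' \<in> ?U" using in_c cU by blast+
  moreover have "lab m' a' \<in> - {lab m a}" using neq by simp
  ultimately have in_F: "lift m p \<in> F" "lift m' p' \<in> F'" using F(2) F'(2) by blast+
  have cover: "c \<subseteq> F \<union> F'"
  proof
    fix x assume "x \<in> c"
    then have x: "x \<in> ?U" using cU by blast
    then obtain v where "kept x v \<or> new x v" using total by blast
    then show "x \<in> F \<union> F'" using F(2)[OF x] F'(2)[OF x] by (cases "v = lab m a") auto
  qed
  have disjoint: "F \<inter> F' \<inter> c = {}"
  proof (rule ccontr)
    assume "F \<inter> F' \<inter> c \<noteq> {}"
    then obtain x where x: "x \<in> F" "x \<in> F'" "x \<in> c" by blast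
    then have "x \<in> ?U" using cU by blast
    then obtain v where "v \<noteq> lab m a" "kept x v \<or> new x v" using F'(2) x(2) by auto
    moreover have "kept x (lab m a) \<or> new x (lab m a)" using F(2) \<open>x \<in> ?U\<close> x(1) by auto
    ultimately show False using unique by blast
  qed
  have "F \<inter> c = {} \<or> F' \<inter> c = {}"
    by (rule connected_closedD[OF connected_semi_arc[OF c] disjoint cover F(1) F'(1)])
  then show False using in_F in_c by blast
qed

text \<open>Close to the crossing, the lift of a point of \<open>a\<close> is a small rotation of
  the lifted crossing; only the direction is in question. The displacement along the tangent has the
  same value in \<open>D\<close> and in \<open>C\<close>, so its sign decides, and one such point
  identifies the semi-arc.\<close>

lemma germ_lift:
  assumes p: "p \<in> X" and \<sigma>: "\<sigma> \<in> {1, - 1}" and a: "germ D \<sigma> p a"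
  shows "germ C \<sigma> (lift m p) (cover_arc m a)"
proof -
  have pS: "p \<in> S - \<Union>(J ` bars D)" "p \<in> S" "p \<in> K" using p X_subset S_minus_J_subset by blast+
  let ?r = "lift m p"
  have r: "?r \<in> source C" using lift(1)[OF pS(3)] .
  obtain c where c: "germ C \<sigma> ?r c" using C.ex1_germ[OF r \<sigma>] by blast
  obtain \<delta>1 where \<delta>1: "\<delta>1 > 0" "\<And>s. 0 < s \<Longrightarrow> s < \<delta>1 \<Longrightarrow> shift ?r (\<sigma> * s) \<in> c"
    using c by (auto simp: germ_def eventually_at_right_field)
  let ?iC = "\<lambda>x. (curve C x - curve C ?r) \<bullet> sgn (velocity C ?r)"
  let ?iD = "\<lambda>q. (curve D q - curve D p) \<bullet> sgn (velocity D p)"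
  obtain \<delta>2 where \<delta>2: "\<delta>2 > 0" "\<And>s. s \<noteq> 0 \<Longrightarrow> \<bar>s\<bar> < \<delta>2 \<Longrightarrow> s * ?iC (shift ?r s) > 0"
    using C.curve_moves_forward[OF r] by (auto simp: eventually_at dist_real_def)
  \<comment> \<open>Both displacements are computed from strands, which agree up to the linear
    isometry \<open>side m\<close>.\<close>
  have inner_eq: "?iC (lift m q) = ?iD q" if "q \<in> K" for q
    using lift(2)[OF that, of m] lift(2)[OF pS(3), of m]
    by (simp add: strand_def side_strand_def sgn_side flip: side_diff)
  define \<delta> where "\<delta> = min \<delta>1 \<delta>2"
  have "\<delta> > 0" using \<delta>1 \<delta>2 by (simp add: \<delta>_def)
  have lim: "((\<lambda>t. shift p (\<sigma> * t)) \<longlongrightarrow> p) (at_right 0)"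
  proof -
    have "continuous_on UNIV (\<lambda>t. shift p (\<sigma> * t))" by (intro continuous_intros)
    then have "isCont (\<lambda>t. shift p (\<sigma> * t)) 0" by (simp add: continuous_on_eq_continuous_at)
    then show ?thesis
      by (intro filterlim_at_split[THEN iffD1, THEN conjunct2]) (simp add: isCont_def)
  qed
  \<comment> \<open>Crossings lie off the barred arcs, which are closed, so nearby points stay in
    \<open>K\<close> and can be lifted.\<close>
  have "open (- \<Union>(J ` bars D))"
    using D.finite_bars compact_J by (intro open_Compl closed_UN) (auto intro: compact_imp_closed)
  then have "\<forall>\<^sub>F t in at_right 0. shift p (\<sigma> * t) \<in> - \<Union>(J ` bars D)"
    by (rule topological_tendstoD[OF lim]) (use pS in blast)
  then have ev_K: "\<forall>\<^sub>F t in at_right 0. shift p (\<sigma> * t) \<in> K"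
    by eventually_elim (use pS S_minus_J_subset in auto)
  have "((\<lambda>t. lift m (shift p (\<sigma> * t))) \<longlongrightarrow> ?r) (at_right 0)"
    using continuous_on_lift lim pS(3) ev_K by (rule continuous_on_tendsto_compose)
  from eventually_compose_filterlim[OF eventually_nhds_shift[OF r \<open>\<delta> > 0\<close>] this]
  have ev_near: "\<forall>\<^sub>F t in at_right 0. lift m (shift p (\<sigma> * t)) \<in> source C \<longrightarrow>
      (\<exists>s. \<bar>s\<bar> < \<delta> \<and> lift m (shift p (\<sigma> * t)) = shift ?r s)" .
  have "filterlim (\<lambda>t. \<sigma> * t) (at 0) (at_right 0)"
  proof -
    have "((\<lambda>t. \<sigma> * t) \<longlongrightarrow> \<sigma> * 0) (at_right 0)" by (intro tendsto_intros)
    moreover have "\<forall>\<^sub>F t in at_right 0. \<sigma> * t \<noteq> 0"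
      using \<sigma> by (auto simp: eventually_at_right_field intro: exI[of _ 1])
    ultimately show ?thesis by (simp add: filterlim_at)
  qed
  from eventually_compose_filterlim[OF D.curve_moves_forward[OF pS(2)] this]
  have ev_dir: "\<forall>\<^sub>F t in at_right 0. (\<sigma> * t) * ?iD (shift p (\<sigma> * t)) > 0" .
  have ev_a: "\<forall>\<^sub>F t in at_right 0. shift p (\<sigma> * t) \<in> a" using a by (simp add: germ_def)
  have ev_pos: "\<forall>\<^sub>F t in at_right (0::real). t > 0" by (auto simp: eventually_at_right_field intro: exI[of _ 1])
  have "\<forall>\<^sub>F t in at_right 0. t > 0 \<and> shift p (\<sigma> * t) \<in> a \<and> shift p (\<sigma> * t) \<in> K \<and>
      (\<sigma> * t) * ?iD (shift p (\<sigma> * t)) > 0 \<and> (lift m (shift p (\<sigma> * t)) \<in> source C \<longrightarrow>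
      (\<exists>s. \<bar>s\<bar> < \<delta> \<and> lift m (shift p (\<sigma> * t)) = shift ?r s))"
    by (intro eventually_conj ev_pos ev_a ev_K ev_dir ev_near)
  then obtain t where "t > 0 \<and> shift p (\<sigma> * t) \<in> a \<and> shift p (\<sigma> * t) \<in> K \<and>
      (\<sigma> * t) * ?iD (shift p (\<sigma> * t)) > 0 \<and> (lift m (shift p (\<sigma> * t)) \<in> source C \<longrightarrow>
      (\<exists>s. \<bar>s\<bar> < \<delta> \<and> lift m (shift p (\<sigma> * t)) = shift ?r s))"
    using eventually_happens' trivial_limit_at_right_real by blast
  moreover define q where "q = shift p (\<sigma> * t)"
  ultimately have t: "t > 0" "q \<in> a" "q \<in> K" "(\<sigma> * t) * ?iD q > 0"
    "\<exists>s. \<bar>s\<bar> < \<delta> \<and> lift m q = shift ?r s"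
    using lift(1) by auto
  then obtain s where s: "\<bar>s\<bar> < \<delta>" "lift m q = shift ?r s" by blast
  have "?iC (shift ?r s) = ?iD q" using inner_eq[OF t(3)] s(2) by simp
  moreover from this have "s \<noteq> 0" using t(4) by auto
  ultimately have "s * ?iD q > 0" using \<delta>2(2)[of s] s(1) by (simp add: \<delta>_def)
  \<comment> \<open>\<open>s\<close> and \<open>\<sigma> * t\<close> both have the sign of
    \<open>?iD q\<close>, and \<open>t\<close> is positive.\<close>
  then have "\<sigma> * s > 0" using t(1,4) \<sigma> by (auto simp: zero_less_mult_iff mult_less_0_iff)
  moreover have "\<sigma> * s < \<delta>1" using s(1) \<sigma> by (auto simp: \<delta>_def abs_less_iff)
  moreover have "\<sigma> * (\<sigma> * s) = s" using \<sigma> by auto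
  ultimately have "lift m q \<in> c" using \<delta>1(2) s(2) by metis
  then have "c = semi_arc_at C (lift m q)" using c semi_arc_eq by (auto simp: germ_def)
  moreover have "a = semi_arc_at D q" using a t(2) semi_arc_eq by (auto simp: germ_def)
  moreover have "q \<notin> X"
    using a t(2) semi_arc_subset[of a D] cut_points_D by (auto simp: germ_def)
  ultimately show ?thesis using c cover_arc_K[OF t(3)] by simp
qed

end

section \<open>Relations at a single crossing or bar\<close>

context immersed
begin

lemma ex_germs: "p \<in> source D \<Longrightarrow> \<exists>a a'. arrives D p a \<and> leaves D p a'"
  unfolding arrives_iff_germ leaves_iff_germ using ex1_germ[of p 1] ex1_germ[of p "- 1"] by blast

lemma arrives_unique: "p \<in> source D \<Longrightarrow> arrives D p a \<Longrightarrow> arrives D p b \<Longrightarrow> b = a"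
  unfolding arrives_iff_germ using ex1_germ[of p "- 1"] by blast

lemma leaves_unique: "p \<in> source D \<Longrightarrow> leaves D p a \<Longrightarrow> leaves D p b \<Longrightarrow> b = a"
  unfolding leaves_iff_germ using ex1_germ[of p 1] by blast

text \<open>Germs exist uniquely, so the unions over all choices of semi-arcs reduce to one
  choice.\<close>

lemma
  assumes "p \<in> source D" "q \<in> source D"
    and "arrives D p a" "leaves D p a'" "arrives D q b" "leaves D q b'"
  shows upper_rel_eq: "upper_rel D (p, q) =
      {([Gen (X a')], [Gen (X a)]),
       ([Gen (X b')], if positive_crossing D (p, q)
                      then [Inv (X a), Gen (X b), Gen (X a)]
                      else [Gen (X a), Gen (X b), Inv (X a)])}"
    and lower_rel_eq: "lower_rel D (p, q) =
      {([Gen (Y a')], if positive_crossing D (p, q)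
                      then [Inv (Y b), Gen (Y a), Gen (Y b)]
                      else [Gen (Y b), Gen (Y a), Inv (Y b)]),
       ([Gen (Y b')], [Gen (Y b)])}"
proof -
  have "arrives D p c \<and> leaves D p c' \<and> arrives D q d \<and> leaves D q d' \<longleftrightarrow>
      c = a \<and> c' = a' \<and> d = b \<and> d' = b'" for c c' d d'
    using assms arrives_unique leaves_unique by metis
  note [simp] = this
  show "upper_rel D (p, q) =
      {([Gen (X a')], [Gen (X a)]),
       ([Gen (X b')], if positive_crossing D (p, q)
                      then [Inv (X a), Gen (X b), Gen (X a)]
                      else [Gen (X a), Gen (X b), Inv (X a)])}"
    unfolding upper_rel_def prod.case by simp
  show "lower_rel D (p, q) =
      {([Gen (Y a')], if positive_crossing D (p, q)
                      then [Inv (Y b), Gen (Y a), Gen (Y b)]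
                      else [Gen (Y b), Gen (Y a), Inv (Y b)]),
       ([Gen (Y b')], [Gen (Y b)])}"
    unfolding lower_rel_def prod.case by simp
qed

lemma bar_rel_eq:
  assumes "B \<in> bars D" "arrives D (bar_point D B) a" "leaves D (bar_point D B) a'"
  shows "bar_rel D B = {([Gen (X a')], [Gen (Y a)]), ([Gen (Y a')], [Gen (X a)])}"
proof -
  have b: "bar_point D B \<in> source D" using bar_point[OF assms(1)] by blast
  have "arrives D (bar_point D B) c \<and> leaves D (bar_point D B) c' \<longleftrightarrow> c = a \<and> c' = a'" for c c'
    using assms(2,3) arrives_unique[OF b] leaves_unique[OF b] by metis
  then show ?thesis unfolding bar_rel_def by simp
qed

lemma crossing_in_source:
  "(p, q) \<in> real_crossings D \<Longrightarrow> p \<in> source D \<and> q \<in> source D"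
  using crossings_subset by (auto simp: double_points_def)

end

fun cover_symbol :: "(bool \<Rightarrow> 'a \<Rightarrow> 'b) \<Rightarrow> 'a symbol \<Rightarrow> 'b symbol" where
  "cover_symbol g (X a) = X (g False a)"
| "cover_symbol g (Y a) = X (g True a)"

section \<open>The relations of the covering and the isomorphism of groups\<close>

context covering
begin

lemma crossing_X:
  assumes "c \<in> real_crossings D \<union> (real_crossings D)\<inverse>"
  shows "fst c \<in> X" "snd c \<in> X" "fst c \<in> K" "snd c \<in> K"
proof -
  have "fst c \<in> X \<and> snd c \<in> X"
    using assms unfolding X_def by (cases c) (auto intro: rev_image_eqI)
  then show "fst c \<in> X" "snd c \<in> X" "fst c \<in> K" "snd c \<in> K"
    using X_subset S_minus_J_subset by blast+
qed

text \<open>\<open>strand C\<close> is injective on the circles, so \<open>crossings_C\<close> can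
  be pulled back to them. The converse on the mirror side comes from exchanging over and
  under.\<close>

lemma real_crossings_C:
  "real_crossings C = map_prod (lift False) (lift False) ` real_crossings D \<union>
     map_prod (lift True) (lift True) ` (real_crossings D)\<inverse>"
proof -
  let ?s = "map_prod (strand C) (strand C)"
  have lift_eq: "map_prod (st m) (st m) ` R = ?s ` map_prod (lift m) (lift m) ` R"
    if R: "R \<subseteq> real_crossings D \<union> (real_crossings D)\<inverse>" for m R
    unfolding image_image
  proof (rule image_cong[OF HOL.refl])
    fix c assume "c \<in> R"
    then have "fst c \<in> K" "snd c \<in> K" using R crossing_X by blast+
    then show "map_prod (st m) (st m) c = ?s (map_prod (lift m) (lift m) c)"
      by (cases c) (simp add: lift)
  qed
  have mem: "map_prod (lift m) (lift m) ` R \<subseteq> source C \<times> source C"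
    if R: "R \<subseteq> real_crossings D \<union> (real_crossings D)\<inverse>" for m R
  proof
    fix c' assume "c' \<in> map_prod (lift m) (lift m) ` R"
    then obtain c where c: "c' = map_prod (lift m) (lift m) c" "c \<in> R" by (rule imageE)
    then have "fst c \<in> K" "snd c \<in> K" using R crossing_X by blast+
    then show "c' \<in> source C \<times> source C" using lift(1) by (cases c) (simp add: c(1))
  qed
  have inj: "inj_on ?s (source C \<times> source C)"
    using C.inj_on_strand by (auto intro!: inj_onI dest: inj_onD)
  have "?s ` real_crossings C = ?s ` (map_prod (lift False) (lift False) ` real_crossings D \<union>
     map_prod (lift True) (lift True) ` (real_crossings D)\<inverse>)"
    unfolding crossings_C image_Un[of ?s] by (simp add: lift_eq)
  then show ?thesis
    using mem C.crossing_in_source by (intro inj_on_image_eq_iff[OF inj, THEN iffD1]) auto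
qed

text \<open>On the mirror side the determinant changes sign twice, once by the reflection and once
  by the exchange of the two strands.\<close>

lemma positive_crossing_lift:
  assumes "(p, q) \<in> real_crossings D"
  shows "positive_crossing C (lift False p, lift False q) \<longleftrightarrow> positive_crossing D (p, q)"
    and "positive_crossing C (lift True q, lift True p) \<longleftrightarrow> positive_crossing D (p, q)"
proof -
  have K: "p \<in> K" "q \<in> K" using crossing_X[of "(p, q)"] assms by simp_all
  have v: "sgn (velocity C (lift m r)) = side m (sgn (velocity D r))" if "r \<in> K" for m r
    using lift(2)[OF that, of m] by (simp add: strand_def side_strand_def sgn_side)
  show "positive_crossing C (lift False p, lift False q) \<longleftrightarrow> positive_crossing D (p, q)"
    by (simp add: positive_crossing_sgn v K orientation_side)
  show "positive_crossing C (lift True q, lift True p) \<longleftrightarrow> positive_crossing D (p, q)"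
    using orientation_swap[of "sgn (velocity D p)" "sgn (velocity D q)"]
    by (simp add: positive_crossing_sgn v K orientation_side)
qed

lemma
  assumes "p \<in> X"
  shows arrives_lift: "arrives D p a \<Longrightarrow> arrives C (lift m p) (cover_arc m a)"
    and leaves_lift: "leaves D p a \<Longrightarrow> leaves C (lift m p) (cover_arc m a)"
  using germ_lift[OF assms] by (simp_all add: arrives_iff_germ leaves_iff_germ)

abbreviation "cover_word \<equiv> map (map_letter (cover_symbol cover_arc))"

lemma
  assumes "(p, q) \<in> real_crossings D"
  shows upper_rel_lift: "upper_rel C (lift False p, lift False q) = map_prod cover_word cover_word ` upper_rel D (p, q)"
    and lower_rel_lift: "upper_rel C (lift True q, lift True p) = map_prod cover_word cover_word ` lower_rel D (p, q)"
proof -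
  have X: "p \<in> X" "q \<in> X" and K: "p \<in> K" "q \<in> K" using crossing_X[of "(p, q)"] assms by simp_all
  have S: "p \<in> S" "q \<in> S" using K K_subset by blast+
  obtain a a' b b' where g: "arrives D p a" "leaves D p a'" "arrives D q b" "leaves D q b'"
    using D.ex_germs[OF S(1)] D.ex_germs[OF S(2)] by blast
  note gC = arrives_lift[OF X(1) g(1)] leaves_lift[OF X(1) g(2)] arrives_lift[OF X(2) g(3)] leaves_lift[OF X(2) g(4)]
  show "upper_rel C (lift False p, lift False q) = map_prod cover_word cover_word ` upper_rel D (p, q)"
    unfolding D.upper_rel_eq[OF S g] C.upper_rel_eq[OF lift(1)[OF K(1)] lift(1)[OF K(2)] gC]
      positive_crossing_lift(1)[OF assms] by simp
  \<comment> \<open>In the mirror image \<open>q\<close> is over, so the upper relation conjugates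
    the letter at \<open>p\<close> by the one at \<open>q\<close>, exactly as the lower relation in
    \<open>D\<close> does; hence the germs enter in the order \<open>gC(3,4,1,2)\<close>.\<close>
  show "upper_rel C (lift True q, lift True p) = map_prod cover_word cover_word ` lower_rel D (p, q)"
    unfolding D.lower_rel_eq[OF S g] C.upper_rel_eq[OF lift(1)[OF K(2)] lift(1)[OF K(1)] gC(3,4,1,2)]
      positive_crossing_lift(2)[OF assms] by auto
qed

lemma arrives_semi_arc: "arrives D p a \<Longrightarrow> a \<in> semi_arcs D"
  and leaves_semi_arc: "leaves D p a \<Longrightarrow> a \<in> semi_arcs D"
  by (simp_all add: arrives_def leaves_def)

lemma twisted_link_group_iso: "twisted_link_group D \<cong> virtual_link_group C"
proof -
  let ?G = "symbol.X ` semi_arcs D \<union> Y ` semi_arcs D"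
  let ?R1 = "\<Union>c\<in>real_crossings D. upper_rel D c \<union> lower_rel D c"
  let ?R = "?R1 \<union> (\<Union>B\<in>bars D. bar_rel D B)"
  let ?R' = "\<Union>c\<in>real_crossings C. upper_rel C c"
  have R': "?R' = map_prod cover_word cover_word ` ?R1"
  proof -
    have "?R' = (\<Union>(p, q)\<in>real_crossings D.
        upper_rel C (lift False p, lift False q) \<union> upper_rel C (lift True q, lift True p))"
      unfolding real_crossings_C by auto
    also have "\<dots> = (\<Union>(p, q)\<in>real_crossings D.
        map_prod cover_word cover_word ` upper_rel D (p, q) \<union> map_prod cover_word cover_word ` lower_rel D (p, q))"
      by (rule SUP_cong) (auto simp: upper_rel_lift lower_rel_lift)
    also have "\<dots> = map_prod cover_word cover_word ` ?R1"
      by (auto simp: image_UN image_Un case_prod_unfold)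
    finally show ?thesis .
  qed
  have R1_words: "l \<in> words ?G \<and> r \<in> words ?G" if lr: "(l, r) \<in> ?R1" for l r
  proof -
    obtain c where c: "c \<in> real_crossings D" "(l, r) \<in> upper_rel D c \<union> lower_rel D c"
      using lr by blast
    obtain p q where pq: "c = (p, q)" by (cases c)
    have S: "p \<in> S" "q \<in> S" using D.crossing_in_source c(1) pq by blast+
    obtain a a' b b' where g: "arrives D p a" "leaves D p a'" "arrives D q b" "leaves D q b'"
      using D.ex_germs[OF S(1)] D.ex_germs[OF S(2)] by blast
    have "a \<in> semi_arcs D" "a' \<in> semi_arcs D" "b \<in> semi_arcs D" "b' \<in> semi_arcs D"
      using g arrives_semi_arc leaves_semi_arc by blast+
    then show ?thesis
      using c(2) unfolding pq D.upper_rel_eq[OF S g] D.lower_rel_eq[OF S g] by (auto split: if_splits)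
  qed
  have cover_words: "cover_word w \<in> words (symbol.X ` semi_arcs C)" if "w \<in> words ?G" for w
  proof -
    have "cover_symbol cover_arc ` ?G \<subseteq> symbol.X ` semi_arcs C"
      using cover_arc_in_semi_arcs by auto
    then show ?thesis
      using words_map_letter[OF that, of "cover_symbol cover_arc"] unfolding words_def
      by (meson Un_mono image_mono lists_mono subsetD)
  qed
  \<comment> \<open>Symbols are encoded as a side with a semi-arc: negating the side exchanges the
    two symbols of a semi-arc, as passing a bar does.\<close>
  define sy :: "bool \<Rightarrow> point set \<Rightarrow> point set symbol" where "sy m a = (if m then Y a else symbol.X a)" for m a
  have bar_cong: "word_cong ?G ?R [Gen (sy m (semi_arc_at D (P B)))] [Gen (sy (\<not> m) (semi_arc_at D (Q B)))]"
    if B: "B \<in> bars D" for B m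
  proof -
    obtain \<sigma> where \<sigma>: "\<sigma> \<in> {1, - 1}" "germ D (- \<sigma>) (bar_point D B) (semi_arc_at D (P B))"
        "germ D \<sigma> (bar_point D B) (semi_arc_at D (Q B))" using germ_bar[OF B] by blast
    have rel: "word_cong ?G ?R [Gen (sy n a')] [Gen (sy (\<not> n) a)]"
      if a: "arrives D (bar_point D B) a" "leaves D (bar_point D B) a'" for a a' n
    proof -
      have "([Gen (sy n a')], [Gen (sy (\<not> n) a)]) \<in> bar_rel D B"
        unfolding D.bar_rel_eq[OF B a] by (auto simp: sy_def)
      then have "([Gen (sy n a')], [Gen (sy (\<not> n) a)]) \<in> ?R" using B by blast
      moreover have "sy n a' \<in> ?G" "sy (\<not> n) a \<in> ?G"
        using arrives_semi_arc[OF a(1)] leaves_semi_arc[OF a(2)] by (auto simp: sy_def)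
      ultimately show ?thesis
        using word_cong.relator[of "[]" ?G "[]" "[Gen (sy n a')]" "[Gen (sy (\<not> n) a)]" ?R] by simp
    qed
    \<comment> \<open>If the strand goes up, it arrives from \<open>P B\<close> and leaves towards
      \<open>Q B\<close>, and the bar relation for side \<open>\<not> m\<close> is read backwards.
      If it goes down, the ends exchange their roles and the relation for side \<open>m\<close>
      applies directly.\<close>
    from \<sigma>(1) consider "\<sigma> = 1" | "\<sigma> = - 1" by blast
    then show ?thesis
    proof cases
      case 1
      then show ?thesis
        using rel[of "semi_arc_at D (P B)" "semi_arc_at D (Q B)" "\<not> m"] \<sigma>(2,3)
        by (simp add: arrives_iff_germ leaves_iff_germ word_cong.sym)
    next
      case 2
      then show ?thesis
        using rel[of "semi_arc_at D (Q B)" "semi_arc_at D (P B)" m] \<sigma>(2,3)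
        by (simp add: arrives_iff_germ leaves_iff_germ)
    qed
  qed
  have sy_G: "sy m a \<in> ?G" if "a \<in> semi_arcs D" for m a using that by (auto simp: sy_def)
  have cover_sy: "cover_symbol cover_arc (sy m a) = symbol.X (cover_arc m a)" for m a by (simp add: sy_def)
  have G_sy: "\<exists>m a. a \<in> semi_arcs D \<and> s = sy m a" if "s \<in> ?G" for s
    using that unfolding sy_def by (metis (full_types) UnE imageE)
  \<comment> \<open>The label of a symbol is its class in the twisted link group; with this choice
    \<open>cover_arc_label\<close> turns equal images into congruent generators.\<close>
  define lab where "lab m a = word_class ?G ?R [Gen (sy m a)]" for m a
  have lab_bar: "lab m (semi_arc_at D (P B)) = lab (\<not> m) (semi_arc_at D (Q B))" if "B \<in> bars D" for B m
    using bar_cong[OF that, of m] sy_G K_minus_X(1)[OF P_K P_X, OF that that] K_minus_X(1)[OF Q_K Q_X, OF that that]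
    unfolding lab_def by (subst word_class_eq_iff) auto
  show ?thesis
    unfolding twisted_link_group_def virtual_link_group_def
  proof (rule presented_group_isoI[where f = "cover_symbol cover_arc"])
    show "cover_symbol cover_arc ` ?G = symbol.X ` semi_arcs C"
    proof
      show "cover_symbol cover_arc ` ?G \<subseteq> symbol.X ` semi_arcs C" using cover_arc_in_semi_arcs by auto
      show "symbol.X ` semi_arcs C \<subseteq> cover_symbol cover_arc ` ?G"
      proof
        fix x assume "x \<in> symbol.X ` semi_arcs C"
        then obtain c where "c \<in> semi_arcs C" "x = symbol.X c" by blast
        then obtain m a where "a \<in> semi_arcs D" "x = symbol.X (cover_arc m a)" using cover_arc_surj by metis
        then show "x \<in> cover_symbol cover_arc ` ?G" using cover_sy sy_G by (metis imageI)
      qed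
    qed
  next
    fix s s' assume "s \<in> ?G" "s' \<in> ?G" and eq: "cover_symbol cover_arc s = cover_symbol cover_arc s'"
    then obtain m a m' a' where s: "a \<in> semi_arcs D" "s = sy m a" "a' \<in> semi_arcs D" "s' = sy m' a'"
      using G_sy by meson
    then have "cover_arc m a = cover_arc m' a'" using eq cover_sy by simp
    from cover_arc_label[where lab = lab, OF lab_bar s(1,3) this] have "lab m a = lab m' a'" .
    then show "word_cong ?G ?R [Gen s] [Gen s']"
      using sy_G[OF s(1)] sy_G[OF s(3)] unfolding lab_def s(2,4) by (subst (asm) word_class_eq_iff) auto
  next
    fix l r assume lr: "(l, r) \<in> ?R" "l \<in> words ?G" "r \<in> words ?G"
    then consider "(l, r) \<in> ?R1" | B where "B \<in> bars D" "(l, r) \<in> bar_rel D B" by blast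
    then show "word_cong (symbol.X ` semi_arcs C) ?R' (cover_word l) (cover_word r)"
    proof cases
      case 1
      then have "(cover_word l, cover_word r) \<in> ?R'" 
        unfolding R' using imageI[OF 1, of "map_prod cover_word cover_word"] by (simp only: map_prod_simp)
      then show ?thesis
        using word_cong.relator[of "[]" _ "[]" "cover_word l" "cover_word r" ?R'] cover_words lr(2,3) by simp
    next
      case (2 B)
      have b: "bar_point D B \<in> S" using D.bar_point[OF 2(1)] by blast
      obtain \<sigma> where \<sigma>: "\<sigma> \<in> {1, - 1}" "germ D (- \<sigma>) (bar_point D B) (semi_arc_at D (P B))"
        "germ D \<sigma> (bar_point D B) (semi_arc_at D (Q B))" using germ_bar[OF 2(1)] by blast
      obtain a a' where a: "arrives D (bar_point D B) a" "leaves D (bar_point D B) a'"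
        "\<And>m. cover_arc m a = cover_arc (\<not> m) a'"
      proof (cases "\<sigma> = 1")
        case True
        then show thesis
          using \<sigma>(2,3) cover_arc_bar[OF 2(1)]
          by (intro that[of "semi_arc_at D (P B)" "semi_arc_at D (Q B)"])
            (simp_all add: arrives_iff_germ leaves_iff_germ)
      next
        case False
        then have "\<sigma> = - 1" using \<sigma>(1) by blast
        moreover have "cover_arc m (semi_arc_at D (Q B)) = cover_arc (\<not> m) (semi_arc_at D (P B))" for m
          using cover_arc_bar[OF 2(1), of "\<not> m"] by simp
        ultimately show thesis
          using \<sigma>(2,3)
          by (intro that[of "semi_arc_at D (Q B)" "semi_arc_at D (P B)"])
            (simp_all add: arrives_iff_germ leaves_iff_germ)
      qed
      \<comment> \<open>Bar relations become trivial, because the two symbols in each of them have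
        the same image.\<close>
      have "cover_word l = cover_word r"
        using 2(2) a(3)[of True] a(3)[of False] unfolding D.bar_rel_eq[OF 2(1) a(1,2)] by auto
      then show ?thesis using word_cong.refl[OF cover_words[OF lr(3)]] by simp
    qed
  next
    fix l' r' assume "(l', r') \<in> ?R'"
    then obtain l r where "(l, r) \<in> ?R1" "l' = cover_word l" "r' = cover_word r" unfolding R' by force
    then show "\<exists>(l, r)\<in>?R. l \<in> words ?G \<and> r \<in> words ?G \<and> l' = cover_word l \<and> r' = cover_word r"
      using R1_words by (intro bexI[of _ "(l, r)"]) auto
  qed
qed

end

section \<open>From the surgery to the data of a covering\<close>

lemma
  assumes "monotone_arc e u v"
  shows connected_arc_strands: "connected (arc_strands \<sigma> e)"
    and compact_arc_strands: "compact (arc_strands \<sigma> e)"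
    and arc_strands_range: "z \<in> arc_strands \<sigma> e \<Longrightarrow> Im (fst z) \<in> {Im u..Im v}"
    and arc_strands_bottom: "z \<in> arc_strands \<sigma> e \<Longrightarrow> Im (fst z) = Im u \<Longrightarrow> fst z = u"
    and arc_strands_top: "z \<in> arc_strands \<sigma> e \<Longrightarrow> Im (fst z) = Im v \<Longrightarrow> fst z = v"
proof -
  have e: "e C1_differentiable_on {0..1}" "strict_mono_on {0..1} (\<lambda>s. Im (e s))" "e 0 = u" "e 1 = v"
    and nonzero: "\<forall>s\<in>{0..1}. vector_derivative e (at s) \<noteq> 0"
    using assms by (auto simp: monotone_arc_def)
  have cont: "continuous_on {0..1} (\<lambda>s. (e s, \<sigma> *\<^sub>R sgn (vector_derivative e (at s))))"
  proof (intro continuous_intros continuous_on_sgn)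
    show "continuous_on {0..1} e" using e(1) by (rule C1_differentiable_imp_continuous_on)
    show "continuous_on {0..1} (\<lambda>s. vector_derivative e (at s))"
      using e(1) unfolding C1_differentiable_on_eq by (rule conjunct2)
  qed (rule nonzero)
  show "connected (arc_strands \<sigma> e)" "compact (arc_strands \<sigma> e)"
    unfolding arc_strands_def
    using connected_continuous_image[OF cont] compact_continuous_image[OF cont] by auto
  \<comment> \<open>By strict monotonicity the end heights are attained only at the ends of the
    parameter interval.\<close>
  have mono: "Im u \<le> Im (e s) \<and> Im (e s) \<le> Im v \<and> (Im (e s) = Im u \<longrightarrow> s = 0) \<and> (Im (e s) = Im v \<longrightarrow> s = 1)"
    if "s \<in> {0..1}" for s
    using strict_mono_onD[OF e(2), of 0 s] strict_mono_onD[OF e(2), of s 1] that e(3,4)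
    by (cases "s = 0"; cases "s = 1") auto
  assume "z \<in> arc_strands \<sigma> e"
  then obtain s where s: "s \<in> {0..1}" "fst z = e s" by (auto simp: arc_strands_def)
  show "Im (fst z) \<in> {Im u..Im v}" using mono[OF s(1)] s(2) by simp
  show "fst z = u" if "Im (fst z) = Im u" using mono[OF s(1)] s(2) that e(3) by auto
  show "fst z = v" if "Im (fst z) = Im v" using mono[OF s(1)] s(2) that e(4) by auto
qed

lemma mirror_simps [simp]:
  "ncircles (mirror D) = ncircles D" "source (mirror D) = source D"
  "curve (mirror D) p = reflect (curve D p)" "real_crossings (mirror D) = (real_crossings D)\<inverse>"
  by (simp_all add: mirror_def switch_crossings_def map_diagram_def source_def)

lemma reflect_eq_side: "reflect = side True"
  by (rule ext) (simp add: side_def)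

context immersed
begin

lemma velocity_mirror:
  assumes "p \<in> source D"
  shows "velocity (mirror D) p = reflect (velocity D p)"
proof -
  have "((\<lambda>t. curve D (shift p t)) has_vector_derivative velocity D p) (at 0)"
    using has_vector_derivative_curve[OF assms, of 0] by simp
  then have "((\<lambda>t. reflect (curve D (shift p t))) has_vector_derivative reflect (velocity D p)) (at 0)"
    unfolding reflect_eq_side
    by (rule bounded_linear.has_vector_derivative[OF linear_side[unfolded linear_conv_bounded_linear]])
  then show ?thesis by (simp add: velocity_def vector_derivative_at)
qed

lemma strand_mirror: "p \<in> source D \<Longrightarrow> strand (mirror D) p = side_strand D True p"
  by (simp add: strand_def side_strand_def velocity_mirror side_def)

lemma strand_eq_side_strand: "strand D p = side_strand D False p"
  by (simp add: strand_def side_strand_def side_def)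

lemma inj_on_side_strand: "inj_on (side_strand D m) (source D)"
proof (rule inj_onI)
  fix p q assume "p \<in> source D" "q \<in> source D" "side_strand D m p = side_strand D m q"
  then have "strand D p = strand D q" by (simp add: side_strand_def strand_def sgn_side)
  then show "p = q" using inj_on_strand \<open>p \<in> source D\<close> \<open>q \<in> source D\<close> by (auto dest: inj_onD)
qed

lemma crossing_in_double_points:
  assumes "p \<in> fst ` real_crossings D \<union> snd ` real_crossings D"
  shows "p \<in> fst ` double_points D"
proof -
  from assms obtain c where c: "c \<in> real_crossings D" "p = fst c \<or> p = snd c" by blast
  then have "c \<in> double_points D" using crossings_subset by blast
  then have "(fst c, snd c) \<in> double_points D" "(snd c, fst c) \<in> double_points D"
    by (cases c, auto simp: double_points_def)+
  with c(2) show ?thesis by (metis fst_conv imageI)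
qed

lemma barred_arc_subset: "barred_arc D B l u \<subseteq> {p \<in> source D. curve D p \<in> strip l u}"
  unfolding barred_arc_def by (rule connected_component_subset)

text \<open>The facts about barred arcs come from \<open>barred_arc_ends\<close>. What remains is to
  match the surgery with them, where \<open>e B\<close> becomes the arc starting on side
  \<open>False\<close> and \<open>f B\<close> the one starting on side \<open>True\<close>.\<close>

lemma covering_surgery_imp_covering:
  assumes C: "immersed C" "bars C = {}"
    and right: "in_right_half_plane D"
    and surgery: "covering_surgery D C"
  obtains lo hi P Q A where "covering D C lo hi P Q A"
proof -
  obtain lo hi e f where
      "\<forall>B\<in>bars D. thin_strip D B (lo B) (hi B)"
    and disjoint_strips: "pairwise (\<lambda>B B'. disjnt (strip (lo B) (hi B)) (strip (lo B') (hi B'))) (bars D)"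
    and "\<forall>B\<in>bars D. \<exists>p\<in>barred_arc D B (lo B) (hi B). \<exists>q\<in>barred_arc D B (lo B) (hi B).
        Im (curve D p) = lo B \<and> Im (curve D q) = hi B \<and>
        monotone_arc (e B) (curve D p) (reflect (curve D q)) \<and>
        monotone_arc (f B) (reflect (curve D p)) (curve D q)"
    and rest: "let \<sigma> = (\<lambda>B. sgn (Im (velocity D (bar_point D B))));
          E = (\<lambda>B. arc_strands (\<sigma> B) (e B));
          F = (\<lambda>B. arc_strands (\<sigma> B) (f B));
          kept = (\<Union>D'\<in>{D, mirror D}.
                    strand D' ` source D - (\<Union>B\<in>bars D. strand D' ` barred_arc D B (lo B) (hi B)))
      in (\<forall>B\<in>bars D. disjnt (E B) (F B) \<and> disjnt kept (E B \<union> F B)) \<and>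
         strand C ` source C = kept \<union> (\<Union>B\<in>bars D. E B \<union> F B)"
    and crossings: "map_prod (strand C) (strand C) ` real_crossings C =
       (\<Union>D'\<in>{D, mirror D}. map_prod (strand D') (strand D') ` real_crossings D')"
    using surgery unfolding covering_surgery_def by (elim exE conjE) (rule that)
  then have thin: "\<And>B. B \<in> bars D \<Longrightarrow> thin_strip D B (lo B) (hi B)"
    and arcs: "\<And>B. B \<in> bars D \<Longrightarrow>
      \<exists>p\<in>barred_arc D B (lo B) (hi B). \<exists>q\<in>barred_arc D B (lo B) (hi B).
        Im (curve D p) = lo B \<and> Im (curve D q) = hi B \<and>
        monotone_arc (e B) (curve D p) (reflect (curve D q)) \<and>
        monotone_arc (f B) (reflect (curve D p)) (curve D q)"
    by simp_all
  define J where "J B = barred_arc D B (lo B) (hi B)" for B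
  define h where "h p = Im (curve D p)" for p
  define A where "A B m = arc_strands (sgn (Im (velocity D (bar_point D B)))) (if m then f B else e B)" for B m
  define kept where "kept = (\<Union>m. side_strand D m ` (source D - \<Union>(J ` bars D)))"
  have positive: "Re (curve D p) > 0" if "p \<in> source D" for p
    using right that by (auto simp: in_right_half_plane_def)
  have strips: "B = B'" if "B \<in> bars D" "B' \<in> bars D" "y \<in> {lo B..hi B}" "y \<in> {lo B'..hi B'}" for B B' y
  proof (rule ccontr)
    assume "B \<noteq> B'"
    then have "disjnt (strip (lo B) (hi B)) (strip (lo B') (hi B'))"
      using disjoint_strips that(1,2) by (auto simp: pairwise_def)
    moreover have "Complex 0 y \<in> strip (lo B) (hi B)" "Complex 0 y \<in> strip (lo B') (hi B')"
      using that(3,4) by (simp_all add: strip_def)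
    ultimately show False by (auto simp: disjnt_def)
  qed
  have J_sub: "J B \<subseteq> source D" for B using barred_arc_subset by (auto simp: J_def)
  have h_J: "h p \<in> {lo B..hi B}" if "p \<in> J B" for p B
    using barred_arc_subset that by (auto simp: J_def h_def strip_def)
  have b: "bar_point D B \<in> source D" "lo B < h (bar_point D B)" "h (bar_point D B) < hi B"
    if "B \<in> bars D" for B
    using thin[OF that] bar_point[OF that] by (auto simp: thin_strip_def h_def)
  have not_strip: "curve D p \<notin> strip (lo B) (hi B)"
    if "B \<in> bars D" "p \<in> critical_points D \<union> fst ` double_points D" for B p
    using thin[OF that(1)] that(2) by (auto simp: thin_strip_def)
  have not_cut: "curve D p \<notin> strip (lo B) (hi B)"
    if B: "B \<in> bars D" and p: "p \<in> cut_points D" "p \<noteq> bar_point D B" for B p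
  proof (cases "p \<in> fst ` real_crossings D \<union> snd ` real_crossings D")
    case True
    then show ?thesis using not_strip[OF B] crossing_in_double_points by blast
  next
    case False
    then obtain B' where B': "B' \<in> bars D" "p = bar_point D B'" using p(1) by (auto simp: cut_points_def)
    have "B' \<noteq> B" using p(2) B'(2) by blast
    \<comment> \<open>\<open>thin_strip\<close> exempts the mirror image of \<open>B\<close>. A bar
      of \<open>D\<close> cannot be this image, since both its bar point and all of \<open>B\<close>
      lie in the right half-plane.\<close>
    moreover have "B' \<noteq> reflect ` B"
    proof
      assume eq: "B' = reflect ` B"
      have "curve D p \<in> B'" "Re (curve D p) > 0" using bar_point[OF B'(1)] B'(2) positive by auto
      then obtain z where "z \<in> B" "Re (reflect z) > 0" using eq by auto
      moreover have "Re z > 0" using right B \<open>z \<in> B\<close> by (auto simp: in_right_half_plane_def)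
      ultimately show False by (simp add: reflect_def)
    qed
    ultimately have "B' \<inter> strip (lo B) (hi B) = {}"
      using thin[OF B] B'(1) unfolding thin_strip_def by blast
    then show ?thesis using bar_point[OF B'(1)] B'(2) by blast
  qed
  define ends where "ends B P Q \<longleftrightarrow>
      P \<in> J B \<and> Q \<in> J B \<and> h P = lo B \<and> h Q = hi B \<and> inj_on h (J B) \<and> compact (J B) \<and>
      openin (top_of_set (source D)) (J B - {P, Q}) \<and>
      P \<in> closure (source D - J B) \<and> Q \<in> closure (source D - J B) \<and>
      (\<exists>\<sigma>\<in>{1, - 1}. germ D (- \<sigma>) (bar_point D B) (semi_arc_at D P) \<and>
        germ D \<sigma> (bar_point D B) (semi_arc_at D Q)) \<and>
      (\<forall>p\<in>J B. (h p < h (bar_point D B) \<longrightarrow> semi_arc_at D p = semi_arc_at D P) \<and>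
        (h p > h (bar_point D B) \<longrightarrow> semi_arc_at D p = semi_arc_at D Q))" for B P Q
  have "\<exists>P Q. ends B P Q" if B: "B \<in> bars D" for B
  proof -
    obtain P Q \<sigma> where "\<sigma> \<in> {1, - 1}"
      "P \<in> J B" "Q \<in> J B" "h P = lo B" "h Q = hi B" "inj_on h (J B)" "compact (J B)" "J B \<subseteq> source D"
      "openin (top_of_set (source D)) (J B - {P, Q})"
      "P \<in> closure (source D - J B)" "Q \<in> closure (source D - J B)"
      "germ D (- \<sigma>) (bar_point D B) (semi_arc_at D P)" "germ D \<sigma> (bar_point D B) (semi_arc_at D Q)"
      "\<And>p. p \<in> J B \<Longrightarrow> h p < h (bar_point D B) \<Longrightarrow> semi_arc_at D p = semi_arc_at D P"
      "\<And>p. p \<in> J B \<Longrightarrow> h p > h (bar_point D B) \<Longrightarrow> semi_arc_at D p = semi_arc_at D Q"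
      unfolding J_def h_def
      by (rule barred_arc_ends[OF B b(2)[OF B, unfolded h_def] b(3)[OF B, unfolded h_def]])
        (use not_strip[OF B] not_cut[OF B] in auto)
    then have "ends B P Q" unfolding ends_def by blast
    then show ?thesis by blast
  qed
  then obtain P Q where PQ: "\<And>B. B \<in> bars D \<Longrightarrow> ends B (P B) (Q B)" by metis
  have monotone: "monotone_arc (if m then f B else e B) (side m (curve D (P B))) (side (\<not> m) (curve D (Q B)))"
    if B: "B \<in> bars D" for B m
  proof -
    obtain p q where pq: "p \<in> J B" "q \<in> J B" "h p = lo B" "h q = hi B"
        "monotone_arc (e B) (curve D p) (reflect (curve D q))"
        "monotone_arc (f B) (reflect (curve D p)) (curve D q)"
      using arcs[OF B] unfolding J_def h_def by blast
    \<comment> \<open>The surgery names its own ends; height is injective on the barred arc, so they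
      are \<open>P B\<close> and \<open>Q B\<close>.\<close>
    have "p = P B" "q = Q B"
      using PQ[OF B] pq(1-4) unfolding ends_def by (metis inj_onD)+
    with pq show ?thesis by (simp add: side_def)
  qed
  have kept_eq: "(\<Union>D'\<in>{D, mirror D}.
      strand D' ` source D - (\<Union>B\<in>bars D. strand D' ` barred_arc D B (lo B) (hi B))) = kept"
  proof -
    \<comment> \<open>By injectivity, removing the strands of the barred arcs amounts to removing
      their points.\<close>
    have diff: "side_strand D m ` source D - (\<Union>B\<in>bars D. side_strand D m ` J B) =
        side_strand D m ` (source D - \<Union>(J ` bars D))" for m
      using J_sub by (subst inj_on_image_set_diff[OF inj_on_side_strand]) (auto simp: image_UN)
    have "strand (mirror D) ` S = side_strand D True ` S" if "S \<subseteq> source D" for S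
      using that strand_mirror by (intro image_cong) auto
    moreover have "strand D = side_strand D False" by (rule ext) (rule strand_eq_side_strand)
    ultimately show ?thesis
      unfolding kept_def UNIV_bool by (simp add: diff J_sub Un_commute flip: J_def)
  qed
  have surgered: "\<forall>B\<in>bars D. disjnt (A B False) (A B True) \<and> disjnt kept (A B False \<union> A B True)"
      "strand C ` source C = kept \<union> (\<Union>B\<in>bars D. A B False \<union> A B True)"
    using rest[unfolded Let_def kept_eq] unfolding A_def by simp_all
  have ends: "P B \<in> J B" "Q B \<in> J B" "h (P B) = lo B" "h (Q B) = hi B" "inj_on h (J B)" "compact (J B)"
      "openin (top_of_set (source D)) (J B - {P B, Q B})"
      "P B \<in> closure (source D - J B)" "Q B \<in> closure (source D - J B)"
      "\<exists>\<sigma>\<in>{1, - 1}. germ D (- \<sigma>) (bar_point D B) (semi_arc_at D (P B)) \<and>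
        germ D \<sigma> (bar_point D B) (semi_arc_at D (Q B))"
      "\<And>p. p \<in> J B \<Longrightarrow> h p < h (bar_point D B) \<Longrightarrow> semi_arc_at D p = semi_arc_at D (P B)"
      "\<And>p. p \<in> J B \<Longrightarrow> h p > h (bar_point D B) \<Longrightarrow> semi_arc_at D p = semi_arc_at D (Q B)"
    if "B \<in> bars D" for B
    using PQ[OF that] unfolding ends_def by simp_all
  have bar_J: "bar_point D B \<in> J B" if "B \<in> bars D" for B
    using b[OF that] by (simp add: J_def barred_arc_def strip_def h_def)
  have cut_J: "cut_points D \<inter> J B = {bar_point D B}" if B: "B \<in> bars D" for B
  proof -
    have "p = bar_point D B" if "p \<in> cut_points D" "p \<in> J B" for p
      using not_cut[OF B that(1)] barred_arc_subset that(2) unfolding J_def by blast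
    moreover have "bar_point D B \<in> cut_points D" using B by (simp add: cut_points_def)
    ultimately show ?thesis using bar_J[OF B] by blast
  qed
  have X_J: "(fst ` real_crossings D \<union> snd ` real_crossings D) \<inter> J B = {}" if B: "B \<in> bars D" for B
  proof (rule ccontr)
    assume "(fst ` real_crossings D \<union> snd ` real_crossings D) \<inter> J B \<noteq> {}"
    then obtain p where p: "p \<in> fst ` real_crossings D \<union> snd ` real_crossings D" "p \<in> J B" by blast
    have "p \<in> fst ` double_points D" using crossing_in_double_points[OF p(1)] .
    moreover have "curve D p \<in> strip (lo B) (hi B)" using p(2) barred_arc_subset unfolding J_def by blast
    ultimately show False using not_strip[OF B] by blast
  qed
  have A: "connected (A B m)" "compact (A B m)"
      "\<And>z. z \<in> A B m \<Longrightarrow> Im (fst z) \<in> {lo B..hi B}"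
      "\<And>z. z \<in> A B m \<Longrightarrow> Im (fst z) = lo B \<Longrightarrow> fst z = side m (curve D (P B))"
      "\<And>z. z \<in> A B m \<Longrightarrow> Im (fst z) = hi B \<Longrightarrow> fst z = side (\<not> m) (curve D (Q B))"
    if B: "B \<in> bars D" for B m
    using connected_arc_strands[OF monotone[OF B]] compact_arc_strands[OF monotone[OF B]]
      arc_strands_range[OF monotone[OF B]] arc_strands_bottom[OF monotone[OF B]]
      arc_strands_top[OF monotone[OF B]] ends(3,4)[OF B]
    by (simp_all add: A_def h_def)
  have A_UN: "(\<Union>m. A B m) = A B False \<union> A B True" for B by (simp add: UNIV_bool Un_commute)
  have kept_A: "side_strand D m p \<notin> A B m'"
    if B: "B \<in> bars D" and p: "p \<in> source D" "\<And>B'. B' \<in> bars D \<Longrightarrow> p \<notin> J B'" for B p m m'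
  proof -
    have "side_strand D m p \<in> kept" unfolding kept_def using p by blast
    moreover have "A B m' \<subseteq> A B False \<union> A B True" by (cases m') auto
    ultimately show ?thesis using surgered(1) B by (auto simp: disjnt_def)
  qed
  have crossings': "map_prod (strand C) (strand C) ` real_crossings C =
      map_prod (side_strand D False) (side_strand D False) ` real_crossings D \<union>
      map_prod (side_strand D True) (side_strand D True) ` (real_crossings D)\<inverse>"
  proof -
    have "map_prod (strand (mirror D)) (strand (mirror D)) ` (real_crossings D)\<inverse> =
        map_prod (side_strand D True) (side_strand D True) ` (real_crossings D)\<inverse>"
    proof (rule image_cong[OF HOL.refl])
      fix c assume "c \<in> (real_crossings D)\<inverse>"
      then have "fst c \<in> source D" "snd c \<in> source D"
        using crossings_subset by (cases c, auto simp: double_points_def)+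
      then show "map_prod (strand (mirror D)) (strand (mirror D)) c =
          map_prod (side_strand D True) (side_strand D True) c"
        by (cases c) (simp add: strand_mirror)
    qed
    moreover have "strand D = side_strand D False" by (rule ext) (rule strand_eq_side_strand)
    ultimately show ?thesis unfolding crossings by simp
  qed
  have "covering D C lo hi P Q A"
  proof (rule covering.intro[OF immersed_axioms C(1)],
      rule covering_axioms.intro; (unfold J_def[symmetric] h_def[symmetric])?)
    show "strand C ` source C =
      (\<Union>m. side_strand D m ` (source D - \<Union>(J ` bars D))) \<union> (\<Union>B\<in>bars D. \<Union>m. A B m)"
      unfolding A_UN using surgered(2) by (simp add: kept_def)
    show "A B False \<inter> A B True = {}" if "B \<in> bars D" for B
      using surgered(1) that by (auto simp: disjnt_def)
    show "B = B'" if "B \<in> bars D" "B' \<in> bars D" "y \<in> {lo B..hi B}" "y \<in> {lo B'..hi B'}" for B B' y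
      using strips that .
  qed (fact positive C(2) ends cut_J X_J A kept_A crossings' | use b in blast)+
  then show thesis by (rule that)
qed

end

theorem theorem6p1:
  fixes D Dt :: diagram
  assumes "twisted_link_diagram D"
    and "double_covering_diagram D Dt"
  shows "twisted_link_group D \<cong> virtual_link_group Dt"
proof -
  have D: "immersed D" using assms(1) by (rule twisted_link_diagram_imp_immersed)
  have Dt: "immersed Dt" "bars Dt = {}"
    using assms(2) twisted_link_diagram_imp_immersed
    by (simp_all add: double_covering_diagram_def virtual_link_diagram_def)
  obtain H where H: "plane_isotopy H" "in_right_half_plane (map_diagram (H 1) D)"
      "covering_surgery (map_diagram (H 1) D) Dt"
    using assms(2) by (auto simp: double_covering_diagram_def Let_def)
  obtain f' where f': "orientation_preserving_diffeo (H 1) f'"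
    using plane_isotopy_diffeo[OF H(1)] .
  have D': "immersed (map_diagram (H 1) D)"
    using orientation_preserving_diffeo.immersed_map[OF f' D] .
  obtain lo hi P Q A where "covering (map_diagram (H 1) D) Dt lo hi P Q A"
    using immersed.covering_surgery_imp_covering[OF D' Dt H(2,3)] .
  then have "twisted_link_group (map_diagram (H 1) D) \<cong> virtual_link_group Dt"
    by (rule covering.twisted_link_group_iso)
  then show ?thesis
    unfolding orientation_preserving_diffeo.twisted_link_group_map[OF f' D] .
qed

end
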